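(* Let $\Omega\subset\mathbb{R}^3$ be a bounded domain with sufficiently smooth boundary, and let $h\in L^2(\Omega)$, $f\in C(\mathbb{R})$ satisfy, for some constants $C_1,C_2,\alpha>0$, $$|f(u)|\le C_1(1+|u|^3),\qquad f(u)u\ge \alpha|u|^4-C_2,\qquad \forall u\in\mathbb{R}.$$ Let $\Theta_r$ be the global compact attractor in $L^2(\Omega)$ of the multivalued semiflow $G_r$ generated by the regular solutions, and $\Theta_s$ the global compact attractor in $H_0^1(\Omega)$ of the multivalued semiflow $G_s$ generated by the strong solutions, of $u_t-\Delta u+f(u)=h$, $u|_{\partial\Omega}=0$. Then $\Theta_s=\Theta_r$.
   Context: Notation: $(\cdot,\cdot)$ is the scalar product of $L^2(\Omega)$ (also the corresponding duality pairings); $(u,v)_{H_0^1(\Omega)}=\int_\Omega\nabla u\cdot\nabla v\,dx$, with norm $\|u\|_{H_0^1(\Omega)}$. $L^p_{loc}(0,+\infty;X)$ denotes the functions belonging to $L^p(0,T;X)$ for every $T>0$. For sets $A,B$ in a normed space $X$, $\mathrm{dist}_X(A,B)=\sup_{x\in A}\inf_{y\in B}\|x-y\|_X$. Weak solution: $u\in L^2_{loc}(0,+\infty;H_0^1(\Omega))\cap L^4_{loc}(0,+\infty;L^4(\Omega))$ such that for all $T>0$, $v\in H_0^1(\Omega)$, $\eta\in C_0^\infty(0,T)$, $$-\int_0^T(u,v)\eta_t\,dt+\int_0^T\big((u,v)_{H_0^1(\Omega)}+(f(u),v)-(h,v)\big)\eta\,dt=0.$$ Weak solutions are known to belong to $C([0,+\infty);L^2(\Omega))$.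 A weak solution is a regular solution if $u\in L^\infty(\varepsilon,T;H_0^1(\Omega))$ and $u_t\in L^2(\varepsilon,T;L^2(\Omega))$ for all $0<\varepsilon<T$; it is a strong solution if $u\in L^\infty(0,T;H_0^1(\Omega))$ and $u_t\in L^2(0,T;L^2(\Omega))$ for all $T>0$. Strong solutions belong to $C([0,+\infty);H_0^1(\Omega))$. Let $K_r^+$, $K_s^+$ be the sets of all regular, respectively strong, solutions, and $G_r(t,u_0)=\{u(t):u\in K_r^+,\ u(0)=u_0\}$ for $u_0\in L^2(\Omega)$, $G_s(t,u_0)=\{u(t):u\in K_s^+,\ u(0)=u_0\}$ for $u_0\in H_0^1(\Omega)$, $t\ge0$. Global attractor of a multivalued semiflow $G$ on the phase space $X$ ($X=L^2(\Omega)$ for $G_r$, $X=H_0^1(\Omega)$ for $G_s$): a set $\Theta\subset X$ such that (1) $\Theta\subset G(t,\Theta)$ for all $t\ge0$; (2) for every bounded $B\subset X$, $\mathrm{dist}_X(G(t,B),\Theta)\to0$ as $t\to+\infty$; (3) $\Theta$ is contained in every closed set $C\subset X$ having the attraction property (2). Under the stated conditions both $G_r$ and $G_s$ possess global attractors, compact in their respective phase spaces. *)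

theory Defs
  imports "HOL-Analysis.Analysis"
begin

section \<open>Square-integrable functions modulo almost-everywhere equality\<close>

definition square_integrable :: "('a::euclidean_space \<Rightarrow> real) \<Rightarrow> bool" where
  "square_integrable u \<longleftrightarrow> u \<in> borel_measurable lebesgue \<and> integrable lebesgue (\<lambda>x. (u x)\<^sup>2)"

definition l2_rel :: "('a::euclidean_space \<Rightarrow> real) \<Rightarrow> ('a \<Rightarrow> real) \<Rightarrow> bool" where
  "l2_rel u v \<longleftrightarrow> square_integrable u \<and> square_integrable v \<and> (AE x in lebesgue. u x = v x)"

lemma square_integrable_zero: "square_integrable (\<lambda>_. 0)"
  by (simp add: square_integrable_def)

lemma square_integrable_scale: "square_integrable u \<Longrightarrow> square_integrable (\<lambda>x. c * u x)"
  by (auto simp: square_integrable_def power_mult_distrib intro!: borel_measurable_times)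

lemma square_integrable_mult:
  assumes "square_integrable u" "square_integrable v"
  shows "integrable lebesgue (\<lambda>x. u x * v x)"
proof (rule Bochner_Integration.integrable_bound)
  show "integrable lebesgue (\<lambda>x. (u x)\<^sup>2 + (v x)\<^sup>2)"
    using assms by (auto simp: square_integrable_def)
  show "(\<lambda>x. u x * v x) \<in> borel_measurable lebesgue"
    using assms by (auto simp: square_integrable_def)
  have "\<bar>a * b\<bar> \<le> a\<^sup>2 + b\<^sup>2" for a b :: real
  proof -
    have "2 * \<bar>a * b\<bar> \<le> a\<^sup>2 + b\<^sup>2"
      using sum_squares_bound[of "\<bar>a\<bar>" "\<bar>b\<bar>"] by (simp add: abs_mult)
    then show ?thesis by linarith
  qed
  then show "AE x in lebesgue. norm (u x * v x) \<le> norm ((u x)\<^sup>2 + (v x)\<^sup>2)"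
    by simp
qed

lemma square_integrable_add:
  assumes "square_integrable u" "square_integrable v"
  shows "square_integrable (\<lambda>x. u x + v x)"
  using assms square_integrable_mult[OF assms]
  by (auto simp: square_integrable_def power2_sum mult.assoc)

lemma square_integrable_diff:
  assumes "square_integrable u" "square_integrable v"
  shows "square_integrable (\<lambda>x. u x - v x)"
  using square_integrable_add[OF assms(1) square_integrable_scale[OF assms(2), of "-1"]] by simp

quotient_type (overloaded) 'a l2 = "'a::euclidean_space \<Rightarrow> real" / partial: l2_rel
proof (rule part_equivpI)
  show "\<exists>u::'a \<Rightarrow> real. l2_rel u u"
    using square_integrable_zero by (auto simp: l2_rel_def)
  show "symp (l2_rel :: ('a \<Rightarrow> real) \<Rightarrow> _)"
    by (auto simp: symp_def l2_rel_def elim: eventually_mono)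
  show "transp (l2_rel :: ('a \<Rightarrow> real) \<Rightarrow> _)"
  proof (rule transpI)
    fix u v w :: "'a \<Rightarrow> real"
    assume uv: "l2_rel u v" and vw: "l2_rel v w"
    have "AE x in lebesgue. u x = v x" "AE x in lebesgue. v x = w x"
      using uv vw by (auto simp: l2_rel_def)
    then have "AE x in lebesgue. u x = w x" by eventually_elim simp
    with uv vw show "l2_rel u w" by (simp add: l2_rel_def)
  qed
qed

instantiation l2 :: (euclidean_space) real_vector
begin

lift_definition zero_l2 :: "'a l2" is "\<lambda>_. 0"
  by (simp add: l2_rel_def square_integrable_zero)

lift_definition plus_l2 :: "'a l2 \<Rightarrow> 'a l2 \<Rightarrow> 'a l2" is "\<lambda>u v x. u x + v x"
  unfolding l2_rel_def by (auto intro: square_integrable_add elim: eventually_elim2)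

lift_definition minus_l2 :: "'a l2 \<Rightarrow> 'a l2 \<Rightarrow> 'a l2" is "\<lambda>u v x. u x - v x"
  unfolding l2_rel_def by (auto intro: square_integrable_diff elim: eventually_elim2)

lift_definition uminus_l2 :: "'a l2 \<Rightarrow> 'a l2" is "\<lambda>u x. - u x"
  unfolding l2_rel_def using square_integrable_scale[where c = "-1"] by (auto elim: eventually_mono)

lift_definition scaleR_l2 :: "real \<Rightarrow> 'a l2 \<Rightarrow> 'a l2" is "\<lambda>c u x. c * u x"
  unfolding l2_rel_def by (auto intro: square_integrable_scale elim: eventually_mono)

instance
proof
  fix u v w :: "'a l2" and a b :: real
  show "u + v + w = u + (v + w)"
    by transfer (auto simp: l2_rel_def add.assoc intro!: square_integrable_add)
  show "u + v = v + u"
    by transfer (auto simp: l2_rel_def add.commute intro!: square_integrable_add)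
  show "0 + u = u" by transfer (auto simp: l2_rel_def)
  show "- u + u = 0"
    by transfer (auto simp: l2_rel_def square_integrable_zero)
  show "u - v = u + - v"
    by transfer (auto simp: l2_rel_def intro!: square_integrable_diff)
  show "a *\<^sub>R (u + v) = a *\<^sub>R u + a *\<^sub>R v"
    by transfer (auto simp: l2_rel_def distrib_left
          intro!: square_integrable_add square_integrable_scale)
  show "(a + b) *\<^sub>R u = a *\<^sub>R u + b *\<^sub>R u"
    by transfer (auto simp: l2_rel_def distrib_right
          intro!: square_integrable_add square_integrable_scale)
  show "a *\<^sub>R b *\<^sub>R u = (a * b) *\<^sub>R u"
    by transfer (auto simp: l2_rel_def mult.assoc intro!: square_integrable_scale)
  show "1 *\<^sub>R u = u" by transfer (auto simp: l2_rel_def)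
qed

end

instantiation l2 :: (euclidean_space) real_inner
begin

lift_definition inner_l2 :: "'a l2 \<Rightarrow> 'a l2 \<Rightarrow> real" is "\<lambda>u v. LINT x|lebesgue. u x * v x"
proof -
  fix u u' v v' :: "'a \<Rightarrow> real"
  assume uu': "l2_rel u u'" and vv': "l2_rel v v'"
  have "AE x in lebesgue. u x = u' x" "AE x in lebesgue. v x = v' x"
    using uu' vv' by (auto simp: l2_rel_def)
  then have "AE x in lebesgue. u x * v x = u' x * v' x" by eventually_elim simp
  then show "(LINT x|lebesgue. u x * v x) = (LINT x|lebesgue. u' x * v' x)"
    using uu' vv' by (intro integral_cong_AE) (auto simp: l2_rel_def square_integrable_def)
qed

definition norm_l2 :: "'a l2 \<Rightarrow> real" where "norm_l2 u = sqrt (inner u u)"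
definition dist_l2 :: "'a l2 \<Rightarrow> 'a l2 \<Rightarrow> real" where "dist_l2 u v = norm (u - v)"
definition sgn_l2 :: "'a l2 \<Rightarrow> 'a l2" where "sgn_l2 u = u /\<^sub>R norm u"
definition uniformity_l2 :: "('a l2 \<times> 'a l2) filter" where
  "uniformity_l2 = (INF e\<in>{0<..}. principal {(x, y). dist x y < e})"
definition open_l2 :: "'a l2 set \<Rightarrow> bool" where
  "open_l2 U \<longleftrightarrow> (\<forall>x\<in>U. \<forall>\<^sub>F (x', y) in uniformity. x' = x \<longrightarrow> y \<in> U)"

instance
proof
  fix u v w :: "'a l2" and a :: real and U :: "'a l2 set"
  show "dist u v = norm (u - v)" by (rule dist_l2_def)
  show "sgn u = u /\<^sub>R norm u" by (rule sgn_l2_def)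
  show "uniformity = (INF e\<in>{0<..}. principal {(x, y). dist (x::'a l2) y < e})"
    by (rule uniformity_l2_def)
  show "open U = (\<forall>x\<in>U. \<forall>\<^sub>F (x', y) in uniformity. x' = x \<longrightarrow> y \<in> U)"
    by (rule open_l2_def)
  show "inner u v = inner v u" by transfer (simp add: mult.commute)
  show "inner (u + v) w = inner u w + inner v w"
    by transfer (simp add: l2_rel_def distrib_right square_integrable_mult)
  show "inner (a *\<^sub>R u) v = a * inner u v"
    by transfer (simp add: mult.assoc)
  show "0 \<le> inner u u" by transfer simp
  show "inner u u = 0 \<longleftrightarrow> u = 0"
  proof (transfer)
    fix u :: "'a \<Rightarrow> real"
    assume u: "l2_rel u u"
    then have "integrable lebesgue (\<lambda>x. u x * u x)"
      by (auto simp: l2_rel_def square_integrable_mult)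
    then have "(LINT x|lebesgue. u x * u x) = 0 \<longleftrightarrow> (AE x in lebesgue. u x * u x = 0)"
      by (intro integral_nonneg_eq_0_iff_AE) auto
    then show "(LINT x|lebesgue. u x * u x) = 0 \<longleftrightarrow> l2_rel u (\<lambda>_. 0)"
      using u by (simp add: l2_rel_def square_integrable_zero)
  qed
  show "norm u = sqrt (inner u u)" by (rule norm_l2_def)
qed

end


section \<open>Function spaces on a domain\<close>

text \<open>
  An element of \<open>L\<^sup>2(\<Omega>)\<close> is identified with its extension by zero, so the scalar product
  of \<open>L\<^sup>2(\<Omega>)\<close> is the restriction of the scalar product of the type \<open>'a l2\<close>.
\<close>

definition L2 :: "'a::euclidean_space set \<Rightarrow> 'a l2 set" where
  "L2 \<Omega> = {u. AE x in lebesgue. x \<notin> \<Omega> \<longrightarrow> rep_l2 u x = 0}"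

text \<open>\<open>L\<^sup>4(\<Omega>)\<close> as a subset of \<open>L\<^sup>2(\<Omega>)\<close>; this is all of \<open>L\<^sup>4(\<Omega>)\<close> when \<open>\<Omega>\<close> is bounded.\<close>

definition L4 :: "'a::euclidean_space set \<Rightarrow> 'a l2 set" where
  "L4 \<Omega> = {u \<in> L2 \<Omega>. integrable (lebesgue_on \<Omega>) (\<lambda>x. (rep_l2 u x) ^ 4)}"

definition L4_norm :: "'a::euclidean_space set \<Rightarrow> 'a l2 \<Rightarrow> real" where
  "L4_norm \<Omega> u = root 4 (LINT x|lebesgue_on \<Omega>. (rep_l2 u x) ^ 4)"

definition partial_deriv :: "'a::euclidean_space \<Rightarrow> ('a \<Rightarrow> real) \<Rightarrow> 'a \<Rightarrow> real" where
  "partial_deriv b \<phi> x = frechet_derivative \<phi> (at x) b"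

primrec C_k :: "nat \<Rightarrow> ('a::euclidean_space \<Rightarrow> real) \<Rightarrow> bool" where
  "C_k 0 \<phi> \<longleftrightarrow> continuous_on UNIV \<phi>"
| "C_k (Suc k) \<phi> \<longleftrightarrow> (\<forall>x. \<phi> differentiable (at x)) \<and> (\<forall>b\<in>Basis. C_k k (partial_deriv b \<phi>))"

definition test_functions :: "'a::euclidean_space set \<Rightarrow> ('a \<Rightarrow> real) set" where
  "test_functions \<Omega> = {\<phi>. (\<forall>k. C_k k \<phi>) \<and>
     compact (closure {x. \<phi> x \<noteq> 0}) \<and> closure {x. \<phi> x \<noteq> 0} \<subseteq> \<Omega>}"

text \<open>
  The boundary is locally the graph of a \<open>C\<^sup>k\<close> function, with \<open>\<Omega>\<close> lying on one side of it:
  \<open>e\<close> is the direction of the graph axis at the boundary point, and \<open>\<gamma>\<close> is evaluated only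
  on the hyperplane orthogonal to \<open>e\<close>.
\<close>

definition C_k_boundary :: "nat \<Rightarrow> 'a::euclidean_space set \<Rightarrow> bool" where
  "C_k_boundary k \<Omega> \<longleftrightarrow>
     (\<forall>x\<in>frontier \<Omega>. \<exists>r>0. \<exists>e \<gamma>. norm e = 1 \<and> C_k k \<gamma> \<and>
        \<Omega> \<inter> ball x r = {y \<in> ball x r. y \<bullet> e > \<gamma> (y - (y \<bullet> e) *\<^sub>R e)})"

definition weak_partial :: "'a::euclidean_space set \<Rightarrow> 'a \<Rightarrow> 'a l2 \<Rightarrow> 'a l2 \<Rightarrow> bool" where
  "weak_partial \<Omega> b u g \<longleftrightarrow>
     (\<forall>\<phi>\<in>test_functions \<Omega>.
        (LINT x|lebesgue_on \<Omega>. rep_l2 u x * partial_deriv b \<phi> x)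
          = - (LINT x|lebesgue_on \<Omega>. rep_l2 g x * \<phi> x))"

definition H1 :: "'a::euclidean_space set \<Rightarrow> 'a l2 set" where
  "H1 \<Omega> = {u \<in> L2 \<Omega>. \<forall>b\<in>Basis. \<exists>g\<in>L2 \<Omega>. weak_partial \<Omega> b u g}"

definition weak_deriv :: "'a::euclidean_space set \<Rightarrow> 'a \<Rightarrow> 'a l2 \<Rightarrow> 'a l2" where
  "weak_deriv \<Omega> b u = (THE g. g \<in> L2 \<Omega> \<and> weak_partial \<Omega> b u g)"

definition H1_norm :: "'a::euclidean_space set \<Rightarrow> 'a l2 \<Rightarrow> real" where
  "H1_norm \<Omega> u = sqrt ((norm u)\<^sup>2 + (\<Sum>b\<in>Basis. (norm (weak_deriv \<Omega> b u))\<^sup>2))"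

text \<open>The closure of \<open>C\<^sub>0\<^sup>\<infinity>(\<Omega>)\<close> in \<open>H\<^sup>1(\<Omega>)\<close>.\<close>

definition H10 :: "'a::euclidean_space set \<Rightarrow> 'a l2 set" where
  "H10 \<Omega> = {u \<in> H1 \<Omega>. \<forall>e>0. \<exists>\<phi>\<in>test_functions \<Omega>. H1_norm \<Omega> (u - abs_l2 \<phi>) < e}"

definition H10_inner :: "'a::euclidean_space set \<Rightarrow> 'a l2 \<Rightarrow> 'a l2 \<Rightarrow> real" where
  "H10_inner \<Omega> u v = (\<Sum>b\<in>Basis. weak_deriv \<Omega> b u \<bullet> weak_deriv \<Omega> b v)"

definition H10_norm :: "'a::euclidean_space set \<Rightarrow> 'a l2 \<Rightarrow> real" where
  "H10_norm \<Omega> u = sqrt (H10_inner \<Omega> u u)"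


section \<open>Bochner spaces\<close>

text \<open>
  A function space is given by its carrier \<open>X\<close> and its norm \<open>N\<close>, because several norms are
  used on subsets of one type. Strong measurability is almost-everywhere approximability by
  simple functions in the norm \<open>N\<close>.
\<close>

definition strongly_measurable ::
    "real set \<Rightarrow> 'b::real_vector set \<Rightarrow> ('b \<Rightarrow> real) \<Rightarrow> (real \<Rightarrow> 'b) \<Rightarrow> bool" where
  "strongly_measurable I X N u \<longleftrightarrow>
     (AE t in lebesgue_on I. u t \<in> X) \<and>
     (\<exists>s. (\<forall>n::nat. simple_function (lebesgue_on I) (s n) \<and> s n ` I \<subseteq> X) \<and>
          (AE t in lebesgue_on I. (\<lambda>n. N (s n t - u t)) \<longlonglongrightarrow> 0))"

definition bochner_Lp ::
    "nat \<Rightarrow> real set \<Rightarrow> 'b::real_vector set \<Rightarrow> ('b \<Rightarrow> real) \<Rightarrow> (real \<Rightarrow> 'b) set" where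
  "bochner_Lp p I X N = {u. strongly_measurable I X N u \<and>
     (\<integral>\<^sup>+ t. ennreal (N (u t) ^ p) \<partial>lebesgue_on I) < \<infinity>}"

definition bochner_Linf ::
    "real set \<Rightarrow> 'b::real_vector set \<Rightarrow> ('b \<Rightarrow> real) \<Rightarrow> (real \<Rightarrow> 'b) set" where
  "bochner_Linf I X N = {u. strongly_measurable I X N u \<and>
     (\<exists>C. AE t in lebesgue_on I. N (u t) \<le> C)}"

text \<open>
  \<open>w\<close> is the distributional derivative of \<open>u\<close> on \<open>I\<close> with values in \<open>L\<^sup>2(\<Omega>)\<close>; the identity
  between the two vector-valued integrals is written after pairing with each \<open>v \<in> L\<^sup>2(\<Omega>)\<close>.
\<close>

definition weak_time_deriv ::
    "real set \<Rightarrow> 'a::euclidean_space set \<Rightarrow> (real \<Rightarrow> 'a l2) \<Rightarrow> (real \<Rightarrow> 'a l2) \<Rightarrow> bool" where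
  "weak_time_deriv I \<Omega> u w \<longleftrightarrow>
     (\<forall>v\<in>L2 \<Omega>. \<forall>\<eta>\<in>test_functions I.
        (LINT t|lebesgue_on I. (u t \<bullet> v) * deriv \<eta> t)
          = - (LINT t|lebesgue_on I. (w t \<bullet> v) * \<eta> t))"


section \<open>Solutions of the reaction-diffusion problem\<close>

definition weak_solution ::
    "'a::euclidean_space set \<Rightarrow> (real \<Rightarrow> real) \<Rightarrow> 'a l2 \<Rightarrow> (real \<Rightarrow> 'a l2) \<Rightarrow> bool" where
  "weak_solution \<Omega> f h u \<longleftrightarrow>
     (\<forall>T>0. u \<in> bochner_Lp 2 {0<..<T} (H10 \<Omega>) (H10_norm \<Omega>)) \<and>
     (\<forall>T>0. u \<in> bochner_Lp 4 {0<..<T} (L4 \<Omega>) (L4_norm \<Omega>)) \<and>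
     (\<forall>T>0. \<forall>v\<in>H10 \<Omega>. \<forall>\<eta>\<in>test_functions {0<..<T}.
        - (LINT t|lebesgue_on {0<..<T}. (u t \<bullet> v) * deriv \<eta> t)
        + (LINT t|lebesgue_on {0<..<T}.
             (H10_inner \<Omega> (u t) v
              + (LINT x|lebesgue_on \<Omega>. f (rep_l2 (u t) x) * rep_l2 v x)
              - h \<bullet> v) * \<eta> t) = 0)"

definition regular_solution ::
    "'a::euclidean_space set \<Rightarrow> (real \<Rightarrow> real) \<Rightarrow> 'a l2 \<Rightarrow> (real \<Rightarrow> 'a l2) \<Rightarrow> bool" where
  "regular_solution \<Omega> f h u \<longleftrightarrow> weak_solution \<Omega> f h u \<and>
     (\<forall>\<epsilon> T. 0 < \<epsilon> \<and> \<epsilon> < T \<longrightarrow>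
        u \<in> bochner_Linf {\<epsilon><..<T} (H10 \<Omega>) (H10_norm \<Omega>) \<and>
        (\<exists>w\<in>bochner_Lp 2 {\<epsilon><..<T} (L2 \<Omega>) norm. weak_time_deriv {\<epsilon><..<T} \<Omega> u w))"

definition strong_solution ::
    "'a::euclidean_space set \<Rightarrow> (real \<Rightarrow> real) \<Rightarrow> 'a l2 \<Rightarrow> (real \<Rightarrow> 'a l2) \<Rightarrow> bool" where
  "strong_solution \<Omega> f h u \<longleftrightarrow> weak_solution \<Omega> f h u \<and>
     (\<forall>T>0.
        u \<in> bochner_Linf {0<..<T} (H10 \<Omega>) (H10_norm \<Omega>) \<and>
        (\<exists>w\<in>bochner_Lp 2 {0<..<T} (L2 \<Omega>) norm. weak_time_deriv {0<..<T} \<Omega> u w))"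

text \<open>
  A weak solution is determined only for almost every time; it has a unique representative in
  \<open>C([0,\<infinity>); L\<^sup>2(\<Omega>))\<close>. The sets \<open>K_r\<close> and \<open>K_s\<close> consist of these representatives, so
  that the values \<open>u 0\<close> and \<open>u t\<close> below are meaningful. Values at negative times are irrelevant.
\<close>

definition K_r ::
    "'a::euclidean_space set \<Rightarrow> (real \<Rightarrow> real) \<Rightarrow> 'a l2 \<Rightarrow> (real \<Rightarrow> 'a l2) set" where
  "K_r \<Omega> f h = {u. regular_solution \<Omega> f h u \<and> u ` {0..} \<subseteq> L2 \<Omega> \<and> continuous_on {0..} u}"

definition K_s ::
    "'a::euclidean_space set \<Rightarrow> (real \<Rightarrow> real) \<Rightarrow> 'a l2 \<Rightarrow> (real \<Rightarrow> 'a l2) set" where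
  "K_s \<Omega> f h = {u. strong_solution \<Omega> f h u \<and> u ` {0..} \<subseteq> L2 \<Omega> \<and> continuous_on {0..} u}"

definition G_r ::
    "'a::euclidean_space set \<Rightarrow> (real \<Rightarrow> real) \<Rightarrow> 'a l2 \<Rightarrow> real \<Rightarrow> 'a l2 \<Rightarrow> 'a l2 set" where
  "G_r \<Omega> f h t u0 = {u t | u. u \<in> K_r \<Omega> f h \<and> u 0 = u0}"

definition G_s ::
    "'a::euclidean_space set \<Rightarrow> (real \<Rightarrow> real) \<Rightarrow> 'a l2 \<Rightarrow> real \<Rightarrow> 'a l2 \<Rightarrow> 'a l2 set" where
  "G_s \<Omega> f h t u0 = {u t | u. u \<in> K_s \<Omega> f h \<and> u 0 = u0}"


section \<open>Global attractors\<close>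

definition norm_topology :: "'b::real_vector set \<Rightarrow> ('b \<Rightarrow> real) \<Rightarrow> 'b topology" where
  "norm_topology X N = Metric_space.mtopology X (\<lambda>x y. N (x - y))"

definition semidist :: "('b::real_vector \<Rightarrow> real) \<Rightarrow> 'b set \<Rightarrow> 'b set \<Rightarrow> ennreal" where
  "semidist N A B = (SUP x\<in>A. INF y\<in>B. ennreal (N (x - y)))"

definition attracts_bounded ::
    "'b::real_vector set \<Rightarrow> ('b \<Rightarrow> real) \<Rightarrow> (real \<Rightarrow> 'b \<Rightarrow> 'b set) \<Rightarrow> 'b set \<Rightarrow> bool" where
  "attracts_bounded X N G A \<longleftrightarrow>
     (\<forall>B\<subseteq>X. (\<exists>M. \<forall>x\<in>B. N x \<le> M) \<longrightarrow>
        ((\<lambda>t. semidist N (\<Union>x\<in>B. G t x) A) \<longlongrightarrow> 0) at_top)"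

definition global_attractor ::
    "'b::real_vector set \<Rightarrow> ('b \<Rightarrow> real) \<Rightarrow> (real \<Rightarrow> 'b \<Rightarrow> 'b set) \<Rightarrow> 'b set \<Rightarrow> bool" where
  "global_attractor X N G \<Theta> \<longleftrightarrow> \<Theta> \<subseteq> X \<and>
     (\<forall>t\<ge>0. \<Theta> \<subseteq> (\<Union>x\<in>\<Theta>. G t x)) \<and>
     attracts_bounded X N G \<Theta> \<and>
     (\<forall>C. closedin (norm_topology X N) C \<and> attracts_bounded X N G C \<longrightarrow> \<Theta> \<subseteq> C)"

end

theory Submission
  imports Defs "HOL-Computational_Algebra.Polynomial"
begin

text \<open>
  Every point \<open>x\<close> of an attractor is reached from that attractor in arbitrarily long time. Hence
  \<open>x\<close> belongs to the other attractor as soon as the solutions that reach \<open>x\<close> also belong to the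
  other semiflow and start in one fixed bounded subset of its phase space: these solutions are
  then attracted by the other attractor, which is compact and therefore closed.

  For \<open>\<Theta>\<^sub>s \<subseteq> \<Theta>\<^sub>r\<close> both conditions are immediate: strong solutions are regular, and by the
  Poincare inequality a bounded subset of \<open>H\<^sub>0\<^sup>1\<close> is bounded in \<open>L\<^sup>2\<close>.

  For \<open>\<Theta>\<^sub>r \<subseteq> \<Theta>\<^sub>s\<close> a regular solution becomes strong after an arbitrary positive time shift
  (\<open>K_r_shift_in_K_s\<close>), so it is enough that every regular solution starting in the bounded set
  \<open>\<Theta>\<^sub>r\<close> meets a fixed ball of \<open>H\<^sub>0\<^sup>1\<close> at some time in \<open>(0,1)\<close>. It does: by the energy
  inequality \<open>(1/2) d/dt |u|\<^sup>2 + (1/2) |u|\<^sup>2\<^bsub>H\<^esub> \<le> K\<close>, where \<open>|u|\<^sub>H\<close> is the norm of \<open>H\<^sub>0\<^sup>1\<close>, the \<open>H\<^sub>0\<^sup>1\<close> norm cannot stay large during the whole interval \<open>(0,1)\<close>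
  (\<open>regular_solutions_enter_bounded_set\<close>). The attraction of \<open>\<Theta>\<^sub>s\<close> is then applied at almost
  every time, where \<open>u(t)\<close> lies in \<open>H\<^sub>0\<^sup>1\<close> by definition. The Poincare inequality turns
  \<open>H\<^sub>0\<^sup>1\<close>-closeness into \<open>L\<^sup>2\<close>-closeness, continuity of \<open>u\<close> in \<open>L\<^sup>2\<close> carries it to every time,
  and \<open>\<Theta>\<^sub>s\<close>, compact in \<open>H\<^sub>0\<^sup>1\<close>, is closed in \<open>L\<^sup>2\<close>.

  The energy inequality comes from testing the equation with \<open>u(t)\<close> itself. The weak formulation
  gives the equation for each fixed \<open>v\<close> outside a null set of times depending on \<open>v\<close>; a countable
  set of test elements with \<open>u(t)\<close> in its closure for almost every \<open>t\<close> is therefore required. As \<open>u\<close> is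
  strongly measurable with values in \<open>H\<^sub>0\<^sup>1\<close> and in \<open>L\<^sup>4\<close>, countably many of its own values are
  dense among almost all its values for both norms at once
  (\<open>AE_simultaneous_approximation_by_own_values\<close>). The rule for the derivative of
  \<open>|u|\<^sup>2\<close> is replaced by a comparison on short intervals
  (\<open>norm_square_increment_le\<close>).
\<close>

section \<open>Smooth functions with compact support\<close>

lemma C_k_imp_continuous_on: "C_k k \<phi> \<Longrightarrow> continuous_on UNIV \<phi>"
  by (cases k) (auto intro!: differentiable_imp_continuous_on simp: differentiable_on_def)

lemma C_k_Suc_imp: "C_k (Suc k) \<phi> \<Longrightarrow> C_k k \<phi>"
proof (induction k arbitrary: \<phi>)
  case 0
  then show ?case using C_k_imp_continuous_on[of 1 \<phi>] by simp
next
  case (Suc k)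
  then show ?case by (metis C_k.simps(2))
qed

lemma partial_deriv_eqI:
  "(\<phi> has_derivative D) (at x) \<Longrightarrow> partial_deriv b \<phi> x = D b"
  unfolding partial_deriv_def using frechet_derivative_at by metis

lemma has_derivative_partial_deriv:
  "C_k (Suc k) \<phi> \<Longrightarrow> (\<phi> has_derivative (\<lambda>b. partial_deriv b \<phi> x)) (at x)"
  unfolding partial_deriv_def using frechet_derivative_works[of \<phi> "at x"] by (simp add: eta_contract_eq)

lemma C_k_SucI:
  assumes "\<And>x. (\<phi> has_derivative D x) (at x)" "\<And>b. b \<in> Basis \<Longrightarrow> C_k k (\<lambda>x. D x b)"
  shows "C_k (Suc k) \<phi>"
proof -
  have "partial_deriv b \<phi> = (\<lambda>x. D x b)" for b
    using partial_deriv_eqI[OF assms(1)] by auto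
  then show ?thesis using assms by (auto simp: differentiable_def)
qed

lemma C_k_const: "C_k k (\<lambda>_. c)"
  by (induction k arbitrary: c) (simp, rule C_k_SucI, auto intro: derivative_eq_intros)

lemma C_k_add: "C_k k \<phi> \<Longrightarrow> C_k k \<psi> \<Longrightarrow> C_k k (\<lambda>x. \<phi> x + \<psi> x)"
proof (induction k arbitrary: \<phi> \<psi>)
  case 0
  then show ?case by (auto intro: continuous_on_add)
next
  case (Suc k)
  show ?case
    by (rule C_k_SucI[OF has_derivative_add[OF has_derivative_partial_deriv has_derivative_partial_deriv]])
      (use Suc in auto)
qed

lemma C_k_mult: "C_k k \<phi> \<Longrightarrow> C_k k \<psi> \<Longrightarrow> C_k k (\<lambda>x. \<phi> x * \<psi> x)"
proof (induction k arbitrary: \<phi> \<psi>)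
  case 0
  then show ?case by (auto intro: continuous_on_mult)
next
  case (Suc k)
  show ?case
    by (rule C_k_SucI[OF has_derivative_mult[OF has_derivative_partial_deriv has_derivative_partial_deriv]])
      (use Suc C_k_Suc_imp[OF Suc.prems(1)] C_k_Suc_imp[OF Suc.prems(2)] in \<open>auto intro!: C_k_add\<close>)
qed

lemma C_k_prod:
  "(\<And>i. i \<in> A \<Longrightarrow> C_k k (\<phi> i)) \<Longrightarrow> C_k k (\<lambda>x. \<Prod>i\<in>A. \<phi> i x)"
  by (induction A rule: infinite_finite_induct) (auto intro: C_k_const C_k_mult)

text \<open>
  Stated with the whole sequence of derivatives, because one partial derivative of a ridge function
  is a multiple of the ridge function of the next derivative; the induction runs through the sequence.
\<close>

lemma C_k_ridge:
  assumes "\<And>n s. (G n has_real_derivative G (Suc n) s) (at s)"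
  shows "C_k k (\<lambda>x. G n (x \<bullet> b + a))"
proof (induction k arbitrary: n)
  case 0
  have "continuous_on UNIV (G n)"
    using assms by (meson DERIV_isCont continuous_at_imp_continuous_on)
  then show ?case
    by (auto intro!: continuous_on_compose2[of UNIV "G n"] continuous_intros)
next
  case (Suc k)
  have "((\<lambda>x. G n (x \<bullet> b + a)) has_derivative (\<lambda>y. (y \<bullet> b) * G (Suc n) (x \<bullet> b + a))) (at x)" for x
    by (rule DERIV_compose_FDERIV[OF assms]) (auto intro!: derivative_eq_intros)
  then show ?case
    by (rule C_k_SucI) (intro C_k_mult C_k_const Suc)
qed

lemma C_k_inner: "C_k k (\<lambda>x. x \<bullet> b)"
proof -
  define G :: "nat \<Rightarrow> real \<Rightarrow> real" where
    "G n = (case n of 0 \<Rightarrow> (\<lambda>s. s) | Suc m \<Rightarrow> (\<lambda>_. if m = 0 then 1 else 0))" for n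
  have "(G n has_real_derivative G (Suc n) s) (at s)" for n s
    by (auto simp: G_def split: nat.split)
  from C_k_ridge[where G=G, OF this, of k 0 b 0] show ?thesis by (simp add: G_def)
qed

lemma C_k_affine: "C_k k \<phi> \<Longrightarrow> C_k k (\<lambda>x. \<phi> (c *\<^sub>R x + a))"
proof (induction k arbitrary: \<phi>)
  case 0
  then show ?case by (auto intro!: continuous_on_compose2[of UNIV \<phi>] continuous_intros)
next
  case (Suc k)
  have "((\<lambda>x. c *\<^sub>R x + a) has_derivative (\<lambda>h. c *\<^sub>R h)) (at x)" for x
    by (auto intro!: derivative_eq_intros)
  note D = has_derivative_compose[OF this has_derivative_partial_deriv[OF Suc.prems]]
  have "partial_deriv (c *\<^sub>R b) \<phi> x = c * partial_deriv b \<phi> x" for b x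
    using linear_scale[OF has_derivative_linear[OF has_derivative_partial_deriv[OF Suc.prems, of x]], of c b] by simp
  with D have "((\<lambda>x. \<phi> (c *\<^sub>R x + a)) has_derivative (\<lambda>b. c * partial_deriv b \<phi> (c *\<^sub>R x + a))) (at x)" for x
    by simp
  then show ?case
    by (rule C_k_SucI) (use Suc in \<open>auto intro!: C_k_mult C_k_const\<close>)
qed

text \<open>
  The functions \<open>p(1/x) exp(-1/x)\<close>, extended by zero to \<open>x \<le> 0\<close>, form a family closed under
  differentiation; for \<open>p = 1\<close> this is the standard smooth function that is flat at the origin.
\<close>

definition flat_exp :: "real poly \<Rightarrow> real \<Rightarrow> real" where
  "flat_exp p x = (if x > 0 then poly p (1/x) * exp (- (1/x)) else 0)"

text \<open>
  The factor \<open>y ^ k\<close> makes the induction over the coefficients of \<open>p\<close> work: passing to the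
  remaining coefficients raises \<open>k\<close> by one.
\<close>

lemma poly_times_exp_minus_tendsto_0:
  fixes p :: "real poly"
  shows "((\<lambda>y. y ^ k * poly p y * exp (- y)) \<longlongrightarrow> 0) at_top"
proof (induction p arbitrary: k)
  case 0
  then show ?case by simp
next
  case (pCons a p)
  have "((\<lambda>y::real. y ^ k * exp (- y)) \<longlongrightarrow> 0) at_top"
    using tendsto_power_div_exp_0[of k] by (simp add: exp_minus field_simps)
  from tendsto_add[OF tendsto_mult[OF tendsto_const[of a] this] pCons(2)[of "Suc k"]]
  show ?case by (simp add: algebra_simps)
qed

lemma flat_exp_deriv:
  "(flat_exp p has_real_derivative flat_exp ([:0, 0, 1:] * (p - pderiv p)) x) (at x)"
proof (cases x "0::real" rule: linorder_cases)
  case less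
  have "((\<lambda>_. 0) has_real_derivative 0) (at x)" by simp
  moreover have "eventually (\<lambda>y. 0 = flat_exp p y) (nhds x)"
    using eventually_nhds_in_open[of "{..<0}" x] less
    by (auto elim!: eventually_mono simp: flat_exp_def)
  ultimately show ?thesis
    using less DERIV_cong_ev[of x x "\<lambda>_. 0" "flat_exp p" 0 0, OF refl] by (simp add: flat_exp_def[of _ x])
next
  case equal
  have "((\<lambda>y. flat_exp p y / y) \<longlongrightarrow> 0) (at 0)"
  proof (rule filterlim_split_at)
    have "eventually (\<lambda>y. 0 = flat_exp p y / y) (at_left 0)"
      by (auto simp: eventually_at_filter flat_exp_def)
    then show "((\<lambda>y. flat_exp p y / y) \<longlongrightarrow> 0) (at_left 0)"
      using Lim_transform_eventually[OF tendsto_const] by fast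
    have "((\<lambda>y. inverse y ^ 1 * poly p (inverse y) * exp (- (inverse y))) \<longlongrightarrow> 0) (at_right 0)"
      by (rule filterlim_compose[OF poly_times_exp_minus_tendsto_0 filterlim_inverse_at_top_right])
    moreover have "eventually (\<lambda>y. inverse y ^ 1 * poly p (inverse y) * exp (- (inverse y)) = flat_exp p y / y) (at_right 0)"
      by (auto simp: eventually_at_filter flat_exp_def field_simps)
    ultimately show "((\<lambda>y. flat_exp p y / y) \<longlongrightarrow> 0) (at_right 0)"
      by (rule Lim_transform_eventually)
  qed
  then show ?thesis
    using equal by (simp add: has_field_derivative_iff flat_exp_def[of _ 0])
next
  case greater
  have "((\<lambda>y. poly p (1/y) * exp (- (1/y))) has_real_derivative flat_exp ([:0, 0, 1:] * (p - pderiv p)) x) (at x)"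
    using greater
    by (auto intro!: derivative_eq_intros DERIV_chain2[OF poly_DERIV] simp: flat_exp_def field_simps power2_eq_square)
  moreover have "eventually (\<lambda>y. poly p (1/y) * exp (- (1/y)) = flat_exp p y) (nhds x)"
    using eventually_nhds_in_open[of "{0<..}" x] greater
    by (auto elim!: eventually_mono simp: flat_exp_def)
  ultimately show ?thesis
    using DERIV_cong_ev[of x x _ "flat_exp p", OF refl] by fast
qed

lemma C_k_flat_exp: "C_k k (\<lambda>x. flat_exp 1 (x \<bullet> b + a))"
proof -
  define P where "P n = ((\<lambda>p::real poly. [:0, 0, 1:] * (p - pderiv p)) ^^ n) 1" for n
  have "(flat_exp (P n) has_real_derivative flat_exp (P (Suc n)) s) (at s)" for n s
    using flat_exp_deriv[of "P n" s] by (simp add: P_def)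
  from C_k_ridge[where G="\<lambda>n. flat_exp (P n)", OF this, of k 0 b a] show ?thesis by (simp add: P_def)
qed

lemma flat_exp_1_bounds: "0 \<le> flat_exp 1 x" "flat_exp 1 x \<le> 1" "flat_exp 1 x \<noteq> 0 \<longleftrightarrow> x > 0"
  by (auto simp: flat_exp_def)

text \<open>
  The convergence \<open>exp(-1/(n x)) \<longlonglongrightarrow> 1\<close> for \<open>x > 0\<close> is what lets dilations of a single flat
  function approximate indicator functions.
\<close>

lemma flat_exp_1_tendsto: "(\<lambda>n. flat_exp 1 (real n * x)) \<longlonglongrightarrow> (if x > 0 then 1 else 0)"
proof (cases "x > 0")
  case True
  have "(\<lambda>n. exp (- (1 / x) * inverse (real n))) \<longlonglongrightarrow> exp (- (1/x) * 0)"
    by (intro tendsto_intros lim_inverse_n)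
  moreover have "eventually (\<lambda>n. exp (- (1 / x) * inverse (real n)) = flat_exp 1 (real n * x)) sequentially"
    using eventually_gt_at_top[of 0] by eventually_elim (use True in \<open>auto simp: flat_exp_def field_simps\<close>)
  ultimately show ?thesis using True Lim_transform_eventually by fastforce
next
  case False
  then have "flat_exp 1 (real n * x) = 0" for n
    by (auto simp: flat_exp_def zero_less_mult_iff)
  then show ?thesis using False by simp
qed

definition box_bump :: "'a::euclidean_space \<Rightarrow> 'a \<Rightarrow> nat \<Rightarrow> 'a \<Rightarrow> real" where
  "box_bump a c n x = (\<Prod>b\<in>Basis. flat_exp 1 (real n * (x \<bullet> b - a \<bullet> b)) * flat_exp 1 (real n * (c \<bullet> b - x \<bullet> b)))"

lemma C_k_box_bump: "C_k k (box_bump a c n)"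
proof -
  have 1: "C_k k (\<lambda>x::'a. flat_exp 1 (real n * (x \<bullet> b - a \<bullet> b)))" for b
    using C_k_flat_exp[of k "real n *\<^sub>R b" "- real n * (a \<bullet> b)"] by (simp add: algebra_simps)
  have 2: "C_k k (\<lambda>x::'a. flat_exp 1 (real n * (c \<bullet> b - x \<bullet> b)))" for b
    using C_k_flat_exp[of k "- real n *\<^sub>R b" "real n * (c \<bullet> b)"] by (simp add: algebra_simps)
  show ?thesis unfolding box_bump_def[abs_def] by (intro C_k_prod C_k_mult 1 2)
qed

lemma box_bump_bounds: "0 \<le> box_bump a c n x" "box_bump a c n x \<le> 1"
  unfolding box_bump_def
  by (auto intro!: prod_nonneg prod_le_1 mult_nonneg_nonneg mult_le_one simp: flat_exp_1_bounds)

lemma box_bump_nonzero: "box_bump a c n x \<noteq> 0 \<Longrightarrow> x \<in> box a c"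
  by (auto simp: box_bump_def box_def flat_exp_1_bounds zero_less_mult_iff)

text \<open>
  Indicators of boxes are bounded pointwise limits of test functions.
\<close>

lemma box_bump_tendsto: "(\<lambda>n. box_bump a c n x) \<longlonglongrightarrow> indicator (box a c) x"
proof -
  have "(\<lambda>n. box_bump a c n x) \<longlonglongrightarrow>
     (\<Prod>b\<in>Basis. (if x \<bullet> b - a \<bullet> b > 0 then 1 else 0) * (if c \<bullet> b - x \<bullet> b > 0 then 1 else 0))"
    unfolding box_bump_def by (intro tendsto_prod tendsto_mult flat_exp_1_tendsto)
  also have "(\<Prod>b\<in>Basis. (if x \<bullet> b - a \<bullet> b > 0 then 1 else 0) * (if c \<bullet> b - x \<bullet> b > 0 then 1 else 0))
    = (indicator (box a c) x :: real)"
    by (auto simp: indicator_def box_def)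
  finally show ?thesis .
qed

lemma test_functionsI:
  assumes "\<And>k. C_k k \<phi>" "compact K" "K \<subseteq> \<Omega>" "\<And>x. \<phi> x \<noteq> 0 \<Longrightarrow> x \<in> K"
  shows "\<phi> \<in> test_functions \<Omega>"
proof -
  have "closure {x. \<phi> x \<noteq> 0} \<subseteq> K"
    using assms by (intro closure_minimal) (auto simp: compact_imp_closed)
  then show ?thesis
    using assms compact_Int_closed[OF assms(2) closed_closure, of "{x. \<phi> x \<noteq> 0}"]
    by (auto simp: test_functions_def Int_absorb2 Int_absorb1)
qed

lemma box_bump_test_function: "cbox a c \<subseteq> \<Omega> \<Longrightarrow> box_bump a c n \<in> test_functions \<Omega>"
  using box_bump_nonzero box_subset_cbox
  by (intro test_functionsI[of _ "cbox a c"] C_k_box_bump) (auto, blast)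

section \<open>The fundamental lemma of the calculus of variations\<close>

lemma enn2real_inj:
  "enn2real a = enn2real b \<Longrightarrow> a < \<infinity> \<Longrightarrow> b < \<infinity> \<Longrightarrow> a = b"
  by (metis ennreal_enn2real infinity_ennreal_def)

text \<open>
  The positive and the negative part of \<open>H\<close> are densities of two measures that agree on boxes.
  Boxes are stable under intersection and generate the Borel sets, so the measures and hence the
  densities agree.
\<close>

lemma AE_lborel_eq_0_if_box_integrals_eq_0:
  fixes H :: "'a::euclidean_space \<Rightarrow> real"
  assumes H: "integrable lborel H"
    and box: "\<And>a c. (LINT x|lborel. H x * indicator (box a c) x) = 0"
  shows "AE x in lborel. H x = 0"
proof -
  define p where "p x = ennreal (H x)" for x
  define n where "n x = ennreal (- H x)" for x
  have [measurable]: "H \<in> borel_measurable borel" using H by simp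
  have [measurable]: "p \<in> borel_measurable borel" "n \<in> borel_measurable borel"
    unfolding p_def n_def by measurable
  have eq: "emeasure (density lborel p) (box a c) = emeasure (density lborel n) (box a c)" for a c
  proof -
    let ?Hb = "\<lambda>x. H x * indicator (box a c) x"
    have int: "integrable lborel ?Hb"
      using integrable_real_mult_indicator[OF _ H, of "box a c"] by simp
    have "p x * indicator (box a c) x = ennreal (?Hb x)" "n x * indicator (box a c) x = ennreal (- ?Hb x)" for x
      by (auto simp: p_def n_def indicator_def)
    then have e: "emeasure (density lborel p) (box a c) = (\<integral>\<^sup>+x. ennreal (?Hb x) \<partial>lborel)"
       "emeasure (density lborel n) (box a c) = (\<integral>\<^sup>+x. ennreal (- ?Hb x) \<partial>lborel)"
      by (simp_all add: emeasure_density)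
    have "enn2real (\<integral>\<^sup>+x. ennreal (?Hb x) \<partial>lborel) = enn2real (\<integral>\<^sup>+x. ennreal (- ?Hb x) \<partial>lborel)"
      using real_lebesgue_integral_def[OF int] box[of a c] by simp
    moreover have "(\<integral>\<^sup>+x. ennreal (?Hb x) \<partial>lborel) < \<infinity>" "(\<integral>\<^sup>+x. ennreal (- ?Hb x) \<partial>lborel) < \<infinity>"
      using real_integrable_def[of lborel ?Hb] int by (auto simp: less_top)
    ultimately show ?thesis
      unfolding e by (rule enn2real_inj)
  qed
  have "density lborel p = density lborel n"
  proof (rule measure_eqI_generator_eq)
    let ?E = "range (\<lambda>(a, b). box a b::'a set)"
    show "Int_stable ?E"
      by (auto simp: Int_stable_def box_Int_box)
    show "?E \<subseteq> Pow UNIV" "sets (density lborel p) = sigma_sets UNIV ?E" "sets (density lborel n) = sigma_sets UNIV ?E"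
      by (simp_all add: borel_eq_box)
    let ?A = "\<lambda>n::nat. box (- (real n *\<^sub>R One)) (real n *\<^sub>R One) :: 'a set"
    show "range ?A \<subseteq> ?E" "(\<Union>i. ?A i) = UNIV"
      unfolding UN_box_eq_UNIV by auto
    show "emeasure (density lborel p) (?A i) \<noteq> \<infinity>" for i
    proof -
      have "emeasure (density lborel p) (?A i) \<le> (\<integral>\<^sup>+x. p x \<partial>lborel)"
        by (auto simp: emeasure_density intro!: nn_integral_mono split: split_indicator)
      also have "\<dots> < \<infinity>"
        using real_integrable_def[of lborel H] H by (auto simp: p_def less_top)
      finally show ?thesis by simp
    qed
    show "emeasure (density lborel p) X = emeasure (density lborel n) X" if "X \<in> ?E" for X
      using that eq by auto
  qed
  then have "AE x in lborel. p x = n x"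
    by (intro sigma_finite_measure.density_unique[OF sigma_finite_lborel]) auto
  then show ?thesis
  proof eventually_elim
    case (elim x)
    show "H x = 0"
    proof (cases "H x \<ge> 0")
      case True
      then have "ennreal (H x) = 0" using elim by (simp add: p_def n_def ennreal_neg)
      then show ?thesis using True by (simp add: ennreal_eq_0_iff)
    next
      case False
      then have "ennreal (- H x) = 0" using elim by (simp add: p_def n_def ennreal_neg)
      then show ?thesis using False by (simp add: ennreal_eq_0_iff)
    qed
  qed
qed

lemma test_function_props:
  assumes "\<phi> \<in> test_functions \<Omega>"
  shows "C_k k \<phi>" "compact (closure {x. \<phi> x \<noteq> 0})" "closure {x. \<phi> x \<noteq> 0} \<subseteq> \<Omega>"
    "\<phi> x \<noteq> 0 \<Longrightarrow> x \<in> \<Omega>" "\<phi> x \<noteq> 0 \<Longrightarrow> x \<in> closure {x. \<phi> x \<noteq> 0}"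
    "continuous_on UNIV \<phi>" "(\<phi> has_derivative (\<lambda>b. partial_deriv b \<phi> x)) (at x)"
proof -
  show 1: "C_k k \<phi>" for k using assms by (simp add: test_functions_def)
  show 2: "compact (closure {x. \<phi> x \<noteq> 0})" "closure {x. \<phi> x \<noteq> 0} \<subseteq> \<Omega>"
    using assms by (simp_all add: test_functions_def)
  show 3: "\<phi> x \<noteq> 0 \<Longrightarrow> x \<in> closure {x. \<phi> x \<noteq> 0}"
    using closure_subset[of "{x. \<phi> x \<noteq> 0}"] by auto
  show "\<phi> x \<noteq> 0 \<Longrightarrow> x \<in> \<Omega>" using 2(2) 3 by auto
  show "continuous_on UNIV \<phi>" "(\<phi> has_derivative (\<lambda>b. partial_deriv b \<phi> x)) (at x)"
    by (rule C_k_imp_continuous_on[OF 1] has_derivative_partial_deriv[OF 1])+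
qed

lemma test_function_mult:
  assumes "\<phi> \<in> test_functions \<Omega>" "\<And>k. C_k k \<psi>"
  shows "(\<lambda>x. \<psi> x * \<phi> x) \<in> test_functions \<Omega>"
proof (rule test_functionsI)
  show "C_k k (\<lambda>x. \<psi> x * \<phi> x)" for k
    by (intro C_k_mult assms test_function_props(1)[OF assms(1)])
  show "x \<in> closure {x. \<phi> x \<noteq> 0}" if "\<psi> x * \<phi> x \<noteq> 0" for x
    using test_function_props(5)[OF assms(1), of x] that by simp
qed (rule test_function_props[OF assms(1)])+

lemma test_function_add:
  assumes "\<phi> \<in> test_functions \<Omega>" "\<psi> \<in> test_functions \<Omega>"
  shows "(\<lambda>x. \<phi> x + \<psi> x) \<in> test_functions \<Omega>"
proof (rule test_functionsI)
  let ?K = "closure {x. \<phi> x \<noteq> 0} \<union> closure {x. \<psi> x \<noteq> 0}"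
  show "C_k k (\<lambda>x. \<phi> x + \<psi> x)" for k
    by (intro C_k_add test_function_props(1)[OF assms(1)] test_function_props(1)[OF assms(2)])
  show "compact ?K"
    by (intro compact_Un test_function_props(2)[OF assms(1)] test_function_props(2)[OF assms(2)])
  show "?K \<subseteq> \<Omega>"
    by (intro Un_least test_function_props(3)[OF assms(1)] test_function_props(3)[OF assms(2)])
  show "x \<in> ?K" if "\<phi> x + \<psi> x \<noteq> 0" for x
  proof (cases "\<phi> x = 0")
    case True
    then show ?thesis using that test_function_props(5)[OF assms(2), of x] by simp
  next
    case False
    then show ?thesis using test_function_props(5)[OF assms(1), of x] by simp
  qed
qed

lemma partial_deriv_zero_outside:
  assumes "\<phi> \<in> test_functions \<Omega>" "x \<notin> closure {x. \<phi> x \<noteq> 0}"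
  shows "partial_deriv b \<phi> x = 0"
proof (rule partial_deriv_eqI)
  have "((\<lambda>_. 0) has_derivative (\<lambda>_. 0)) (at x)" by simp
  then show "(\<phi> has_derivative (\<lambda>_. 0)) (at x)"
    by (rule has_derivative_transform_within_open[of _ _ _ _ "- closure {x. \<phi> x \<noteq> 0}"])
      (use assms(2) test_function_props(5)[OF assms(1)] in \<open>force+\<close>)
qed

lemma test_function_partial:
  assumes "\<phi> \<in> test_functions \<Omega>" "b \<in> Basis"
  shows "partial_deriv b \<phi> \<in> test_functions \<Omega>"
proof (rule test_functionsI[of _ "closure {x. \<phi> x \<noteq> 0}"])
  show "C_k k (partial_deriv b \<phi>)" for k
    using test_function_props(1)[OF assms(1), of "Suc k"] assms(2) by simp
  show "x \<in> closure {x. \<phi> x \<noteq> 0}" if "partial_deriv b \<phi> x \<noteq> 0" for x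
    using partial_deriv_zero_outside[OF assms(1)] that by blast
qed (rule test_function_props[OF assms(1)])+

lemma test_function_bounded:
  assumes "\<phi> \<in> test_functions \<Omega>"
  obtains M where "M \<ge> 0" "\<And>x. \<bar>\<phi> x\<bar> \<le> M"
proof -
  let ?K = "closure {x. \<phi> x \<noteq> 0}"
  have "compact (\<phi> ` ?K)"
    by (intro compact_continuous_image continuous_on_subset[OF test_function_props(6)[OF assms] subset_UNIV]
        test_function_props(2)[OF assms])
  then obtain M where M: "\<And>y. y \<in> \<phi> ` ?K \<Longrightarrow> norm y \<le> M"
    by (meson bounded_iff compact_imp_bounded)
  have "\<bar>\<phi> x\<bar> \<le> max M 0" for x
    using M[of "\<phi> x"] test_function_props(5)[OF assms, of x] by (cases "\<phi> x = 0") auto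
  then show ?thesis using that[of "max M 0"] by auto
qed

lemma test_function_support_in_ball:
  assumes "\<phi> \<in> test_functions \<Omega>"
  obtains R where "R > 0" "\<And>x. \<phi> x \<noteq> 0 \<Longrightarrow> norm x \<le> R"
  using compact_imp_bounded[OF test_function_props(2)[OF assms]] test_function_props(5)[OF assms]
  unfolding bounded_pos by blast

lemma test_function_borel:
  "\<phi> \<in> test_functions \<Omega> \<Longrightarrow> \<phi> \<in> borel_measurable borel"
  by (intro borel_measurable_continuous_onI test_function_props(6))

lemma test_function_integrable:
  assumes "\<phi> \<in> test_functions \<Omega>"
  shows "integrable lborel \<phi>" "integrable lebesgue \<phi>"
proof -
  obtain M where M: "M \<ge> 0" "\<And>x. \<bar>\<phi> x\<bar> \<le> M" using test_function_bounded[OF assms] by blast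
  obtain R where R: "R > 0" "\<And>x. \<phi> x \<noteq> 0 \<Longrightarrow> norm x \<le> R" using test_function_support_in_ball[OF assms] by blast
  show 1: "integrable lborel \<phi>"
  proof (rule Bochner_Integration.integrable_bound)
    show "integrable lborel (\<lambda>x. M * indicator (cball 0 R) x :: real)"
      by (intro integrable_mult_right integrable_real_indicator) (simp_all add: emeasure_lborel_cball_finite[unfolded infinity_ennreal_def])
    show "\<phi> \<in> borel_measurable lborel" using test_function_borel[OF assms] by simp
    show "AE x in lborel. norm (\<phi> x) \<le> norm (M * indicator (cball 0 R) x)"
      using M R by (intro AE_I2) (auto simp: indicator_def)
  qed
  show "integrable lebesgue \<phi>"
    using 1 test_function_borel[OF assms] integrable_completion[of \<phi> lborel] by simp
qed

text \<open>
  By translation invariance the difference quotients in direction \<open>b\<close> have integral zero. They are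
  bounded by the maximum of the derivative and supported in one ball, so dominated convergence applies.
\<close>

lemma integral_partial_deriv_eq_0:
  fixes \<phi> :: "'a::euclidean_space \<Rightarrow> real"
  assumes \<phi>: "\<phi> \<in> test_functions \<Omega>" and b: "b \<in> Basis"
  shows "(LINT x|lebesgue. partial_deriv b \<phi> x) = 0"
proof -
  have d: "partial_deriv b \<phi> \<in> test_functions \<Omega>" by (rule test_function_partial[OF assms])
  obtain M where M: "M \<ge> 0" "\<And>x. \<bar>partial_deriv b \<phi> x\<bar> \<le> M" using test_function_bounded[OF d] by blast
  obtain R where R: "R > 0" "\<And>x. \<phi> x \<noteq> 0 \<Longrightarrow> norm x \<le> R" using test_function_support_in_ball[OF \<phi>] by blast
  define h where "h n = inverse (real (Suc n))" for n
  have h: "0 < h n" "h n \<le> 1" for n by (auto simp: h_def field_simps)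
  define q where "q n x = (\<phi> (h n *\<^sub>R b + x) - \<phi> x) / h n" for n x
  have [measurable]: "\<phi> \<in> borel_measurable borel" "partial_deriv b \<phi> \<in> borel_measurable borel"
    by (rule test_function_borel[OF \<phi>] test_function_borel[OF d])+
  have line: "((\<lambda>s. \<phi> (s *\<^sub>R b + x)) has_real_derivative partial_deriv b \<phi> (s *\<^sub>R b + x)) (at s)" for s x
  proof -
    have "((\<lambda>s. s *\<^sub>R b + x) has_derivative (\<lambda>t. t *\<^sub>R b)) (at s)"
      by (auto intro!: derivative_eq_intros)
    then have D: "((\<lambda>s. \<phi> (s *\<^sub>R b + x)) has_derivative (\<lambda>t. partial_deriv (t *\<^sub>R b) \<phi> (s *\<^sub>R b + x))) (at s)"
      by (rule has_derivative_compose[OF _ test_function_props(7)[OF \<phi>]])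
    have "partial_deriv (t *\<^sub>R b) \<phi> y = t * partial_deriv b \<phi> y" for t y
      using linear_scale[OF has_derivative_linear[OF test_function_props(7)[OF \<phi>, of y]], of t b] by simp
    with D show ?thesis by (simp add: has_field_derivative_def mult_commute_abs)
  qed
  have q0: "(LINT x|lborel. q n x) = 0" for n
  proof -
    have i: "integrable lborel (\<lambda>x. \<phi> (h n *\<^sub>R b + x))"
      using test_function_integrable(1)[OF \<phi>] lborel_distr_plus[of "h n *\<^sub>R b"]
        integrable_distr_eq[of "(+) (h n *\<^sub>R b)" lborel borel \<phi>] by simp
    have "(LINT x|lborel. \<phi> (h n *\<^sub>R b + x)) = (LINT x|distr lborel borel ((+) (h n *\<^sub>R b)). \<phi> x)"
      by (subst integral_distr) auto
    also have "\<dots> = (LINT x|lborel. \<phi> x)" by (simp add: lborel_distr_plus)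
    finally show ?thesis
      unfolding q_def using i test_function_integrable(1)[OF \<phi>] by simp
  qed
  have lim: "(\<lambda>n. q n x) \<longlonglongrightarrow> partial_deriv b \<phi> x" for x
  proof -
    have "((\<lambda>t. (\<phi> (t *\<^sub>R b + x) - \<phi> x) / t) \<longlongrightarrow> partial_deriv b \<phi> x) (at 0)"
      using line[of x 0] by (simp add: has_field_derivative_iff)
    moreover have "filterlim h (at 0) sequentially"
      unfolding filterlim_at h_def
      using LIMSEQ_inverse_real_of_nat by (auto intro!: always_eventually)
    ultimately show ?thesis
      unfolding q_def by (rule filterlim_compose)
  qed
  have bound: "norm (q n x) \<le> M * indicator (cball 0 (R + 1)) x" for n x
  proof (cases "x \<in> cball 0 (R + 1)")
    case True
    obtain z where "\<phi> (h n *\<^sub>R b + x) - \<phi> (0 *\<^sub>R b + x) = (h n - 0) * partial_deriv b \<phi> (z *\<^sub>R b + x)"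
      using MVT2[OF h(1) line, of n x] by blast
    then have "q n x = partial_deriv b \<phi> (z *\<^sub>R b + x)" using h(1)[of n] by (simp add: q_def)
    then show ?thesis using True M by simp
  next
    case False
    have "norm x \<le> norm (h n *\<^sub>R b + x) + norm (h n *\<^sub>R b)"
      using norm_triangle_ineq4[of "h n *\<^sub>R b + x" "h n *\<^sub>R b"] by simp
    also have "norm (h n *\<^sub>R b) \<le> 1" using h[of n] b by simp
    finally have "norm (h n *\<^sub>R b + x) > R" "norm x > R" using False by auto
    then have "\<phi> (h n *\<^sub>R b + x) = 0" "\<phi> x = 0" using R(2) by force+
    then show ?thesis using M by (simp add: q_def)
  qed
  have "(\<lambda>n. LINT x|lborel. q n x) \<longlonglongrightarrow> (LINT x|lborel. partial_deriv b \<phi> x)"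
  proof (rule integral_dominated_convergence)
    show "integrable lborel (\<lambda>x. M * indicator (cball 0 (R + 1)) x :: real)"
      by (intro integrable_mult_right integrable_real_indicator) (simp_all add: emeasure_lborel_cball_finite[unfolded infinity_ennreal_def])
    show "q n \<in> borel_measurable lborel" for n unfolding q_def[abs_def] by measurable
  qed (use lim bound in auto)
  then have "(LINT x|lborel. partial_deriv b \<phi> x) = 0"
    using q0 LIMSEQ_unique by (simp add: LIMSEQ_const_iff)
  then show ?thesis by (simp add: integral_completion)
qed

text \<open>
  Dominated convergence along \<open>box_bump\<close> shows that \<open>g\<close> has integral zero over every box whose closure
  lies in \<open>\<Omega>\<close>. Inside one such box, all sub-boxes have this property, so \<open>g\<close> vanishes there almost
  everywhere; countably many closed boxes cover \<open>\<Omega>\<close>.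
\<close>

lemma fundamental_lemma_of_variations:
  fixes g :: "'a::euclidean_space \<Rightarrow> real"
  assumes \<Omega>: "open \<Omega>" and g: "integrable (lebesgue_on \<Omega>) g"
    and 0: "\<And>\<phi>. \<phi> \<in> test_functions \<Omega> \<Longrightarrow> (LINT x|lebesgue_on \<Omega>. g x * \<phi> x) = 0"
  shows "AE x in lebesgue_on \<Omega>. g x = 0"
proof -
  let ?G = "\<lambda>x. indicator \<Omega> x * g x"
  have [measurable]: "\<Omega> \<in> sets borel" using \<Omega> by simp
  have \<Omega>s: "\<Omega> \<inter> space lebesgue \<in> sets lebesgue" by simp
  have G: "integrable lebesgue ?G"
    using g by (simp add: integrable_restrict_space)
  have box: "(LINT x|lebesgue. ?G x * indicator (box a c) x) = 0" if ac: "cbox a c \<subseteq> \<Omega>" for a c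
  proof -
    have "(\<lambda>n. LINT x|lebesgue. ?G x * box_bump a c n x) \<longlonglongrightarrow> (LINT x|lebesgue. ?G x * indicator (box a c) x)"
    proof (rule integral_dominated_convergence)
      show "integrable lebesgue (\<lambda>x. \<bar>?G x\<bar>)" using G by (rule integrable_abs)
      show "AE x in lebesgue. norm (?G x * box_bump a c n x) \<le> \<bar>?G x\<bar>" for n
        using box_bump_bounds[of a c n] by (auto simp: abs_mult intro!: mult_left_le)
      have "box_bump a c n \<in> borel_measurable lebesgue" for n
        by (rule borel_measurable_integrable[OF test_function_integrable(2)[OF box_bump_test_function[OF ac]]])
      then show "(\<lambda>x. ?G x * box_bump a c n x) \<in> borel_measurable lebesgue" for n
        by (intro borel_measurable_times[OF borel_measurable_integrable[OF G]])
      show "(\<lambda>x. ?G x * indicator (box a c) x) \<in> borel_measurable lebesgue"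
        by (intro borel_measurable_times[OF borel_measurable_integrable[OF G]] borel_measurable_indicator) auto
    qed (auto intro!: tendsto_mult box_bump_tendsto)
    moreover have "(LINT x|lebesgue. ?G x * box_bump a c n x) = 0" for n
      using 0[OF box_bump_test_function[OF ac, of n]] by (simp add: integral_restrict_space mult.assoc)
    ultimately show ?thesis using LIMSEQ_unique by (simp add: LIMSEQ_const_iff)
  qed
  obtain G' where G': "G' \<in> borel_measurable lborel" "AE x in lborel. ?G x = G' x"
    using completion_ex_borel_measurable_real[of ?G lborel] G by auto
  have GG': "AE x in lebesgue. ?G x = G' x" using G'(2) by (rule AE_completion)
  have G'i: "integrable lborel G'"
    using integrable_cong_AE[OF borel_measurable_integrable[OF G] measurable_completion[OF G'(1)] GG'] G
      integrable_completion[OF G'(1)] by blast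
  have on_box: "AE x in lborel. x \<in> box a c \<longrightarrow> G' x = 0" if ac: "cbox a c \<subseteq> \<Omega>" for a c
  proof -
    have [measurable]: "G' \<in> borel_measurable borel" using G'(1) by simp
    have "AE x in lborel. G' x * indicator (box a c) x = 0"
    proof (rule AE_lborel_eq_0_if_box_integrals_eq_0)
      show "integrable lborel (\<lambda>x. G' x * indicator (box a c) x)"
        using integrable_real_mult_indicator[OF _ G'i, of "box a c"] by simp
      fix a' c'
      define l where "l = (\<Sum>i\<in>Basis. max (a \<bullet> i) (a' \<bullet> i) *\<^sub>R i)"
      define u where "u = (\<Sum>i\<in>Basis. min (c \<bullet> i) (c' \<bullet> i) *\<^sub>R i)"
      have lu: "box a c \<inter> box a' c' = box l u" unfolding l_def u_def by (rule box_Int_box)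
      have "cbox l u \<subseteq> cbox a c" by (auto simp: l_def u_def mem_box)
      then have "0 = (LINT x|lebesgue. ?G x * indicator (box l u) x)" using box ac by (metis order_trans)
      also have "\<dots> = (LINT x|lebesgue. G' x * indicator (box l u) x)"
        using GG' by (intro integral_cong_AE borel_measurable_times borel_measurable_integrable[OF G]
            measurable_completion[OF G'(1)] borel_measurable_indicator) (auto elim: eventually_mono)
      also have "\<dots> = (LINT x|lborel. G' x * indicator (box l u) x)"
        by (rule integral_completion) simp
      also have "(\<lambda>x. G' x * indicator (box l u) x) = (\<lambda>x. G' x * indicator (box a c) x * indicator (box a' c') x)"
        by (auto simp: indicator_def lu[symmetric])
      finally show "(LINT x|lborel. G' x * indicator (box a c) x * indicator (box a' c') x) = 0" by simp
    qed
    then show ?thesis by eventually_elim (auto simp: indicator_def)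
  qed
  obtain D where D: "countable D" "\<And>X. X \<in> D \<Longrightarrow> X \<subseteq> \<Omega>" "\<And>X. X \<in> D \<Longrightarrow> \<exists>a c. X = cbox a c" "\<Union>D = \<Omega>"
    using open_countable_Union_open_cbox[OF \<Omega>] by (metis Pow_iff subsetD)
  have "AE x in lborel. \<forall>X\<in>D. x \<in> X \<longrightarrow> G' x = 0"
  proof (subst AE_ball_countable[OF D(1)], intro ballI)
    fix X assume "X \<in> D"
    then obtain a c where ac: "X = cbox a c" "cbox a c \<subseteq> \<Omega>" using D by metis
    have "cbox a c - box a c \<in> null_sets lborel"
      using negligible_frontier_interval[of a c] by (simp add: negligible_iff_null_sets null_sets_completion_iff)
    from on_box[OF ac(2)] AE_not_in[OF this] show "AE x in lborel. x \<in> X \<longrightarrow> G' x = 0"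
      by eventually_elim (auto simp: ac)
  qed
  then have "AE x in lborel. x \<in> \<Omega> \<longrightarrow> g x = 0"
    using G'(2) by eventually_elim (use D(4) in \<open>auto simp: indicator_def split: if_splits\<close>)
  then have "AE x in lebesgue. x \<in> \<Omega> \<longrightarrow> g x = 0" by (rule AE_completion)
  then show ?thesis by (simp add: AE_restrict_space_iff)
qed

section \<open>The space of square-integrable functions\<close>

lemma l2_rel_rep: "l2_rel (rep_l2 u) (rep_l2 u)"
  by (rule Quotient_rep_reflp[OF Quotient_l2])

lemma square_integrable_rep: "square_integrable (rep_l2 u)"
  using l2_rel_rep[of u] by (simp add: l2_rel_def)

lemma rep_l2_measurable: "rep_l2 u \<in> borel_measurable lebesgue"
  using square_integrable_rep[of u] by (simp add: square_integrable_def)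

lemma rep_abs_l2_AE:
  assumes "square_integrable \<phi>"
  shows "AE x in lebesgue. rep_l2 (abs_l2 \<phi>) x = \<phi> x"
  using Quotient_rep_abs[OF Quotient_l2, of \<phi>] assms by (simp add: l2_rel_def)

lemma l2_eqI:
  assumes "AE x in lebesgue. rep_l2 u x = rep_l2 v x"
  shows "u = v"
  using Quotient_rel_rep[OF Quotient_l2, of u v] assms by (simp add: l2_rel_def square_integrable_rep)

lemma rep_diff_AE: "AE x in lebesgue. rep_l2 (u - v) x = rep_l2 u x - rep_l2 v x"
  using rep_abs_l2_AE[OF square_integrable_diff[OF square_integrable_rep[of u] square_integrable_rep[of v]]]
  by (simp add: minus_l2_def)

lemma rep_scaleR_AE: "AE x in lebesgue. rep_l2 (c *\<^sub>R u) x = c * rep_l2 u x"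
  using rep_abs_l2_AE[OF square_integrable_scale[OF square_integrable_rep[of u], of c]]
  by (simp add: scaleR_l2_def)

lemma rep_zero_AE: "AE x in lebesgue. rep_l2 0 x = 0"
  using rep_abs_l2_AE[OF square_integrable_zero] by (simp add: zero_l2_def)

lemma abs_l2_diff:
  assumes "square_integrable \<phi>" "square_integrable \<psi>"
  shows "abs_l2 \<phi> - abs_l2 \<psi> = abs_l2 (\<lambda>x. \<phi> x - \<psi> x)"
  by (rule l2_eqI)
    (use rep_diff_AE[of "abs_l2 \<phi>" "abs_l2 \<psi>"] rep_abs_l2_AE[OF assms(1)] rep_abs_l2_AE[OF assms(2)]
      rep_abs_l2_AE[OF square_integrable_diff[OF assms]] in \<open>eventually_elim, simp\<close>)

lemma inner_l2_eq: "u \<bullet> v = (LINT x|lebesgue. rep_l2 u x * rep_l2 v x)"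
  by (rule inner_l2.rep_eq)

lemma inner_abs_l2:
  assumes "square_integrable \<phi>"
  shows "u \<bullet> abs_l2 \<phi> = (LINT x|lebesgue. rep_l2 u x * \<phi> x)"
  unfolding inner_l2_eq
proof (rule integral_cong_AE)
  show "AE x in lebesgue. rep_l2 u x * rep_l2 (abs_l2 \<phi>) x = rep_l2 u x * \<phi> x"
    using rep_abs_l2_AE[OF assms] by eventually_elim simp
qed (use assms in \<open>auto intro!: borel_measurable_times rep_l2_measurable simp: square_integrable_def\<close>)

lemma inner_abs_abs_l2:
  assumes "square_integrable \<phi>" "square_integrable \<psi>"
  shows "abs_l2 \<phi> \<bullet> abs_l2 \<psi> = (LINT x|lebesgue. \<phi> x * \<psi> x)"
  using assms by (intro inner_l2.abs_eq) (auto simp: l2_rel_def)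

lemma integrable_lebesgue_on_subset:
  fixes g :: "'a::euclidean_space \<Rightarrow> real"
  assumes "integrable (lebesgue_on I) g" "J \<subseteq> I" "I \<in> sets lebesgue" "J \<in> sets lebesgue"
  shows "integrable (lebesgue_on J) g"
proof -
  have "integrable lebesgue (\<lambda>x. indicator J x *\<^sub>R (indicator I x *\<^sub>R g x))"
    by (rule integrable_mult_indicator[OF assms(4)]) (use assms in \<open>simp add: integrable_restrict_space\<close>)
  also have "(\<lambda>x. indicator J x *\<^sub>R (indicator I x *\<^sub>R g x)) = (\<lambda>x. indicator J x *\<^sub>R g x)"
    using assms(2) by (auto simp: fun_eq_iff indicator_def)
  finally show ?thesis using assms(4) by (simp add: integrable_restrict_space)
qed

lemma abs_le_one_plus_square: "\<bar>x\<bar> \<le> 1 + x\<^sup>2" for x :: real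
  using sum_squares_bound[of 1 "\<bar>x\<bar>"] zero_le_power2[of x] by simp

lemma square_integrable_test:
  assumes "\<phi> \<in> test_functions \<Omega>"
  shows "square_integrable \<phi>"
proof -
  have "(\<lambda>x. \<phi> x * \<phi> x) \<in> test_functions \<Omega>"
    using assms by (intro test_function_mult) (auto intro: test_function_props)
  from test_function_integrable(2)[OF this] test_function_integrable(2)[OF assms] show ?thesis
    by (simp add: square_integrable_def power2_eq_square)
qed

section \<open>Weak derivatives\<close>

lemma L2_diff:
  assumes "u \<in> L2 \<Omega>" "v \<in> L2 \<Omega>"
  shows "u - v \<in> L2 \<Omega>"
  using assms rep_diff_AE[of u v] unfolding L2_def mem_Collect_eq by eventually_elim simp

lemma L2_scaleR:
  assumes "u \<in> L2 \<Omega>"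
  shows "c *\<^sub>R u \<in> L2 \<Omega>"
  using assms rep_scaleR_AE[of c u] unfolding L2_def mem_Collect_eq by eventually_elim simp

lemma abs_test_in_L2:
  assumes "\<phi> \<in> test_functions \<Omega>"
  shows "abs_l2 \<phi> \<in> L2 \<Omega>"
  unfolding L2_def mem_Collect_eq using rep_abs_l2_AE[OF square_integrable_test[OF assms]]
  by eventually_elim (use test_function_props(4)[OF assms] in auto)

locale bounded_open =
  fixes \<Omega> :: "'a::euclidean_space set"
  assumes open_domain: "open \<Omega>" and bounded_domain: "bounded \<Omega>"
begin

lemma domain_sets: "\<Omega> \<in> sets lebesgue" "\<Omega> \<inter> space lebesgue \<in> sets lebesgue"
  using open_domain by auto

lemma finite_measure_domain: "finite_measure (lebesgue_on \<Omega>)"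
  by (intro finite_measure_lebesgue_on lmeasurable_open bounded_domain open_domain)

abbreviation "M\<Omega> \<equiv> lebesgue_on \<Omega>"

lemma rep_measurable_domain: "rep_l2 u \<in> borel_measurable M\<Omega>"
  by (rule measurable_restrict_space1[OF rep_l2_measurable])

lemma AE_domain: "AE x in lebesgue. P x \<Longrightarrow> AE x in M\<Omega>. P x"
  by (auto simp: AE_restrict_space_iff domain_sets elim: eventually_mono)

lemma integrable_domain: "integrable lebesgue g \<Longrightarrow> integrable M\<Omega> g" for g :: "'a \<Rightarrow> real"
  using integrable_lebesgue_on_subset[of UNIV g \<Omega>] domain_sets by (simp add: lebesgue_on_UNIV_eq)

lemma integrable_domain_const: "integrable M\<Omega> (\<lambda>_. c :: real)"
  using finite_measure_domain by (rule finite_measure.integrable_const)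

lemma rep_product_integrable_domain: "integrable M\<Omega> (\<lambda>x. \<bar>rep_l2 u x\<bar> * \<bar>rep_l2 v x\<bar>)"
  using integrable_abs[OF integrable_domain[OF square_integrable_mult[OF square_integrable_rep square_integrable_rep], of u v]]
  by (simp add: abs_mult)

lemma rep_integrable_domain: "integrable M\<Omega> (rep_l2 u)"
proof (rule Bochner_Integration.integrable_bound[OF _ rep_measurable_domain])
  show "integrable M\<Omega> (\<lambda>x. 1 + \<bar>rep_l2 u x\<bar> * \<bar>rep_l2 u x\<bar>)"
    by (intro Bochner_Integration.integrable_add integrable_domain_const rep_product_integrable_domain)
  show "AE x in M\<Omega>. norm (rep_l2 u x) \<le> norm (1 + \<bar>rep_l2 u x\<bar> * \<bar>rep_l2 u x\<bar>)"
    using abs_le_one_plus_square by (simp add: abs_mult_self_eq power2_eq_square)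
qed

lemma integral_test_eq_inner:
  assumes "\<phi> \<in> test_functions \<Omega>"
  shows "(LINT x|lebesgue_on \<Omega>. rep_l2 u x * \<phi> x) = u \<bullet> abs_l2 \<phi>"
proof -
  have "(LINT x|lebesgue_on \<Omega>. rep_l2 u x * \<phi> x) = (LINT x|lebesgue. indicator \<Omega> x *\<^sub>R (rep_l2 u x * \<phi> x))"
    by (rule integral_restrict_space[OF domain_sets(2)])
  also have "(\<lambda>x. indicator \<Omega> x *\<^sub>R (rep_l2 u x * \<phi> x)) = (\<lambda>x. rep_l2 u x * \<phi> x)"
    using test_function_props(4)[OF assms] by (auto simp: fun_eq_iff indicator_def)
  finally show ?thesis by (simp add: inner_abs_l2[OF square_integrable_test[OF assms]])
qed

text \<open>
  In terms of the inner product, weak derivatives are visibly linear in \<open>u\<close> and \<open>g\<close>.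
\<close>

lemma weak_partial_iff:
  assumes "b \<in> Basis"
  shows "weak_partial \<Omega> b u g \<longleftrightarrow>
    (\<forall>\<phi>\<in>test_functions \<Omega>. u \<bullet> abs_l2 (partial_deriv b \<phi>) = - (g \<bullet> abs_l2 \<phi>))"
  unfolding weak_partial_def
  by (intro ball_cong refl) (simp add: integral_test_eq_inner test_function_partial[OF _ assms])

lemma L2_eq_0_if_orthogonal_to_tests:
  assumes g: "g \<in> L2 \<Omega>" and 0: "\<And>\<phi>. \<phi> \<in> test_functions \<Omega> \<Longrightarrow> g \<bullet> abs_l2 \<phi> = 0"
  shows "g = 0"
proof (rule l2_eqI)
  have "AE x in lebesgue_on \<Omega>. rep_l2 g x = 0"
    by (rule fundamental_lemma_of_variations[OF open_domain rep_integrable_domain]) (simp add: integral_test_eq_inner 0)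
  then have "AE x in lebesgue. x \<in> \<Omega> \<longrightarrow> rep_l2 g x = 0"
    by (simp add: AE_restrict_space_iff domain_sets)
  moreover have "AE x in lebesgue. x \<notin> \<Omega> \<longrightarrow> rep_l2 g x = 0" using g by (simp add: L2_def)
  ultimately show "AE x in lebesgue. rep_l2 g x = rep_l2 0 x"
    using rep_zero_AE by eventually_elim auto
qed

lemma weak_partial_unique:
  assumes "b \<in> Basis" "g \<in> L2 \<Omega>" "g' \<in> L2 \<Omega>" "weak_partial \<Omega> b u g" "weak_partial \<Omega> b u g'"
  shows "g = g'"
proof -
  have "g - g' = 0"
    using assms(4,5)
    by (intro L2_eq_0_if_orthogonal_to_tests L2_diff assms)
      (auto simp: weak_partial_iff[OF assms(1)] inner_diff_left)
  then show ?thesis by simp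
qed

lemma weak_deriv_eqI:
  assumes "b \<in> Basis" "g \<in> L2 \<Omega>" "weak_partial \<Omega> b u g"
  shows "weak_deriv \<Omega> b u = g"
  unfolding weak_deriv_def
  using assms weak_partial_unique[OF assms(1)] by (intro the_equality) auto

lemma weak_deriv_H1:
  assumes "b \<in> Basis" "u \<in> H1 \<Omega>"
  shows "weak_deriv \<Omega> b u \<in> L2 \<Omega>" "weak_partial \<Omega> b u (weak_deriv \<Omega> b u)"
  using assms weak_deriv_eqI[OF assms(1)] by (auto simp: H1_def)

lemma H1_diff:
  assumes "u \<in> H1 \<Omega>" "v \<in> H1 \<Omega>"
  shows "u - v \<in> H1 \<Omega>"
    and "b \<in> Basis \<Longrightarrow> weak_deriv \<Omega> b (u - v) = weak_deriv \<Omega> b u - weak_deriv \<Omega> b v"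
proof -
  have d: "weak_deriv \<Omega> b u - weak_deriv \<Omega> b v \<in> L2 \<Omega>"
    "weak_partial \<Omega> b (u - v) (weak_deriv \<Omega> b u - weak_deriv \<Omega> b v)" if b: "b \<in> Basis" for b
    using weak_deriv_H1[OF b assms(1)] weak_deriv_H1[OF b assms(2)]
    by (auto simp: weak_partial_iff[OF b] inner_diff_left intro: L2_diff)
  then show "u - v \<in> H1 \<Omega>" using assms by (auto simp: H1_def intro: L2_diff)
  show "weak_deriv \<Omega> b (u - v) = weak_deriv \<Omega> b u - weak_deriv \<Omega> b v" if "b \<in> Basis"
    using weak_deriv_eqI[OF that d[OF that]] .
qed

lemma weak_partial_uminus:
  "b \<in> Basis \<Longrightarrow> weak_partial \<Omega> b (- u) g \<longleftrightarrow> weak_partial \<Omega> b u (- g)"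
  by (auto simp: weak_partial_iff)

lemma L2_uminus: "- u \<in> L2 \<Omega> \<longleftrightarrow> u \<in> L2 \<Omega>"
  using L2_scaleR[of u \<Omega> "-1"] L2_scaleR[of "-u" \<Omega> "-1"] by auto

text \<open>
  A metric has to be symmetric on the whole type, also outside its carrier, so all \<open>u\<close> have to be
  covered: without a weak derivative, \<open>weak_deriv\<close> takes the same default value
  for \<open>u\<close> and \<open>- u\<close>.
\<close>

lemma norm_weak_deriv_uminus:
  assumes b: "b \<in> Basis"
  shows "norm (weak_deriv \<Omega> b (- u)) = norm (weak_deriv \<Omega> b u)"
proof (cases "\<exists>g\<in>L2 \<Omega>. weak_partial \<Omega> b u g")
  case True
  then obtain g where g: "g \<in> L2 \<Omega>" "weak_partial \<Omega> b u g" by blast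
  have "weak_deriv \<Omega> b (- u) = - g"
    using g by (intro weak_deriv_eqI b) (auto simp: L2_uminus weak_partial_uminus[OF b])
  then show ?thesis using weak_deriv_eqI[OF b g] by simp
next
  case False
  then have "(\<lambda>g. g \<in> L2 \<Omega> \<and> weak_partial \<Omega> b (- u) g) = (\<lambda>g. g \<in> L2 \<Omega> \<and> weak_partial \<Omega> b u g)"
    using weak_partial_uminus[OF b] L2_uminus by (metis minus_minus)
  then show ?thesis by (simp add: weak_deriv_def)
qed

lemma H10_norm_commute: "H10_norm \<Omega> (u - v) = H10_norm \<Omega> (v - u)"
  using norm_weak_deriv_uminus[of _ "u - v"]
  by (simp add: H10_norm_def H10_inner_def power2_norm_eq_inner[symmetric] cong: sum.cong)

text \<open>
  The classical derivatives of a test function are its weak derivatives: integrate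
  \<open>\<partial>\<^sub>b (\<phi> \<psi>)\<close>.
\<close>

lemma test_in_H1:
  assumes \<phi>: "\<phi> \<in> test_functions \<Omega>"
  shows "abs_l2 \<phi> \<in> H1 \<Omega>"
    and "b \<in> Basis \<Longrightarrow> weak_deriv \<Omega> b (abs_l2 \<phi>) = abs_l2 (partial_deriv b \<phi>)"
proof -
  have d: "weak_partial \<Omega> b (abs_l2 \<phi>) (abs_l2 (partial_deriv b \<phi>))" if b: "b \<in> Basis" for b
    unfolding weak_partial_iff[OF b]
  proof
    fix \<psi> assume \<psi>: "\<psi> \<in> test_functions \<Omega>"
    note d\<phi> = test_function_partial[OF \<phi> b] and d\<psi> = test_function_partial[OF \<psi> b]
    have "partial_deriv b (\<lambda>x. \<phi> x * \<psi> x) x = \<phi> x * partial_deriv b \<psi> x + partial_deriv b \<phi> x * \<psi> x" for x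
      by (rule partial_deriv_eqI[OF has_derivative_mult[OF test_function_props(7)[OF \<phi>] test_function_props(7)[OF \<psi>]]])
    moreover have "(\<lambda>x. \<phi> x * \<psi> x) \<in> test_functions \<Omega>"
      using \<phi> \<psi> by (intro test_function_mult) (auto intro: test_function_props)
    ultimately have "(LINT x|lebesgue. \<phi> x * partial_deriv b \<psi> x + partial_deriv b \<phi> x * \<psi> x) = 0"
      using integral_partial_deriv_eq_0[OF _ b, of "\<lambda>x. \<phi> x * \<psi> x" \<Omega>] by simp
    moreover have "integrable lebesgue (\<lambda>x. \<phi> x * partial_deriv b \<psi> x)" "integrable lebesgue (\<lambda>x. partial_deriv b \<phi> x * \<psi> x)"
      by (rule square_integrable_mult[OF square_integrable_test[OF \<phi>] square_integrable_test[OF d\<psi>]]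
          square_integrable_mult[OF square_integrable_test[OF d\<phi>] square_integrable_test[OF \<psi>]])+
    moreover have "abs_l2 \<phi> \<bullet> abs_l2 (partial_deriv b \<psi>) = (LINT x|lebesgue. \<phi> x * partial_deriv b \<psi> x)"
      "abs_l2 (partial_deriv b \<phi>) \<bullet> abs_l2 \<psi> = (LINT x|lebesgue. partial_deriv b \<phi> x * \<psi> x)"
      by (rule inner_abs_abs_l2[OF square_integrable_test square_integrable_test] \<phi> \<psi> d\<phi> d\<psi>)+
    ultimately show "abs_l2 \<phi> \<bullet> abs_l2 (partial_deriv b \<psi>) = - (abs_l2 (partial_deriv b \<phi>) \<bullet> abs_l2 \<psi>)"
      by simp
  qed
  show "abs_l2 \<phi> \<in> H1 \<Omega>"
    using d abs_test_in_L2[OF \<phi>] abs_test_in_L2[OF test_function_partial[OF \<phi>]] by (auto simp: H1_def)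
  show "weak_deriv \<Omega> b (abs_l2 \<phi>) = abs_l2 (partial_deriv b \<phi>)" if b: "b \<in> Basis"
    by (rule weak_deriv_eqI[OF b abs_test_in_L2[OF test_function_partial[OF \<phi> b]] d[OF b]])
qed

lemma H1_norm_ge: "norm u \<le> H1_norm \<Omega> u" "b \<in> Basis \<Longrightarrow> norm (weak_deriv \<Omega> b u) \<le> H1_norm \<Omega> u"
proof -
  show "norm u \<le> H1_norm \<Omega> u"
    unfolding H1_norm_def by (rule real_le_rsqrt) (simp add: sum_nonneg)
  show "norm (weak_deriv \<Omega> b u) \<le> H1_norm \<Omega> u" if "b \<in> Basis"
    unfolding H1_norm_def
    using member_le_sum[of b Basis "\<lambda>b. (norm (weak_deriv \<Omega> b u))\<^sup>2"] that
    by (intro real_le_rsqrt) (simp add: add_increasing)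
qed

lemma H1_norm_diff_le:
  assumes "u \<in> H1 \<Omega>" "v \<in> H1 \<Omega>"
  shows "(H1_norm \<Omega> (u - v))\<^sup>2 \<le> 2 * (H1_norm \<Omega> u)\<^sup>2 + 2 * (H1_norm \<Omega> v)\<^sup>2"
proof -
  have *: "(norm (x - y))\<^sup>2 \<le> 2 * (norm x)\<^sup>2 + 2 * (norm y)\<^sup>2" for x y :: "'a l2"
  proof -
    have "(norm (x - y))\<^sup>2 \<le> (norm x + norm y)\<^sup>2" by (intro power_mono norm_triangle_ineq4) simp
    also have "\<dots> \<le> 2 * (norm x)\<^sup>2 + 2 * (norm y)\<^sup>2"
      using sum_squares_bound[of "norm x" "norm y"] by (simp add: power2_sum)
    finally show ?thesis .
  qed
  have "(\<Sum>b\<in>Basis. (norm (weak_deriv \<Omega> b (u - v)))\<^sup>2)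
     \<le> (\<Sum>b\<in>Basis. 2 * (norm (weak_deriv \<Omega> b u))\<^sup>2 + 2 * (norm (weak_deriv \<Omega> b v))\<^sup>2)"
    by (intro sum_mono) (simp add: H1_diff(2)[OF assms] *)
  then show ?thesis
    using *[of u v] by (simp add: H1_norm_def sum_nonneg sum.distrib sum_distrib_left)
qed

lemma H10_imp_H1: "u \<in> H10 \<Omega> \<Longrightarrow> u \<in> H1 \<Omega>"
  and H10_imp_L2: "u \<in> H10 \<Omega> \<Longrightarrow> u \<in> L2 \<Omega>"
  by (auto simp: H10_def H1_def)

lemma H10_diff:
  assumes "u \<in> H10 \<Omega>" "v \<in> H10 \<Omega>"
  shows "u - v \<in> H10 \<Omega>"
  unfolding H10_def mem_Collect_eq
proof (intro conjI allI impI)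
  show "u - v \<in> H1 \<Omega>" using assms by (intro H1_diff H10_imp_H1)
  fix e :: real assume e: "e > 0"
  obtain \<phi> where \<phi>: "\<phi> \<in> test_functions \<Omega>" "H1_norm \<Omega> (u - abs_l2 \<phi>) < e/2"
    using assms(1) e unfolding H10_def by (auto dest!: spec[of _ "e/2"])
  obtain \<psi> where \<psi>: "\<psi> \<in> test_functions \<Omega>" "H1_norm \<Omega> (v - abs_l2 \<psi>) < e/2"
    using assms(2) e unfolding H10_def by (auto dest!: spec[of _ "e/2"])
  let ?w = "\<lambda>x. \<phi> x - \<psi> x"
  have w: "?w \<in> test_functions \<Omega>"
    using test_function_add[OF \<phi>(1) test_function_mult[OF \<psi>(1) C_k_const, of "-1"]] by simp
  have eq: "u - v - abs_l2 ?w = (u - abs_l2 \<phi>) - (v - abs_l2 \<psi>)"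
    unfolding abs_l2_diff[OF square_integrable_test[OF \<phi>(1)] square_integrable_test[OF \<psi>(1)], symmetric] by simp
  have "(H1_norm \<Omega> ((u - abs_l2 \<phi>) - (v - abs_l2 \<psi>)))\<^sup>2
      \<le> 2 * (H1_norm \<Omega> (u - abs_l2 \<phi>))\<^sup>2 + 2 * (H1_norm \<Omega> (v - abs_l2 \<psi>))\<^sup>2"
    by (intro H1_norm_diff_le H1_diff H10_imp_H1 assms test_in_H1 \<phi> \<psi>)
  moreover have "(H1_norm \<Omega> (u - abs_l2 \<phi>))\<^sup>2 < (e/2)\<^sup>2" "(H1_norm \<Omega> (v - abs_l2 \<psi>))\<^sup>2 < (e/2)\<^sup>2"
    using \<phi>(2) \<psi>(2) norm_ge_zero H1_norm_ge(1) by (meson order_trans pos2 power_strict_mono)+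
  ultimately have "(H1_norm \<Omega> (u - v - abs_l2 ?w))\<^sup>2 < e\<^sup>2" unfolding power_divide eq by simp
  then have "H1_norm \<Omega> (u - v - abs_l2 ?w) < e" using e by (simp add: power_less_imp_less_base)
  then show "\<exists>\<phi>\<in>test_functions \<Omega>. H1_norm \<Omega> (u - v - abs_l2 \<phi>) < e" using w by blast
qed

lemma H10_norm_L2_set: "H10_norm \<Omega> u = L2_set (\<lambda>b. norm (weak_deriv \<Omega> b u)) Basis"
  by (simp add: H10_norm_def H10_inner_def L2_set_def power2_norm_eq_inner)

lemma H10_norm_nonneg: "0 \<le> H10_norm \<Omega> u"
  by (simp add: H10_norm_L2_set L2_set_nonneg)

lemma H10_norm_square: "(H10_norm \<Omega> u)\<^sup>2 = H10_inner \<Omega> u u"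
  by (simp add: H10_norm_def H10_inner_def sum_nonneg)

lemma H10_norm_triangle:
  assumes "u \<in> H10 \<Omega>" "v \<in> H10 \<Omega>" "w \<in> H10 \<Omega>"
  shows "H10_norm \<Omega> (u - w) \<le> H10_norm \<Omega> (u - v) + H10_norm \<Omega> (v - w)"
proof -
  have "norm (weak_deriv \<Omega> b (u - w)) \<le> norm (weak_deriv \<Omega> b (u - v)) + norm (weak_deriv \<Omega> b (v - w))"
    if "b \<in> Basis" for b
    using norm_triangle_ineq[of "weak_deriv \<Omega> b (u - v)" "weak_deriv \<Omega> b (v - w)"]
    by (simp add: H1_diff(2)[OF _ _ that] assms H10_imp_H1)
  then have "H10_norm \<Omega> (u - w) \<le> L2_set (\<lambda>b. norm (weak_deriv \<Omega> b (u - v)) + norm (weak_deriv \<Omega> b (v - w))) Basis"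
    unfolding H10_norm_L2_set by (intro L2_set_mono) auto
  also have "\<dots> \<le> H10_norm \<Omega> (u - v) + H10_norm \<Omega> (v - w)"
    unfolding H10_norm_L2_set by (rule L2_set_triangle_ineq)
  finally show ?thesis .
qed

lemma H10_inner_diff_left:
  "u \<in> H10 \<Omega> \<Longrightarrow> v \<in> H10 \<Omega> \<Longrightarrow> H10_inner \<Omega> (u - v) w = H10_inner \<Omega> u w - H10_inner \<Omega> v w"
  by (simp add: H10_inner_def H1_diff(2) H10_imp_H1 inner_diff_left sum_subtractf)

lemma H10_inner_commute: "H10_inner \<Omega> u v = H10_inner \<Omega> v u"
  by (simp add: H10_inner_def inner_commute)

lemma H10_inner_Cauchy_Schwarz: "\<bar>H10_inner \<Omega> u v\<bar> \<le> H10_norm \<Omega> u * H10_norm \<Omega> v"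
proof -
  have "\<bar>H10_inner \<Omega> u v\<bar> \<le> (\<Sum>b\<in>Basis. \<bar>weak_deriv \<Omega> b u \<bullet> weak_deriv \<Omega> b v\<bar>)"
    unfolding H10_inner_def by (rule sum_abs)
  also have "\<dots> \<le> (\<Sum>b\<in>Basis. \<bar>norm (weak_deriv \<Omega> b u)\<bar> * \<bar>norm (weak_deriv \<Omega> b v)\<bar>)"
    by (intro sum_mono) (simp add: Cauchy_Schwarz_ineq2)
  also have "\<dots> \<le> H10_norm \<Omega> u * H10_norm \<Omega> v"
    unfolding H10_norm_L2_set by (rule L2_set_mult_ineq)
  finally show ?thesis .
qed

section \<open>The Poincare inequality\<close>

text \<open>
  The integral of \<open>\<partial>\<^sub>b ((x \<bullet> b) \<phi>\<^sup>2) = \<phi>\<^sup>2 + 2 (x \<bullet> b) \<phi> \<partial>\<^sub>b \<phi>\<close> vanishes, and \<open>|x \<bullet> b| \<le> R\<close> on \<open>\<Omega>\<close>.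
  The Cauchy-Schwarz inequality does the rest.
\<close>

lemma poincare_test:
  assumes \<phi>: "\<phi> \<in> test_functions \<Omega>" and b: "b \<in> Basis" and R: "R > 0" "\<And>x. x \<in> \<Omega> \<Longrightarrow> norm x \<le> R"
  shows "norm (abs_l2 \<phi>) \<le> 2 * R * norm (abs_l2 (partial_deriv b \<phi>))"
proof -
  let ?d = "partial_deriv b \<phi>"
  note d = test_function_partial[OF \<phi> b]
  let ?F = "\<lambda>x. (x \<bullet> b) * (\<phi> x * \<phi> x)"
  let ?p = "\<lambda>x. \<phi> x * \<phi> x" and ?q = "\<lambda>x. 2 * ((x \<bullet> b) * \<phi> x) * ?d x"
  have x\<phi>: "(\<lambda>x. (x \<bullet> b) * \<phi> x) \<in> test_functions \<Omega>"
    by (intro test_function_mult \<phi> C_k_inner)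
  have F: "?F \<in> test_functions \<Omega>"
    by (intro test_function_mult \<phi> C_k_inner test_function_props(1)[OF \<phi>])
  have "partial_deriv b ?F x = ?p x + ?q x" for x
  proof -
    have "(?F has_derivative (\<lambda>h. (x \<bullet> b) * (\<phi> x * partial_deriv h \<phi> x + partial_deriv h \<phi> x * \<phi> x) + (h \<bullet> b) * (\<phi> x * \<phi> x))) (at x)"
      by (intro has_derivative_mult test_function_props(7)[OF \<phi>] has_derivative_inner_left has_derivative_ident)
    from partial_deriv_eqI[OF this, of b] show ?thesis using b by (simp add: inner_same_Basis algebra_simps)
  qed
  with integral_partial_deriv_eq_0[OF F b] have 0: "(LINT x|lebesgue. ?p x + ?q x) = 0" by simp
  have ip: "integrable lebesgue ?p" by (intro square_integrable_mult square_integrable_test[OF \<phi>])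
  have i1: "integrable lebesgue (\<lambda>x. \<bar>\<phi> x\<bar> * \<bar>?d x\<bar>)"
    using integrable_abs[OF square_integrable_mult[OF square_integrable_test[OF \<phi>] square_integrable_test[OF d]]]
    by (simp add: abs_mult)
  have iq: "integrable lebesgue ?q"
    using integrable_mult_right[OF square_integrable_mult[OF square_integrable_test[OF x\<phi>] square_integrable_test[OF d]], of 2]
    by (simp add: mult.assoc)
  have norm\<phi>: "(norm (abs_l2 \<phi>))\<^sup>2 = (LINT x|lebesgue. ?p x)"
    by (simp add: power2_norm_eq_inner inner_abs_abs_l2 square_integrable_test[OF \<phi>])
  define a where "a = abs_l2 (\<lambda>x. \<bar>\<phi> x\<bar>)"
  define c where "c = abs_l2 (\<lambda>x. \<bar>?d x\<bar>)"
  have sq: "square_integrable (\<lambda>x. \<bar>\<phi> x\<bar>)" "square_integrable (\<lambda>x. \<bar>?d x\<bar>)"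
    using square_integrable_test[OF \<phi>] square_integrable_test[OF d] by (auto simp: square_integrable_def)
  have na: "norm a = norm (abs_l2 \<phi>)" "norm c = norm (abs_l2 ?d)"
    using sq square_integrable_test[OF \<phi>] square_integrable_test[OF d]
    by (simp_all add: a_def c_def norm_eq_sqrt_inner inner_abs_abs_l2)
  have "(norm (abs_l2 \<phi>))\<^sup>2 = - (LINT x|lebesgue. ?q x)"
    using 0 ip iq norm\<phi> by simp
  also have "\<dots> = (LINT x|lebesgue. - ?q x)" by simp
  also have "\<dots> \<le> (LINT x|lebesgue. 2 * R * (\<bar>\<phi> x\<bar> * \<bar>?d x\<bar>))"
  proof (rule integral_mono)
    fix x
    show "- ?q x \<le> 2 * R * (\<bar>\<phi> x\<bar> * \<bar>?d x\<bar>)"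
    proof (cases "\<phi> x = 0")
      case False
      then have "\<bar>x \<bullet> b\<bar> \<le> R" using test_function_props(4)[OF \<phi>] R(2)[of x] Basis_le_norm[OF b, of x] by force
      then have "\<bar>x \<bullet> b\<bar> * (\<bar>\<phi> x\<bar> * \<bar>?d x\<bar>) \<le> R * (\<bar>\<phi> x\<bar> * \<bar>?d x\<bar>)" by (intro mult_right_mono) auto
      moreover have "- ?q x \<le> 2 * (\<bar>x \<bullet> b\<bar> * (\<bar>\<phi> x\<bar> * \<bar>?d x\<bar>))"
        using abs_ge_minus_self[of "?q x"] by (simp add: abs_mult mult.assoc)
      ultimately show ?thesis by linarith
    qed simp
  qed (use i1 iq in auto)
  also have "\<dots> = 2 * R * (a \<bullet> c)"
    using sq by (simp add: a_def c_def inner_abs_abs_l2)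
  also have "\<dots> \<le> 2 * R * (norm a * norm c)"
    using norm_cauchy_schwarz R by (intro mult_left_mono) auto
  finally have "norm (abs_l2 \<phi>) * norm (abs_l2 \<phi>) \<le> (2 * R * norm (abs_l2 ?d)) * norm (abs_l2 \<phi>)"
    by (simp add: na power2_eq_square algebra_simps)
  then show ?thesis
    using R by (cases "norm (abs_l2 \<phi>) = 0") (auto simp: mult_le_cancel_right)
qed

lemma poincare_inequality:
  obtains P where "P > 0" "\<And>u. u \<in> H10 \<Omega> \<Longrightarrow> norm u \<le> P * H10_norm \<Omega> u"
proof -
  obtain R where R: "R > 0" "\<And>x. x \<in> \<Omega> \<Longrightarrow> norm x \<le> R"
    using bounded_domain unfolding bounded_pos by blast
  obtain b :: 'a where b: "b \<in> Basis" using nonempty_Basis by blast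
  have "norm u \<le> 2 * R * H10_norm \<Omega> u" if u: "u \<in> H10 \<Omega>" for u
  proof -
    have "norm u \<le> 2 * R * norm (weak_deriv \<Omega> b u)"
    proof (rule field_le_epsilon)
      fix e :: real assume e: "e > 0"
      define e' where "e' = e / (1 + 2 * R)"
      have e': "e' > 0" "e' * (1 + 2 * R) = e" using e R by (auto simp: e'_def)
      obtain \<phi> where \<phi>: "\<phi> \<in> test_functions \<Omega>" "H1_norm \<Omega> (u - abs_l2 \<phi>) < e'"
        using u e'(1) unfolding H10_def by blast
      have 1: "norm (u - abs_l2 \<phi>) < e'" using H1_norm_ge(1)[of "u - abs_l2 \<phi>"] \<phi>(2) by simp
      have "norm (weak_deriv \<Omega> b u - abs_l2 (partial_deriv b \<phi>)) < e'"
        using H1_norm_ge(2)[OF b, of "u - abs_l2 \<phi>"] \<phi>(2)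
        by (simp add: H1_diff(2)[OF H10_imp_H1[OF u] test_in_H1(1)[OF \<phi>(1)] b] test_in_H1(2)[OF \<phi>(1) b])
      then have "norm (abs_l2 (partial_deriv b \<phi>)) \<le> norm (weak_deriv \<Omega> b u) + e'"
        using norm_triangle_ineq2[of "abs_l2 (partial_deriv b \<phi>)" "weak_deriv \<Omega> b u"] by (simp add: norm_minus_commute)
      then have "2 * R * norm (abs_l2 (partial_deriv b \<phi>)) \<le> 2 * R * (norm (weak_deriv \<Omega> b u) + e')"
        using R by (intro mult_left_mono) auto
      moreover have "norm u \<le> norm (abs_l2 \<phi>) + norm (u - abs_l2 \<phi>)"
        using norm_triangle_ineq[of "abs_l2 \<phi>" "u - abs_l2 \<phi>"] by simp
      ultimately have "norm u \<le> 2 * R * norm (weak_deriv \<Omega> b u) + e' * (1 + 2 * R)"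
        using poincare_test[OF \<phi>(1) b R] 1 by (simp add: algebra_simps)
      then show "norm u \<le> 2 * R * norm (weak_deriv \<Omega> b u) + e" by (simp add: e')
    qed
    also have "\<dots> \<le> 2 * R * H10_norm \<Omega> u"
      unfolding H10_norm_L2_set using R b
      by (intro mult_left_mono member_le_L2_set[of Basis b "\<lambda>b. norm (weak_deriv \<Omega> b u)"]) auto
    finally show ?thesis .
  qed
  then show ?thesis using that[of "2 * R"] R by simp
qed

end

section \<open>Translation and restriction of time intervals\<close>

lemma shift_measurable_lebesgue: "(\<lambda>t::real. t + s) \<in> lebesgue \<rightarrow>\<^sub>M lebesgue"
  using lebesgue_affine_measurable[of "\<lambda>_::real. 1" s] by (simp add: add.commute)

lemma AE_lebesgue_shift:
  fixes P :: "real \<Rightarrow> bool"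
  assumes "AE t in lebesgue. P t"
  shows "AE t in lebesgue. P (t + s)"
proof -
  obtain N where N: "negligible N" "{t. \<not> P t} \<subseteq> N"
    using assms by (auto simp: eventually_ae_filter_negligible)
  have "negligible ((+) (- s) ` N)" by (rule negligible_translation[OF N(1)])
  moreover have "{t. \<not> P (t + s)} \<subseteq> (+) (- s) ` N"
  proof
    fix t assume "t \<in> {t. \<not> P (t + s)}"
    then have "t + s \<in> N" using N(2) by auto
    then show "t \<in> (+) (- s) ` N" by (rule rev_image_eqI) simp
  qed
  ultimately show ?thesis unfolding eventually_ae_filter_negligible by blast
qed

lemma AE_interval_shift:
  fixes P :: "real \<Rightarrow> bool"
  assumes "AE t in lebesgue_on {a + s<..<b + s}. P t"
  shows "AE t in lebesgue_on {a<..<b}. P (t + s)"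
  using AE_lebesgue_shift[of "\<lambda>t. t \<in> {a + s<..<b + s} \<longrightarrow> P t" s] assms
  by (simp add: AE_restrict_space_iff)

lemma AE_lebesgue_on_subset:
  assumes "J \<subseteq> I" "I \<in> sets lebesgue" "J \<in> sets lebesgue" "AE t in lebesgue_on I. P t"
  shows "AE t in lebesgue_on J. P t"
  using assms by (auto simp: AE_restrict_space_iff elim: eventually_mono)

lemma simple_function_lebesgue_on_subset:
  assumes s: "simple_function (lebesgue_on I) g" and J: "J \<subseteq> I" "J \<in> sets lebesgue" "I \<in> sets lebesgue"
  shows "simple_function (lebesgue_on J) g"
  unfolding simple_function_def
proof (intro conjI ballI)
  show "finite (g ` space (lebesgue_on J))"
    using s J finite_subset[of "g ` J" "g ` I"] by (auto simp: simple_function_def)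
  fix y assume "y \<in> g ` space (lebesgue_on J)"
  then have "g -` {y} \<inter> I \<in> sets (lebesgue_on I)"
    using s J by (auto simp: simple_function_def)
  then have "g -` {y} \<inter> I \<in> sets lebesgue"
    using J(3) by (simp add: sets_restrict_space_iff)
  then have "(g -` {y} \<inter> I) \<inter> J \<in> sets lebesgue" using J(2) by (rule sets.Int)
  also have "(g -` {y} \<inter> I) \<inter> J = g -` {y} \<inter> J" using J(1) by blast
  finally show "g -` {y} \<inter> space (lebesgue_on J) \<in> sets (lebesgue_on J)"
    using J(2) by (simp add: sets_restrict_space_iff)
qed

lemma strongly_measurable_subset:
  assumes u: "strongly_measurable I X N u" and J: "J \<subseteq> I" "J \<in> sets lebesgue" "I \<in> sets lebesgue"
  shows "strongly_measurable J X N u"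
proof -
  obtain s where s: "\<And>n::nat. simple_function (lebesgue_on I) (s n) \<and> s n ` I \<subseteq> X"
    "AE t in lebesgue_on I. (\<lambda>n. N (s n t - u t)) \<longlonglongrightarrow> 0"
    using u unfolding strongly_measurable_def by blast
  have "simple_function (lebesgue_on J) (s n) \<and> s n ` J \<subseteq> X" for n
    using simple_function_lebesgue_on_subset[OF conjunct1[OF s(1)] J] s(1)[of n] J(1) by blast
  moreover have "AE t in lebesgue_on J. (\<lambda>n. N (s n t - u t)) \<longlonglongrightarrow> 0"
    by (rule AE_lebesgue_on_subset[OF J(1,3,2) s(2)])
  moreover have "AE t in lebesgue_on J. u t \<in> X"
    using u by (intro AE_lebesgue_on_subset[OF J(1,3,2)]) (simp add: strongly_measurable_def)
  ultimately show ?thesis unfolding strongly_measurable_def by blast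
qed

lemma nn_integral_lebesgue_on_subset:
  assumes J: "J \<subseteq> I" "J \<in> sets lebesgue" "I \<in> sets lebesgue"
  shows "(\<integral>\<^sup>+ t. g t \<partial>lebesgue_on J) \<le> (\<integral>\<^sup>+ t. g t \<partial>lebesgue_on I)"
  using J by (auto simp: nn_integral_restrict_space intro!: nn_integral_mono split: split_indicator)

lemma bochner_Lp_subset:
  assumes "u \<in> bochner_Lp p I X N" and J: "J \<subseteq> I" "J \<in> sets lebesgue" "I \<in> sets lebesgue"
  shows "u \<in> bochner_Lp p J X N"
  using assms(1) strongly_measurable_subset[OF _ J]
    le_less_trans[OF nn_integral_lebesgue_on_subset[OF J, of "\<lambda>t. ennreal (N (u t) ^ p)"]]
  unfolding bochner_Lp_def by auto

lemma bochner_Linf_subset: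
  assumes "u \<in> bochner_Linf I X N" and J: "J \<subseteq> I" "J \<in> sets lebesgue" "I \<in> sets lebesgue"
  shows "u \<in> bochner_Linf J X N"
  using assms(1) strongly_measurable_subset[OF _ J] AE_lebesgue_on_subset[OF J(1,3,2)]
  unfolding bochner_Linf_def by blast

lemma strongly_measurable_shift:
  assumes u: "strongly_measurable {a + s<..<b + s} X N u"
  shows "strongly_measurable {a<..<b} X N (\<lambda>t. u (t + s))"
proof -
  let ?I = "{a + s<..<b + s}" and ?J = "{a<..<b}"
  obtain g where g: "\<And>n::nat. simple_function (lebesgue_on ?I) (g n) \<and> g n ` ?I \<subseteq> X"
    "AE t in lebesgue_on ?I. (\<lambda>n. N (g n t - u t)) \<longlonglongrightarrow> 0"
    using u unfolding strongly_measurable_def by blast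
  have shift: "(\<lambda>t. t + s) ` ?J \<subseteq> ?I" by auto
  have "simple_function (lebesgue_on ?J) (\<lambda>t. g n (t + s))" for n
    unfolding simple_function_def
  proof (intro conjI ballI)
    have "(\<lambda>t. g n (t + s)) ` ?J \<subseteq> g n ` ?I" using shift by auto
    then show "finite ((\<lambda>t. g n (t + s)) ` space (lebesgue_on ?J))"
      using g(1)[of n] finite_subset by (auto simp: simple_function_def)
    fix y assume "y \<in> (\<lambda>t. g n (t + s)) ` space (lebesgue_on ?J)"
    then have "g n -` {y} \<inter> ?I \<in> sets (lebesgue_on ?I)"
      using g(1)[of n] shift by (auto simp: simple_function_def)
    then have "g n -` {y} \<inter> ?I \<in> sets lebesgue" by (simp add: sets_restrict_space_iff)
    from measurable_sets[OF shift_measurable_lebesgue this, of s]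
    have "(\<lambda>t. t + s) -` (g n -` {y} \<inter> ?I) \<in> sets lebesgue" by simp
    also have "(\<lambda>t. t + s) -` (g n -` {y} \<inter> ?I) = (\<lambda>t. g n (t + s)) -` {y} \<inter> ?J" by auto
    finally show "(\<lambda>t. g n (t + s)) -` {y} \<inter> space (lebesgue_on ?J) \<in> sets (lebesgue_on ?J)"
      by (simp add: sets_restrict_space_iff)
  qed
  moreover have "(\<lambda>t. g n (t + s)) ` ?J \<subseteq> X" for n using g(1)[of n] shift by auto
  moreover have "AE t in lebesgue_on ?J. (\<lambda>n. N (g n (t + s) - u (t + s))) \<longlonglongrightarrow> 0"
    using AE_interval_shift[OF g(2)] .
  moreover have "AE t in lebesgue_on ?J. u (t + s) \<in> X"
    using u AE_interval_shift[where P="\<lambda>t. u t \<in> X" and a=a and s=s and b=b] by (simp add: strongly_measurable_def)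
  ultimately show ?thesis unfolding strongly_measurable_def by (intro conjI exI[of _ "\<lambda>n t. g n (t + s)"]) auto
qed

text \<open>
  Here \<open>g\<close> is arbitrary, because the norm of a Bochner integrable function need not be known to be
  measurable at this stage. The integral is a supremum over simple functions below \<open>g\<close>, and these can
  be translated.
\<close>

lemma nn_integral_shift_le:
  fixes g :: "real \<Rightarrow> ennreal"
  shows "(\<integral>\<^sup>+ t. g (t + s) \<partial>lebesgue) \<le> (\<integral>\<^sup>+ t. g t \<partial>lebesgue)"
  unfolding nn_integral_def[of lebesgue "\<lambda>t. g (t + s)"]
proof (rule SUP_least)
  fix k assume "k \<in> {k. simple_function lebesgue k \<and> k \<le> (\<lambda>t. g (t + s))}"
  then have k: "simple_function lebesgue k" "\<And>t. k t \<le> g (t + s)" by (auto simp: le_fun_def)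
  have km: "k \<in> borel_measurable lebesgue" by (rule borel_measurable_simple_function[OF k(1)])
  have "integral\<^sup>S lebesgue k = (\<integral>\<^sup>+ t. k t \<partial>lebesgue)" by (rule nn_integral_eq_simple_integral[OF k(1), symmetric])
  also have "\<dots> = (\<integral>\<^sup>+ t. k (- s + 1 * t) \<partial>lebesgue)"
    using nn_integral_real_affine_lebesgue[OF km, of 1 "- s"] by simp
  also have "\<dots> \<le> (\<integral>\<^sup>+ t. g t \<partial>lebesgue)"
    using k(2) by (intro nn_integral_mono) (metis add.commute add.right_inverse add_0 group_cancel.add1 mult_1 uminus_add_conv_diff diff_add_cancel)
  finally show "integral\<^sup>S lebesgue k \<le> (\<integral>\<^sup>+ t. g t \<partial>lebesgue)" .
qed

lemma bochner_Lp_shift: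
  assumes "u \<in> bochner_Lp p {a + s<..<b + s} X N"
  shows "(\<lambda>t. u (t + s)) \<in> bochner_Lp p {a<..<b} X N"
proof -
  have "(\<integral>\<^sup>+ t. ennreal (N (u (t + s)) ^ p) \<partial>lebesgue_on {a<..<b})
    = (\<integral>\<^sup>+ t. ennreal (N (u (t + s)) ^ p) * indicator {a + s<..<b + s} (t + s) \<partial>lebesgue)"
    by (simp add: nn_integral_restrict_space indicator_def)
  also have "\<dots> \<le> (\<integral>\<^sup>+ t. ennreal (N (u t) ^ p) * indicator {a + s<..<b + s} t \<partial>lebesgue)"
    by (rule nn_integral_shift_le)
  also have "\<dots> = (\<integral>\<^sup>+ t. ennreal (N (u t) ^ p) \<partial>lebesgue_on {a + s<..<b + s})"
    by (simp add: nn_integral_restrict_space)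
  also have "\<dots> < \<infinity>" using assms by (simp add: bochner_Lp_def)
  finally show ?thesis
    using assms strongly_measurable_shift by (auto simp: bochner_Lp_def)
qed

lemma bochner_Linf_shift:
  assumes "u \<in> bochner_Linf {a + s<..<b + s} X N"
  shows "(\<lambda>t. u (t + s)) \<in> bochner_Linf {a<..<b} X N"
  using assms strongly_measurable_shift[of a s b X N u] AE_interval_shift[where a=a and s=s and b=b]
  unfolding bochner_Linf_def by blast

lemma test_functions_mono: "\<Omega> \<subseteq> \<Omega>' \<Longrightarrow> test_functions \<Omega> \<subseteq> test_functions \<Omega>'"
  by (auto simp: test_functions_def)

lemma test_function_DERIV:
  fixes \<eta> :: "real \<Rightarrow> real"
  assumes "\<eta> \<in> test_functions I"
  shows "(\<eta> has_real_derivative deriv \<eta> t) (at t)" "deriv \<eta> = partial_deriv 1 \<eta>"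
proof -
  have *: "(\<eta> has_real_derivative partial_deriv 1 \<eta> t) (at t)" for t
  proof -
    have D: "(\<eta> has_derivative (\<lambda>b. partial_deriv b \<eta> t)) (at t)" by (rule test_function_props(7)[OF assms])
    have "partial_deriv b \<eta> t = partial_deriv 1 \<eta> t * b" for b
      using linear_scale[OF has_derivative_linear[OF D], of b 1] by (simp add: mult.commute)
    then have "(\<lambda>b. partial_deriv b \<eta> t) = (*) (partial_deriv 1 \<eta> t)" by (intro ext)
    with D show ?thesis unfolding has_field_derivative_def by (rule subst[rotated])
  qed
  have **: "deriv \<eta> t = partial_deriv 1 \<eta> t" for t by (rule DERIV_imp_deriv[OF *])
  then show "deriv \<eta> = partial_deriv 1 \<eta>" by (intro ext)
  show "(\<eta> has_real_derivative deriv \<eta> t) (at t)" unfolding ** by (rule *)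
qed

lemma test_function_deriv:
  fixes \<eta> :: "real \<Rightarrow> real"
  assumes "\<eta> \<in> test_functions I"
  shows "deriv \<eta> \<in> test_functions I"
  using test_function_partial[OF assms, of 1] test_function_DERIV(2)[OF assms] by simp

lemma test_function_shift:
  fixes \<eta> :: "real \<Rightarrow> real"
  assumes "\<eta> \<in> test_functions {a<..<b}"
  shows "(\<lambda>t. \<eta> (t - s)) \<in> test_functions {a + s<..<b + s}" "deriv (\<lambda>t. \<eta> (t - s)) t = deriv \<eta> (t - s)"
proof -
  let ?K = "closure {t. \<eta> t \<noteq> 0}"
  show "(\<lambda>t. \<eta> (t - s)) \<in> test_functions {a + s<..<b + s}"
  proof (rule test_functionsI[of _ "(\<lambda>t. s + t) ` ?K"])
    show "C_k k (\<lambda>t. \<eta> (t - s))" for k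
      using C_k_affine[OF test_function_props(1)[OF assms], of k 1 "- s"] by simp
    show "compact ((+) s ` ?K)" by (rule compact_translation[OF test_function_props(2)[OF assms]])
    show "(+) s ` ?K \<subseteq> {a + s<..<b + s}" using test_function_props(3)[OF assms] by force
    show "t \<in> (+) s ` ?K" if "\<eta> (t - s) \<noteq> 0" for t
      using test_function_props(5)[OF assms that] by (rule rev_image_eqI) simp
  qed
  have "((\<lambda>t. \<eta> (t - s)) has_real_derivative deriv \<eta> (t - s)) (at t)"
    using DERIV_shift[of \<eta> "deriv \<eta> (t - s)" t "- s"] test_function_DERIV(1)[OF assms, of "t - s"] by simp
  then show "deriv (\<lambda>t. \<eta> (t - s)) t = deriv \<eta> (t - s)" by (rule DERIV_imp_deriv)
qed

lemma integral_times_test_eq: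
  fixes g :: "real \<Rightarrow> real"
  assumes \<eta>: "\<eta> \<in> test_functions J" and J: "J \<subseteq> I" "I \<in> sets lebesgue"
  shows "(LINT t|lebesgue_on I. g t * \<eta> t) = (LINT t|lebesgue. g t * \<eta> t)"
proof -
  have "(\<lambda>t. indicator I t *\<^sub>R (g t * \<eta> t)) = (\<lambda>t. g t * \<eta> t)"
    using test_function_props(4)[OF \<eta>] J by (auto simp: fun_eq_iff indicator_def)
  then show ?thesis using J by (simp add: integral_restrict_space)
qed

lemma integral_lebesgue_shift:
  fixes g :: "real \<Rightarrow> real"
  shows "(LINT t|lebesgue. g (t + s)) = (LINT t|lebesgue. g t)"
  using lebesgue_integral_real_affine[of 1 g s] by (simp add: add.commute)

lemma weak_time_deriv_subset:
  assumes "weak_time_deriv I \<Omega> u w" "J \<subseteq> I" "I \<in> sets lebesgue" "J \<in> sets lebesgue"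
  shows "weak_time_deriv J \<Omega> u w"
  unfolding weak_time_deriv_def
proof (intro ballI)
  fix v \<eta> assume v: "v \<in> L2 \<Omega>" and \<eta>: "\<eta> \<in> test_functions J"
  have "\<eta> \<in> test_functions I" using \<eta> test_functions_mono[OF assms(2)] by blast
  then have "(LINT t|lebesgue_on I. (u t \<bullet> v) * deriv \<eta> t) = - (LINT t|lebesgue_on I. (w t \<bullet> v) * \<eta> t)"
    using assms(1) v unfolding weak_time_deriv_def by blast
  then show "(LINT t|lebesgue_on J. (u t \<bullet> v) * deriv \<eta> t) = - (LINT t|lebesgue_on J. (w t \<bullet> v) * \<eta> t)"
    using \<eta> assms(2-4) by (simp add: integral_times_test_eq[of _ J] test_function_deriv)
qed

lemma weak_time_deriv_shift:
  assumes "weak_time_deriv {a + s<..<b + s} \<Omega> u w"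
  shows "weak_time_deriv {a<..<b} \<Omega> (\<lambda>t. u (t + s)) (\<lambda>t. w (t + s))"
  unfolding weak_time_deriv_def
proof (intro ballI)
  fix v \<eta> assume v: "v \<in> L2 \<Omega>" and \<eta>: "\<eta> \<in> test_functions {a<..<b}"
  let ?I = "{a + s<..<b + s}" and ?\<zeta> = "\<lambda>t. \<eta> (t - s)"
  have "(LINT t|lebesgue_on ?I. (u t \<bullet> v) * deriv ?\<zeta> t) = - (LINT t|lebesgue_on ?I. (w t \<bullet> v) * ?\<zeta> t)"
    using assms v test_function_shift(1)[OF \<eta>] unfolding weak_time_deriv_def by blast
  then have "(LINT t|lebesgue. (u t \<bullet> v) * deriv ?\<zeta> t) = - (LINT t|lebesgue. (w t \<bullet> v) * ?\<zeta> t)"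
    using integral_times_test_eq[OF test_function_shift(1)[OF \<eta>], of s]
      integral_times_test_eq[OF test_function_deriv[OF test_function_shift(1)[OF \<eta>]], of s] by simp
  then show "(LINT t|lebesgue_on {a<..<b}. (u (t + s) \<bullet> v) * deriv \<eta> t) = - (LINT t|lebesgue_on {a<..<b}. (w (t + s) \<bullet> v) * \<eta> t)"
    using integral_lebesgue_shift[of "\<lambda>t. (u t \<bullet> v) * deriv \<eta> (t - s)" s]
      integral_lebesgue_shift[of "\<lambda>t. (w t \<bullet> v) * \<eta> (t - s)" s]
    by (simp add: integral_times_test_eq[OF \<eta> order_refl] integral_times_test_eq[OF test_function_deriv[OF \<eta>] order_refl]
        test_function_shift(2)[OF \<eta>])
qed

lemma weak_solution_shift:
  assumes u: "weak_solution \<Omega> f h u" and s: "s \<ge> 0"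
  shows "weak_solution \<Omega> f h (\<lambda>t. u (t + s))"
  unfolding weak_solution_def
proof (intro conjI allI impI ballI)
  fix T :: real assume T: "T > 0"
  have sub: "{0 + s<..<T + s} \<subseteq> {0<..<T + s}" using s by auto
  have "u \<in> bochner_Lp 2 {0<..<T + s} (H10 \<Omega>) (H10_norm \<Omega>)" "u \<in> bochner_Lp 4 {0<..<T + s} (L4 \<Omega>) (L4_norm \<Omega>)"
    using u T s by (auto simp: weak_solution_def)
  then show "(\<lambda>t. u (t + s)) \<in> bochner_Lp 2 {0<..<T} (H10 \<Omega>) (H10_norm \<Omega>)"
    "(\<lambda>t. u (t + s)) \<in> bochner_Lp 4 {0<..<T} (L4 \<Omega>) (L4_norm \<Omega>)"
    by (auto intro!: bochner_Lp_shift elim!: bochner_Lp_subset[OF _ sub])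
next
  fix T :: real and v \<eta> assume T: "T > 0" and v: "v \<in> H10 \<Omega>" and \<eta>: "\<eta> \<in> test_functions {0<..<T}"
  let ?I = "{0 + s<..<T + s}" and ?\<zeta> = "\<lambda>t. \<eta> (t - s)"
  define k where "k t = H10_inner \<Omega> (u t) v + (LINT x|lebesgue_on \<Omega>. f (rep_l2 (u t) x) * rep_l2 v x) - h \<bullet> v" for t
  have sub: "?I \<subseteq> {0<..<T + s}" using s by auto
  note \<zeta> = test_function_shift(1)[OF \<eta>, of s]
  have "?\<zeta> \<in> test_functions {0<..<T + s}" using \<zeta> test_functions_mono[OF sub] by blast
  then have "- (LINT t|lebesgue_on {0<..<T + s}. (u t \<bullet> v) * deriv ?\<zeta> t) + (LINT t|lebesgue_on {0<..<T + s}. k t * ?\<zeta> t) = 0"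
    using u T s v unfolding weak_solution_def k_def by (meson add_pos_nonneg)
  then have "- (LINT t|lebesgue. (u t \<bullet> v) * deriv ?\<zeta> t) + (LINT t|lebesgue. k t * ?\<zeta> t) = 0"
    using integral_times_test_eq[OF \<zeta> sub] integral_times_test_eq[OF test_function_deriv[OF \<zeta>] sub] by simp
  then have "- (LINT t|lebesgue_on {0<..<T}. (u (t + s) \<bullet> v) * deriv \<eta> t) + (LINT t|lebesgue_on {0<..<T}. k (t + s) * \<eta> t) = 0"
    using integral_lebesgue_shift[of "\<lambda>t. (u t \<bullet> v) * deriv \<eta> (t - s)" s]
      integral_lebesgue_shift[of "\<lambda>t. k t * \<eta> (t - s)" s]
    by (simp add: integral_times_test_eq[OF \<eta> order_refl] integral_times_test_eq[OF test_function_deriv[OF \<eta>] order_refl]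
        test_function_shift(2)[OF \<eta>])
  then show "- (LINT t|lebesgue_on {0<..<T}. (u (t + s) \<bullet> v) * deriv \<eta> t) +
      (LINT t|lebesgue_on {0<..<T}. (H10_inner \<Omega> (u (t + s)) v
         + (LINT x|lebesgue_on \<Omega>. f (rep_l2 (u (t + s)) x) * rep_l2 v x) - h \<bullet> v) * \<eta> t) = 0"
    unfolding k_def .
qed

lemma K_s_subset_K_r: "K_s \<Omega> f h \<subseteq> K_r \<Omega> f h"
proof
  fix u assume u: "u \<in> K_s \<Omega> f h"
  have "u \<in> bochner_Linf {\<epsilon><..<T} (H10 \<Omega>) (H10_norm \<Omega>) \<and>
      (\<exists>w\<in>bochner_Lp 2 {\<epsilon><..<T} (L2 \<Omega>) norm. weak_time_deriv {\<epsilon><..<T} \<Omega> u w)" if \<epsilon>: "0 < \<epsilon>" "\<epsilon> < T" for \<epsilon> T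
  proof -
    have sub: "{\<epsilon><..<T} \<subseteq> {0<..<T}" using \<epsilon> by auto
    have T: "T > 0" using \<epsilon> by simp
    obtain w where "u \<in> bochner_Linf {0<..<T} (H10 \<Omega>) (H10_norm \<Omega>)"
       "w \<in> bochner_Lp 2 {0<..<T} (L2 \<Omega>) norm" "weak_time_deriv {0<..<T} \<Omega> u w"
      using u T unfolding K_s_def strong_solution_def by blast
    then show ?thesis
      using bochner_Linf_subset[OF _ sub] bochner_Lp_subset[OF _ sub] weak_time_deriv_subset[OF _ sub]
      by (metis borel_open lmeasurable_open sets_completionI_sets sets_lborel open_greaterThanLessThan)
  qed
  then show "u \<in> K_r \<Omega> f h"
    using u by (auto simp: K_s_def K_r_def strong_solution_def regular_solution_def)
qed

text \<open>
  The bounds of a regular solution can fail only near time zero, and the shift removes this part.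
\<close>

lemma K_r_shift_in_K_s:
  assumes u: "u \<in> K_r \<Omega> f h" and s: "s > 0"
  shows "(\<lambda>t. u (t + s)) \<in> K_s \<Omega> f h"
proof -
  have reg: "regular_solution \<Omega> f h u" and c: "continuous_on {0..} u" and L: "u ` {0..} \<subseteq> L2 \<Omega>"
    using u by (auto simp: K_r_def)
  have "(\<lambda>t. u (t + s)) \<in> bochner_Linf {0<..<T} (H10 \<Omega>) (H10_norm \<Omega>) \<and>
      (\<exists>w\<in>bochner_Lp 2 {0<..<T} (L2 \<Omega>) norm. weak_time_deriv {0<..<T} \<Omega> (\<lambda>t. u (t + s)) w)" if T: "0 < T" for T
  proof -
    obtain w where w: "u \<in> bochner_Linf {0 + s<..<T + s} (H10 \<Omega>) (H10_norm \<Omega>)"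
       "w \<in> bochner_Lp 2 {0 + s<..<T + s} (L2 \<Omega>) norm" "weak_time_deriv {0 + s<..<T + s} \<Omega> u w"
      using reg s T unfolding regular_solution_def by (metis add_0 add_less_cancel_right)
    show ?thesis
      using bochner_Linf_shift[OF w(1)] bochner_Lp_shift[OF w(2)] weak_time_deriv_shift[OF w(3)] by blast
  qed
  moreover have "weak_solution \<Omega> f h (\<lambda>t. u (t + s))"
    by (rule weak_solution_shift) (use reg s in \<open>simp_all add: regular_solution_def\<close>)
  moreover have "continuous_on {0..} (\<lambda>t. u (t + s))"
    by (rule continuous_on_compose2[OF c]) (use s in \<open>auto intro!: continuous_intros\<close>)
  moreover have "(\<lambda>t. u (t + s)) ` {0..} \<subseteq> L2 \<Omega>" using L s by auto
  ultimately show ?thesis by (auto simp: K_s_def strong_solution_def)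
qed

section \<open>Increments of weakly differentiable functions\<close>

lemma borel_measurable_lebesgue_on_AE_limit:
  fixes g :: "nat \<Rightarrow> real \<Rightarrow> real"
  assumes I: "I \<in> sets lebesgue" and g: "\<And>n. g n \<in> borel_measurable (lebesgue_on I)"
    and lim: "AE t in lebesgue_on I. (\<lambda>n. g n t) \<longlonglongrightarrow> G t"
  shows "G \<in> borel_measurable (lebesgue_on I)"
proof -
  have I': "I \<inter> space lebesgue \<in> sets lebesgue" using I by simp
  have "(\<lambda>t. lim (\<lambda>n. indicator I t * g n t)) \<in> borel_measurable lebesgue"
    using g by (intro borel_measurable_lim_metric) (simp add: borel_measurable_restrict_space_iff[OF I'])
  moreover have "AE t in lebesgue. lim (\<lambda>n. indicator I t * g n t) = indicator I t * G t"
    using lim I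
    by (auto simp: AE_restrict_space_iff indicator_def elim!: eventually_mono intro!: limI)
  ultimately have "(\<lambda>t. indicator I t * G t) \<in> borel_measurable lebesgue"
    by (rule borel_measurable_AE)
  then show ?thesis by (simp add: borel_measurable_restrict_space_iff[OF I'])
qed

text \<open>
  Sequential continuity of \<open>\<Phi>\<close> for \<open>N\<close> on \<open>X\<close> suffices, since \<open>\<Phi>\<close> composed with the approximating
  simple functions is simple.
\<close>

lemma strongly_measurable_imp_borel_measurable:
  fixes \<Phi> :: "'b::real_vector \<Rightarrow> real"
  assumes u: "strongly_measurable I X N u" and I: "I \<in> sets lebesgue"
    and cont: "\<And>y x. (\<And>n::nat. y n \<in> X) \<Longrightarrow> x \<in> X \<Longrightarrow> (\<lambda>n. N (y n - x)) \<longlonglongrightarrow> 0 \<Longrightarrow> (\<lambda>n. \<Phi> (y n)) \<longlonglongrightarrow> \<Phi> x"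
  shows "(\<lambda>t. \<Phi> (u t)) \<in> borel_measurable (lebesgue_on I)"
proof -
  obtain s where s: "\<And>n::nat. simple_function (lebesgue_on I) (s n) \<and> s n ` I \<subseteq> X"
    "AE t in lebesgue_on I. (\<lambda>n. N (s n t - u t)) \<longlonglongrightarrow> 0"
    using u unfolding strongly_measurable_def by blast
  have uX: "AE t in lebesgue_on I. u t \<in> X" using u by (simp add: strongly_measurable_def)
  have tI: "AE t in lebesgue_on I. t \<in> I" using I by (simp add: AE_restrict_space_iff)
  show ?thesis
  proof (rule borel_measurable_lebesgue_on_AE_limit[OF I])
    show "(\<lambda>t. \<Phi> (s n t)) \<in> borel_measurable (lebesgue_on I)" for n
      using s(1)[of n] by (intro borel_measurable_simple_function simple_function_compose1[of _ "s n" \<Phi>]) auto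
    show "AE t in lebesgue_on I. (\<lambda>n. \<Phi> (s n t)) \<longlonglongrightarrow> \<Phi> (u t)"
      using s(2) uX tI
    proof eventually_elim
      case (elim t)
      show ?case by (rule cont) (use s(1) elim in auto)
    qed
  qed
qed

lemma strongly_measurable_norm_inner:
  fixes w :: "real \<Rightarrow> 'b::real_inner"
  assumes w: "strongly_measurable I X norm w" and I: "I \<in> sets lebesgue"
  shows "(\<lambda>t. w t \<bullet> v) \<in> borel_measurable (lebesgue_on I)" "(\<lambda>t. norm (w t)) \<in> borel_measurable (lebesgue_on I)"
  by (rule strongly_measurable_imp_borel_measurable[OF w I];
      auto simp: LIM_zero_iff tendsto_norm_zero_iff intro!: tendsto_intros)+

lemma integrable_norm_if_square:
  fixes w :: "real \<Rightarrow> 'b::real_inner"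
  assumes w: "w \<in> bochner_Lp 2 {a<..<b} X norm"
  shows "integrable (lebesgue_on {a<..<b}) (\<lambda>t. norm (w t))" "integrable (lebesgue_on {a<..<b}) (\<lambda>t. w t \<bullet> v)"
proof -
  let ?M = "lebesgue_on {a<..<b}"
  note m = strongly_measurable_norm_inner[of "{a<..<b}" X w]
  have sm: "strongly_measurable {a<..<b} X norm w" using w by (simp add: bochner_Lp_def)
  have "integrable ?M (\<lambda>t. (norm (w t))\<^sup>2)"
    using w m(2)[OF sm] by (intro integrableI_nonneg) (auto simp: bochner_Lp_def)
  moreover have "integrable ?M (\<lambda>_. 1::real)"
    by (intro finite_measure.integrable_const finite_measure_lebesgue_on) simp
  ultimately have i: "integrable ?M (\<lambda>t. 1 + (norm (w t))\<^sup>2)" by simp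
  have le: "norm (norm (w t)) \<le> norm (1 + (norm (w t))\<^sup>2)" for t
    using abs_le_one_plus_square[of "norm (w t)"] by simp
  show n: "integrable ?M (\<lambda>t. norm (w t))"
    by (rule Bochner_Integration.integrable_bound[OF i m(2)[OF sm]]) (simp, rule AE_I2, rule le)
  have cs: "norm (w t \<bullet> v) \<le> norm (norm v * norm (w t))" for t
    using Cauchy_Schwarz_ineq2[of "w t" v] by (simp add: mult.commute)
  show "integrable ?M (\<lambda>t. w t \<bullet> v)"
    by (rule Bochner_Integration.integrable_bound[OF integrable_mult_right[OF n, of "norm v"] m(1)[OF sm]])
      (simp, rule AE_I2, rule cs)
qed

text \<open>
  The step \<open>\<theta>\<close> is the normalised primitive of a bump function \<open>b\<close> on \<open>[0,1]\<close>. Differences of two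
  rescaled steps are test functions approximating the indicator of an interval.
\<close>

lemma smooth_step:
  obtains \<theta> b :: "real \<Rightarrow> real" where "\<And>k. C_k k \<theta>" "\<And>x. (\<theta> has_real_derivative b x) (at x)"
    "\<And>x. x \<le> 0 \<Longrightarrow> \<theta> x = 0" "\<And>x. x \<ge> 1 \<Longrightarrow> \<theta> x = 1" "\<And>x. 0 \<le> \<theta> x" "\<And>x. \<theta> x \<le> 1"
    "b \<in> test_functions {-1<..<2}" "\<And>x. b x \<noteq> 0 \<Longrightarrow> x \<in> {0..1}" "(LINT x|lebesgue. b x) = 1"
proof -
  define b0 :: "real \<Rightarrow> real" where "b0 = box_bump 0 1 1"
  have b0t: "b0 \<in> test_functions {-1<..<2}"
    unfolding b0_def by (rule box_bump_test_function) auto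
  have b00: "x \<in> {0<..<1}" if "b0 x \<noteq> 0" for x
    using box_bump_nonzero[of "0::real" 1 1 x] that by (simp add: b0_def)
  have b0pos: "b0 x > 0" if "x \<in> {0<..<1}" for x
    using that by (simp add: b0_def box_bump_def flat_exp_def)
  have b0nn: "b0 x \<ge> 0" for x by (simp add: b0_def box_bump_bounds)
  have cont: "continuous_on S b0" for S
    using test_function_props(6)[OF b0t] continuous_on_subset by blast
  \<comment> \<open>The lower limit \<open>-1\<close> lies strictly left of the support, so that \<open>0\<close> is an interior point.\<close>
  define \<theta>0 where "\<theta>0 x = integral {-1..x} b0" for x
  have \<theta>0_neg: "\<theta>0 x = 0" if "x \<le> 0" for x
  proof -
    have "integral {-1..x} b0 = integral {-1..x} (\<lambda>_. 0)"
      using b00 that by (intro integral_cong) force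
    then show ?thesis by (simp add: \<theta>0_def)
  qed
  have D0: "(\<theta>0 has_real_derivative b0 x) (at x)" for x
  proof (cases "x < 0")
    case True
    have "((\<lambda>_. 0) has_real_derivative 0) (at x)" by simp
    moreover have "eventually (\<lambda>y. 0 = \<theta>0 y) (nhds x)"
      using eventually_nhds_in_open[of "{..<0}" x] True by (auto elim!: eventually_mono simp: \<theta>0_neg)
    ultimately have "(\<theta>0 has_real_derivative 0) (at x)"
      using DERIV_cong_ev[of x x "\<lambda>_. 0" \<theta>0 0 0, OF refl] by simp
    moreover have "b0 x = 0" using b00[of x] True by force
    ultimately show ?thesis by simp
  next
    case False
    have "(\<theta>0 has_real_derivative b0 x) (at x within {-1..x+1})"
      unfolding \<theta>0_def by (rule integral_has_real_derivative[OF cont]) (use False in auto)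
    then show ?thesis using False at_within_interior[of x "{-1..x+1}"] by simp
  qed
  define Z where "Z = \<theta>0 1"
  have "Z > 0"
  proof -
    obtain z where "0 < z" "z < 1" "\<theta>0 1 - \<theta>0 0 = (1 - 0) * b0 z"
      using MVT2[of 0 1 \<theta>0 b0] D0 by auto
    then show ?thesis using b0pos[of z] \<theta>0_neg[of 0] by (simp add: Z_def)
  qed
  have \<theta>0_one: "\<theta>0 x = Z" if "x \<ge> 1" for x
  proof (cases "x = 1")
    case False
    then have "1 < x" using that by simp
    then obtain z where z: "1 < z" "\<theta>0 x - \<theta>0 1 = (x - 1) * b0 z"
      using MVT2[of 1 x \<theta>0 b0] D0 by blast
    moreover have "b0 z = 0" using b00[of z] z(1) by force
    ultimately show ?thesis by (simp add: Z_def)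
  qed (simp add: Z_def)
  have mono: "\<theta>0 x \<le> \<theta>0 y" if "x \<le> y" for x y
    using DERIV_nonneg_imp_nondecreasing[OF that, of \<theta>0] D0 b0nn by blast
  define \<theta> where "\<theta> x = \<theta>0 x / Z" for x
  define b where "b x = b0 x * inverse Z" for x
  have bt: "b \<in> test_functions {-1<..<2}"
    using test_function_mult[OF b0t C_k_const, of "inverse Z"] by (simp add: b_def[abs_def] mult.commute)
  have D: "(\<theta> has_real_derivative b x) (at x)" for x
    using DERIV_cdivide[OF D0[of x], of Z] by (simp add: \<theta>_def[abs_def] b_def divide_inverse)
  have "C_k (Suc k) \<theta>" for k
  proof (rule C_k_SucI)
    show "(\<theta> has_derivative (\<lambda>h. b x * h)) (at x)" for x
      using D by (simp add: has_field_derivative_def)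
    show "C_k k (\<lambda>x. b x * h)" for h
      by (intro C_k_mult C_k_const test_function_props(1)[OF bt])
  qed
  then have C: "C_k k \<theta>" for k by (rule C_k_Suc_imp)
  have "(b has_integral (\<theta> 1 - \<theta> 0)) {0..1}"
    using D by (intro fundamental_theorem_of_calculus) (auto simp: has_real_derivative_iff_has_vector_derivative[symmetric] intro: DERIV_subset)
  then have "(b has_integral 1) {0..1}" using \<open>Z > 0\<close> by (simp add: \<theta>_def \<theta>0_neg Z_def)
  have supp: "x \<in> {0..1}" if "b x \<noteq> 0" for x using b00[of x] that by (auto simp: b_def)
  from \<open>(b has_integral 1) {0..1}\<close> have "(b has_integral 1) UNIV" by (rule has_integral_on_superset) (use supp in auto)
  then have int: "(LINT x|lebesgue. b x) = 1"
    using has_integral_integral_lebesgue[OF test_function_integrable(2)[OF bt]] has_integral_unique by blast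
  show ?thesis
  proof (rule that[OF C D _ _ _ _ bt supp int])
    show "\<theta> x = 0" if "x \<le> 0" for x using that by (simp add: \<theta>_def \<theta>0_neg)
    show "\<theta> x = 1" if "x \<ge> 1" for x using that \<open>Z > 0\<close> by (simp add: \<theta>_def \<theta>0_one)
    show "0 \<le> \<theta> x" for x
      using mono[of "min x 0" x] \<theta>0_neg[of "min x 0"] \<open>Z > 0\<close> by (simp add: \<theta>_def)
    show "\<theta> x \<le> 1" for x
      using mono[of x "max x 1"] \<theta>0_one[of "max x 1"] \<open>Z > 0\<close> by (simp add: \<theta>_def)
  qed
qed

text \<open>
  After the substitution \<open>x = s + y / n\<close> the integrand becomes \<open>U(s + y / n) b(y)\<close>, which is dominated
  because \<open>U\<close> is bounded on a compact interval to the right of \<open>s\<close>.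
\<close>

lemma approximate_identity_tendsto:
  fixes b U :: "real \<Rightarrow> real"
  assumes b: "b \<in> test_functions {-1<..<2}" and supp: "\<And>x. b x \<noteq> 0 \<Longrightarrow> x \<in> {0..1}" and int: "(LINT x|lebesgue. b x) = 1"
    and U: "continuous_on {a<..<c} U" and s: "a < s" "s < c"
  shows "(\<lambda>n. LINT x|lebesgue. indicator {a<..<c} x * U x * (real n * b (real n * (x - s)))) \<longlonglongrightarrow> U s"
proof -
  let ?V = "\<lambda>x. indicator {a<..<c} x * U x"
  have Vm: "?V \<in> borel_measurable borel"
    using borel_measurable_continuous_on_indicator[OF _ U] by simp
  have bm [measurable]: "b \<in> borel_measurable borel" by (rule test_function_borel[OF b])
  define d where "d = (c - s) / 2"
  have d: "d > 0" "{s..s+d} \<subseteq> {a<..<c}" using s by (auto simp: d_def field_simps)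
  have "bounded (U ` {s..s+d})"
    by (intro compact_imp_bounded compact_continuous_image continuous_on_subset[OF U d(2)]) simp
  then obtain M where M: "\<And>x. x \<in> {s..s+d} \<Longrightarrow> \<bar>U x\<bar> \<le> M" unfolding bounded_iff by force
  obtain n0 :: nat where n0: "real n0 > 1 / d" using reals_Archimedean2 by blast
  then have n0pos: "n0 > 0" using d(1) by (cases n0) auto
  have near: "s + 1 / real n * x \<in> {s..s+d}" if "n \<ge> n0" "x \<in> {0..1}" for n x
  proof -
    have "real n > 1 / d" using that(1) n0 by linarith
    then have "1 / real n \<le> d" using d(1) n0pos that(1) by (simp add: field_simps)
    moreover have "1 / real n * x \<le> 1 / real n * 1" using that(2) by (intro mult_left_mono) auto
    ultimately show ?thesis using that by auto
  qed
  have subst: "(LINT x|lebesgue. ?V x * (real n * b (real n * (x - s)))) = (LINT x|lebesgue. ?V (s + 1 / real n * x) * b x)"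
    if "n \<ge> n0" for n
  proof -
    have "n > 0" using that n0pos by simp
    then show ?thesis
      by (subst lebesgue_integral_real_affine[of "1 / real n" _ s]) (simp_all flip: integral_mult_right_zero add: field_simps)
  qed
  have "(\<lambda>n. LINT x|lebesgue. ?V (s + 1 / real (n + n0) * x) * b x) \<longlonglongrightarrow> (LINT x|lebesgue. U s * b x)"
  proof (rule integral_dominated_convergence)
    show "integrable lebesgue (\<lambda>x. M * \<bar>b x\<bar>)"
      using test_function_integrable(2)[OF b] by simp
    show "(\<lambda>x. U s * b x) \<in> borel_measurable lebesgue"
      using test_function_integrable(2)[OF b] by simp
    show "(\<lambda>x. ?V (s + 1 / real (n + n0) * x) * b x) \<in> borel_measurable lebesgue" for n
    proof (rule measurable_completion)
      have "(\<lambda>x. ?V (s + 1 / real (n + n0) * x)) \<in> borel_measurable borel"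
        by (rule measurable_compose[OF _ Vm]) simp
      then show "(\<lambda>x. ?V (s + 1 / real (n + n0) * x) * b x) \<in> borel_measurable lborel" by simp
    qed
    show "AE x in lebesgue. norm (?V (s + 1 / real (n + n0) * x) * b x) \<le> M * \<bar>b x\<bar>" for n
    proof (rule AE_I2)
      fix x
      show "norm (?V (s + 1 / real (n + n0) * x) * b x) \<le> M * \<bar>b x\<bar>"
      proof (cases "b x = 0")
        case False
        then have *: "s + 1 / real (n + n0) * x \<in> {s..s+d}" using near[of "n + n0" x] supp[of x] by simp
        then have "\<bar>?V (s + 1 / real (n + n0) * x)\<bar> \<le> M" using M[OF *] d(2) by (auto simp: indicator_def)
        then have "\<bar>?V (s + 1 / real (n + n0) * x)\<bar> * \<bar>b x\<bar> \<le> M * \<bar>b x\<bar>" by (rule mult_right_mono) simp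
        then show ?thesis by (simp add: abs_mult)
      qed simp
    qed
    show "AE x in lebesgue. (\<lambda>n. ?V (s + 1 / real (n + n0) * x) * b x) \<longlonglongrightarrow> U s * b x"
    proof (rule AE_I2)
      fix x
      have lim: "(\<lambda>n. s + 1 / real (n + n0) * x) \<longlonglongrightarrow> s + 0 * x"
        by (intro tendsto_intros LIMSEQ_ignore_initial_segment[OF lim_1_over_n, of n0])
      have "isCont ?V s"
      proof -
        have "isCont U s" using U s by (simp add: continuous_on_eq_continuous_at)
        moreover have "eventually (\<lambda>x. U x = ?V x) (nhds s)"
          using eventually_nhds_in_open[of "{a<..<c}" s] s by (auto elim!: eventually_mono)
        ultimately show ?thesis using isCont_cong[of U ?V s] by blast
      qed
      from isCont_tendsto_compose[OF this, of "\<lambda>n. s + 1 / real (n + n0) * x" sequentially] lim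
      have "(\<lambda>n. ?V (s + 1 / real (n + n0) * x)) \<longlonglongrightarrow> ?V s" by simp
      then show "(\<lambda>n. ?V (s + 1 / real (n + n0) * x) * b x) \<longlonglongrightarrow> U s * b x"
        using s by (intro tendsto_mult tendsto_const) simp
    qed
  qed
  then have "(\<lambda>n. LINT x|lebesgue. ?V x * (real (n + n0) * b (real (n + n0) * (x - s)))) \<longlonglongrightarrow> U s"
    using int subst[of "_ + n0"] by simp
  then show ?thesis by (rule LIMSEQ_offset)
qed

lemma integrable_continuous_times_test:
  fixes U :: "real \<Rightarrow> real"
  assumes U: "continuous_on I U" and \<eta>: "\<eta> \<in> test_functions I"
  shows "integrable lebesgue (\<lambda>x. indicator I x * U x * \<eta> x)"
proof -
  let ?K = "closure {x. \<eta> x \<noteq> 0}"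
  have "integrable lborel (\<lambda>x. indicator ?K x *\<^sub>R (U x * \<eta> x))"
    by (intro borel_integrable_compact test_function_props(2)[OF \<eta>] continuous_on_mult
        continuous_on_subset[OF U test_function_props(3)[OF \<eta>]] continuous_on_subset[OF test_function_props(6)[OF \<eta>] subset_UNIV])
  then have "integrable lebesgue (\<lambda>x. indicator ?K x *\<^sub>R (U x * \<eta> x))"
    using integrable_completion[of "\<lambda>x. indicator ?K x *\<^sub>R (U x * \<eta> x)" lborel] by (simp add: borel_measurable_integrable)
  also have "(\<lambda>x. indicator ?K x *\<^sub>R (U x * \<eta> x)) = (\<lambda>x. indicator I x * U x * \<eta> x)"
    using test_function_props(3,5)[OF \<eta>] by (auto simp: fun_eq_iff indicator_def)
  finally show ?thesis .
qed

text \<open>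
  The test functions \<open>\<theta>(n(x - s)) - \<theta>(n(x - t))\<close> tend to the indicator of \<open>{s<..t}\<close>, while their
  derivatives tend to the difference of the point masses at \<open>s\<close> and \<open>t\<close>.
\<close>

lemma weak_derivative_imp_increment:
  fixes U W :: "real \<Rightarrow> real"
  assumes U: "continuous_on {a<..<c} U" and W: "integrable (lebesgue_on {a<..<c}) W"
    and weak: "\<And>\<eta>. \<eta> \<in> test_functions {a<..<c} \<Longrightarrow>
      (LINT t|lebesgue_on {a<..<c}. U t * deriv \<eta> t) = - (LINT t|lebesgue_on {a<..<c}. W t * \<eta> t)"
    and st: "a < s" "s \<le> t" "t < c"
  shows "U t - U s = (LINT x|lebesgue_on {s<..t}. W x)"
proof -
  obtain \<theta> b :: "real \<Rightarrow> real" where \<theta>: "\<And>k. C_k k \<theta>" "\<And>x. (\<theta> has_real_derivative b x) (at x)"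
    "\<And>x. x \<le> 0 \<Longrightarrow> \<theta> x = 0" "\<And>x. x \<ge> 1 \<Longrightarrow> \<theta> x = 1" "\<And>x. 0 \<le> \<theta> x" "\<And>x. \<theta> x \<le> 1"
    and b: "b \<in> test_functions {-1<..<2}" "\<And>x. b x \<noteq> 0 \<Longrightarrow> x \<in> {0..1}" "(LINT x|lebesgue. b x) = 1"
    using smooth_step by blast
  let ?I = "{a<..<c}"
  define \<beta> where "\<beta> r n x = real n * b (real n * (x - r))" for r n x
  define \<eta> where "\<eta> n x = \<theta> (real n * (x - s)) - \<theta> (real n * (x - t))" for n x
  have D\<eta>: "(\<eta> n has_real_derivative \<beta> s n x - \<beta> t n x) (at x)" for n x
    unfolding \<eta>_def[abs_def] \<beta>_def
    by (auto intro!: derivative_eq_intros DERIV_chain2[OF \<theta>(2)])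
  have aff: "C_k k (\<lambda>x. \<phi> (real n * (x - r)))" if "\<And>k. C_k k \<phi>" for \<phi> :: "real \<Rightarrow> real" and k n r
    using C_k_affine[OF that, of k "real n" "- real n * r"] by (simp add: algebra_simps)
  obtain n0 :: nat where n0: "real n0 > 1 / (c - t)" using reals_Archimedean2 by blast
  have large: "n > 0" "t + 1 / real n < c" if "n \<ge> n0" for n
  proof -
    have n: "real n > 1 / (c - t)" using n0 that by linarith
    then show "n > 0" using st(3) by (cases n) auto
    with n st(3) show "t + 1 / real n < c" by (simp add: field_simps)
  qed
  have \<beta>_test: "\<beta> r n \<in> test_functions ?I" if n: "n \<ge> n0" and r: "r \<in> {s, t}" for r n
  proof (rule test_functionsI)
    show "C_k k (\<beta> r n)" for k
      unfolding \<beta>_def[abs_def] by (intro C_k_mult C_k_const aff test_function_props(1)[OF b(1)])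
    show "{r..r + 1 / real n} \<subseteq> ?I" using large[OF n] r st by auto
    show "x \<in> {r..r + 1 / real n}" if "\<beta> r n x \<noteq> 0" for x
      using b(2)[of "real n * (x - r)"] that large(1)[OF n] by (auto simp: \<beta>_def field_simps zero_le_mult_iff)
  qed simp
  have \<eta>_test: "\<eta> n \<in> test_functions ?I" if n: "n \<ge> n0" for n
  proof (rule test_functionsI)
    show "C_k k (\<eta> n)" for k
      unfolding \<eta>_def[abs_def]
      using C_k_add[OF aff[OF \<theta>(1)] C_k_mult[OF C_k_const[of k "-1"] aff[OF \<theta>(1)]]] by simp
    show "{s..t + 1 / real n} \<subseteq> ?I" using large[OF n] st by auto
    fix x assume nz: "\<eta> n x \<noteq> 0"
    show "x \<in> {s..t + 1 / real n}"
    proof (rule ccontr)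
      assume "x \<notin> {s..t + 1 / real n}"
      then consider "x < s" | "x > t + 1 / real n" by force
      then show False
      proof cases
        case 1
        then have "real n * (x - s) \<le> 0" "real n * (x - t) \<le> 0" using st by (auto intro!: mult_nonneg_nonpos)
        then show False using nz \<theta>(3) by (simp add: \<eta>_def)
      next
        case 2
        then have *: "real n * (x - t) \<ge> 1" using large(1)[OF n] by (simp add: field_simps)
        moreover have "real n * (x - t) \<le> real n * (x - s)" using st by (intro mult_left_mono) auto
        ultimately show False using nz \<theta>(4)[of "real n * (x - t)"] \<theta>(4)[of "real n * (x - s)"] by (simp add: \<eta>_def)
      qed
    qed
  qed simp
  let ?B = "\<lambda>r n. LINT x|lebesgue. indicator ?I x * U x * \<beta> r n x"
  have lhs: "(LINT x|lebesgue_on ?I. U x * deriv (\<eta> n) x) = ?B s n - ?B t n" if n: "n \<ge> n0" for n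
  proof -
    have "(LINT x|lebesgue_on ?I. U x * deriv (\<eta> n) x) = (LINT x|lebesgue. indicator ?I x * U x * \<beta> s n x - indicator ?I x * U x * \<beta> t n x)"
      unfolding DERIV_imp_deriv[OF D\<eta>] by (simp add: integral_restrict_space algebra_simps)
    also have "\<dots> = ?B s n - ?B t n"
      by (intro Bochner_Integration.integral_diff integrable_continuous_times_test[OF U] \<beta>_test n) auto
    finally show ?thesis .
  qed
  have "(\<lambda>n. ?B s n - ?B t n) \<longlonglongrightarrow> U s - U t"
    unfolding \<beta>_def by (intro tendsto_diff approximate_identity_tendsto[OF b U]) (use st in auto)
  then have lim': "(\<lambda>n. ?B s n - ?B t n) \<longlonglongrightarrow> U s - U t" .
  have "(\<lambda>n. LINT x|lebesgue_on ?I. W x * \<eta> n x) \<longlonglongrightarrow> (LINT x|lebesgue_on ?I. W x * indicator {s<..t} x)"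
  proof (rule integral_dominated_convergence)
    show "integrable (lebesgue_on ?I) (\<lambda>x. \<bar>W x\<bar>)" using W by simp
    have "\<eta> n \<in> borel_measurable borel" for n
      by (intro borel_measurable_continuous_onI continuous_at_imp_continuous_on ballI DERIV_isCont[OF D\<eta>])
    then have "\<eta> n \<in> borel_measurable (lebesgue_on ?I)" for n
      by (intro measurable_restrict_space1 measurable_completion) simp
    then show "(\<lambda>x. W x * \<eta> n x) \<in> borel_measurable (lebesgue_on ?I)" for n
      by (rule borel_measurable_times[OF borel_measurable_integrable[OF W]])
    have "indicator {s<..t} \<in> borel_measurable (lebesgue_on ?I)"
      by (intro measurable_restrict_space1 borel_measurable_indicator) simp
    then show "(\<lambda>x. W x * indicator {s<..t} x) \<in> borel_measurable (lebesgue_on ?I)"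
      by (rule borel_measurable_times[OF borel_measurable_integrable[OF W]])
    show "AE x in lebesgue_on ?I. norm (W x * \<eta> n x) \<le> \<bar>W x\<bar>" for n
    proof (rule AE_I2)
      fix x
      have "\<bar>\<eta> n x\<bar> \<le> 1"
        using \<theta>(5,6)[of "real n * (x - s)"] \<theta>(5,6)[of "real n * (x - t)"] by (simp add: \<eta>_def)
      then show "norm (W x * \<eta> n x) \<le> \<bar>W x\<bar>" by (simp add: abs_mult mult_left_le)
    qed
    show "AE x in lebesgue_on ?I. (\<lambda>n. W x * \<eta> n x) \<longlonglongrightarrow> W x * indicator {s<..t} x"
    proof (intro AE_I2 tendsto_mult tendsto_const)
      fix x
      have step: "(\<lambda>n. \<theta> (real n * (x - r))) \<longlonglongrightarrow> (if x > r then 1 else 0)" for r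
      proof (cases "x > r")
        case True
        obtain m :: nat where m: "real m > 1 / (x - r)" using reals_Archimedean2 by blast
        have "\<theta> (real n * (x - r)) = 1" if "n \<ge> m" for n
        proof -
          have "real n > 1 / (x - r)" using m that by linarith
          then show ?thesis using True by (intro \<theta>(4)) (simp add: field_simps)
        qed
        then have "eventually (\<lambda>n. \<theta> (real n * (x - r)) = 1) sequentially"
          by (rule eventually_sequentiallyI)
        then show ?thesis using True by (simp add: tendsto_eventually)
      next
        case False
        then have "\<theta> (real n * (x - r)) = 0" for n by (intro \<theta>(3)) (simp add: mult_nonneg_nonpos)
        then show ?thesis using False by simp
      qed
      have "(\<lambda>n. \<eta> n x) \<longlonglongrightarrow> (if x > s then 1 else 0) - (if x > t then 1 else 0)"
        unfolding \<eta>_def by (intro tendsto_diff step)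
      also have "(if x > s then 1 else 0) - (if x > t then 1 else 0) = (indicator {s<..t} x :: real)"
        using st by (auto simp: indicator_def)
      finally show "(\<lambda>n. \<eta> n x) \<longlonglongrightarrow> indicator {s<..t} x" .
    qed
  qed
  then have lim: "(\<lambda>n. - (LINT x|lebesgue_on ?I. W x * \<eta> n x)) \<longlonglongrightarrow> - (LINT x|lebesgue_on ?I. W x * indicator {s<..t} x)"
    by (rule tendsto_minus)
  have ev: "eventually (\<lambda>n. - (LINT x|lebesgue_on ?I. W x * \<eta> n x) = ?B s n - ?B t n) sequentially"
    using lhs weak[OF \<eta>_test] by (intro eventually_sequentiallyI[of n0]) simp
  have "U s - U t = - (LINT x|lebesgue_on ?I. W x * indicator {s<..t} x)"
    by (rule LIMSEQ_unique[OF lim' Lim_transform_eventually[OF lim ev]])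
  also have "(LINT x|lebesgue_on ?I. W x * indicator {s<..t} x) = (LINT x|lebesgue_on {s<..t}. W x)"
    using st by (simp add: integral_restrict_space) (intro Bochner_Integration.integral_cong, auto simp: indicator_def)
  finally show ?thesis by simp
qed

text \<open>
  This replaces \<open>(|u|\<^sup>2)' = 2 w \<bullet> u\<close>. On a short interval \<open>(p,q]\<close> the increment of \<open>|u|\<^sup>2\<close> is the
  integral of \<open>w \<bullet> (u(q) + u(p))\<close>, and \<open>u(q) + u(p)\<close> is within \<open>4 \<epsilon>\<close> of \<open>2 u(x)\<close> throughout. Both sides of
  the resulting inequality are additive in the interval, so the Bolzano principle extends it from
  short intervals to \<open>(s,t]\<close>.
\<close>

lemma norm_square_increment_le:
  fixes u w :: "real \<Rightarrow> 'b::real_inner"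
  assumes u: "continuous_on {a<..<c} u" and w: "w \<in> bochner_Lp 2 {a<..<c} X norm"
    and incr: "\<And>r s t. r \<in> {a<..<c} \<Longrightarrow> a < s \<Longrightarrow> s \<le> t \<Longrightarrow> t < c \<Longrightarrow>
      u t \<bullet> u r - u s \<bullet> u r = (LINT x|lebesgue_on {s<..t}. w x \<bullet> u r)"
    and le: "AE x in lebesgue_on {a<..<c}. w x \<bullet> u x \<le> \<kappa>"
    and st: "a < s" "s \<le> t" "t < c"
  shows "(norm (u t))\<^sup>2 - (norm (u s))\<^sup>2 \<le> 2 * \<kappa> * (t - s)"
proof -
  let ?N = "\<lambda>p q. LINT x|lebesgue_on {p<..q}. norm (w x)"
  have int: "integrable (lebesgue_on {p<..q}) (\<lambda>x. norm (w x))" "integrable (lebesgue_on {p<..q}) (\<lambda>x. w x \<bullet> v)"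
    if "a < p" "q < c" for p q v
  proof -
    have "w \<in> bochner_Lp 2 {a<..<c} X norm" by (rule w)
    have sub: "{p<..q} \<subseteq> {a<..<c}" using that by auto
    show "integrable (lebesgue_on {p<..q}) (\<lambda>x. norm (w x))" "integrable (lebesgue_on {p<..q}) (\<lambda>x. w x \<bullet> v)"
      by (rule integrable_lebesgue_on_subset[OF _ sub], rule integrable_norm_if_square[OF w], simp_all)+
  qed
  have add: "?N p q + ?N q r = ?N p r" if "a < p" "p \<le> q" "q \<le> r" "r < c" for p q r
  proof -
    have "?N p r = (LINT x|lebesgue. indicator {p<..q} x * norm (w x) + indicator {q<..r} x * norm (w x))"
      unfolding integral_restrict_space[of "{p<..r}" lebesgue, simplified]
      by (intro Bochner_Integration.integral_cong) (use that in \<open>auto simp: indicator_def\<close>)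
    also have "\<dots> = ?N p q + ?N q r"
      using int(1)[of p q] int(1)[of q r] that
      by (simp add: integral_restrict_space integrable_restrict_space)
    finally show ?thesis by simp
  qed
  have main: "(norm (u t))\<^sup>2 - (norm (u s))\<^sup>2 \<le> 2 * \<kappa> * (t - s) + 4 * \<epsilon> * ?N s t" if \<epsilon>: "\<epsilon> > 0" for \<epsilon>
  proof -
    define P where "P p q \<longleftrightarrow> (s \<le> p \<and> p \<le> q \<and> q \<le> t \<longrightarrow>
       (norm (u q))\<^sup>2 - (norm (u p))\<^sup>2 \<le> 2 * \<kappa> * (q - p) + 4 * \<epsilon> * ?N p q)" for p q
    have "P s t"
      using st(2)
    proof (induction rule: Bolzano)
      case (trans p q r)
      show ?case
        unfolding P_def
      proof
        assume *: "s \<le> p \<and> p \<le> r \<and> r \<le> t"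
        have "(norm (u q))\<^sup>2 - (norm (u p))\<^sup>2 \<le> 2 * \<kappa> * (q - p) + 4 * \<epsilon> * ?N p q"
          "(norm (u r))\<^sup>2 - (norm (u q))\<^sup>2 \<le> 2 * \<kappa> * (r - q) + 4 * \<epsilon> * ?N q r"
          using trans * by (auto simp: P_def)
        moreover have "4 * \<epsilon> * ?N p r = 4 * \<epsilon> * ?N p q + 4 * \<epsilon> * ?N q r"
          using add[of p q r] trans * st by (simp flip: distrib_left)
        moreover have "2 * \<kappa> * (r - p) = 2 * \<kappa> * (q - p) + 2 * \<kappa> * (r - q)" by (simp add: algebra_simps)
        ultimately show "(norm (u r))\<^sup>2 - (norm (u p))\<^sup>2 \<le> 2 * \<kappa> * (r - p) + 4 * \<epsilon> * ?N p r"
          by linarith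
      qed
    next
      case (local x)
      have "isCont u x"
        using u local st by (simp add: continuous_on_eq_continuous_at)
      then obtain d where d: "d > 0" "\<And>y. dist y x < d \<Longrightarrow> dist (u y) (u x) < \<epsilon>"
        using \<epsilon> unfolding continuous_at_eps_delta by blast
      have "P p q" if pq: "p \<le> x" "x \<le> q" "q - p < d" for p q
        unfolding P_def
      proof
        assume *: "s \<le> p \<and> p \<le> q \<and> q \<le> t"
        define v where "v = u q + u p"
        have pqI: "a < p" "q < c" "{p<..q} \<subseteq> {a<..<c}" using * st by auto
        have near: "norm (u y - u x) < \<epsilon>" if "y \<in> {p..q}" for y
          using d(2)[of y] that pq by (simp add: dist_norm abs_less_iff)
        have "(norm (u q))\<^sup>2 - (norm (u p))\<^sup>2 = (u q \<bullet> u q - u p \<bullet> u q) + (u q \<bullet> u p - u p \<bullet> u p)"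
          by (simp add: power2_norm_eq_inner inner_commute)
        also have "\<dots> = (LINT x|lebesgue_on {p<..q}. w x \<bullet> u q) + (LINT x|lebesgue_on {p<..q}. w x \<bullet> u p)"
          using incr[of q p q] incr[of p p q] * st by simp
        also have "\<dots> = (LINT x|lebesgue_on {p<..q}. w x \<bullet> v)"
          using int(2)[OF pqI(1,2)] by (simp add: v_def inner_add_right)
        also have "\<dots> \<le> (LINT x|lebesgue_on {p<..q}. 2 * \<kappa> + 4 * \<epsilon> * norm (w x))"
        proof (rule integral_mono_AE)
          show "integrable (lebesgue_on {p<..q}) (\<lambda>x. 2 * \<kappa> + 4 * \<epsilon> * norm (w x))"
            using int(1)[OF pqI(1,2)]
            by (intro Bochner_Integration.integrable_add integrable_mult_right finite_measure.integrable_const finite_measure_lebesgue_on bounded_set_imp_lmeasurable) auto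
          have "AE y in lebesgue_on {p<..q}. w y \<bullet> u y \<le> \<kappa>"
            using le by (rule AE_lebesgue_on_subset[OF pqI(3), rotated 2]) auto
          moreover have "AE y in lebesgue_on {p<..q}. y \<in> {p<..q}" by (simp add: AE_restrict_space_iff)
          ultimately show "AE y in lebesgue_on {p<..q}. w y \<bullet> v \<le> 2 * \<kappa> + 4 * \<epsilon> * norm (w y)"
          proof eventually_elim
            case (elim y)
            have "v - 2 *\<^sub>R u y = (u q - u x) + (u p - u x) - 2 *\<^sub>R (u y - u x)"
              by (simp add: v_def algebra_simps scaleR_2)
            also have "norm \<dots> \<le> norm (u q - u x) + norm (u p - u x) + norm (2 *\<^sub>R (u y - u x))"
              using norm_triangle_ineq4[of "(u q - u x) + (u p - u x)" "2 *\<^sub>R (u y - u x)"]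
                norm_triangle_ineq[of "u q - u x" "u p - u x"] by linarith
            also have "\<dots> \<le> 4 * \<epsilon>"
              using near[of q] near[of p] near[of y] elim pq by simp
            finally have n: "norm (v - 2 *\<^sub>R u y) \<le> 4 * \<epsilon>" .
            have "w y \<bullet> v = 2 * (w y \<bullet> u y) + w y \<bullet> (v - 2 *\<^sub>R u y)"
              by (simp add: inner_diff_right)
            also have "w y \<bullet> (v - 2 *\<^sub>R u y) \<le> norm (w y) * norm (v - 2 *\<^sub>R u y)" by (rule norm_cauchy_schwarz)
            also have "\<dots> \<le> norm (w y) * (4 * \<epsilon>)" by (rule mult_left_mono[OF n]) simp
            finally show ?case using elim by (simp add: mult.commute)
          qed
        qed (rule int(2)[OF pqI(1,2)])
        also have "\<dots> = 2 * \<kappa> * (q - p) + 4 * \<epsilon> * ?N p q"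
        proof -
          have "measure (lebesgue_on {p<..q}) (space (lebesgue_on {p<..q})) = q - p"
            using * by (simp add: measure_restrict_space)
          moreover have "integrable (lebesgue_on {p<..q}) (\<lambda>_. 2 * \<kappa>)"
            by (intro finite_measure.integrable_const finite_measure_lebesgue_on bounded_set_imp_lmeasurable) auto
          ultimately show ?thesis using int(1)[OF pqI(1,2)] by simp
        qed
        finally show "(norm (u q))\<^sup>2 - (norm (u p))\<^sup>2 \<le> 2 * \<kappa> * (q - p) + 4 * \<epsilon> * ?N p q" .
      qed
      then show ?case using d(1) by blast
    qed
    then show ?thesis using st by (simp add: P_def)
  qed
  show ?thesis
  proof (rule field_le_epsilon)
    fix e :: real assume e: "e > 0"
    define K where "K = ?N s t"
    have N: "K \<ge> 0" unfolding K_def by (intro Bochner_Integration.integral_nonneg) simp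
    define \<epsilon> where "\<epsilon> = e / (4 * (K + 1))"
    have "\<epsilon> > 0" using e N by (simp add: \<epsilon>_def)
    moreover have "4 * \<epsilon> * K \<le> e"
    proof -
      have "4 * \<epsilon> * K \<le> 4 * \<epsilon> * (K + 1)" using \<open>\<epsilon> > 0\<close> by (intro mult_left_mono) auto
      also have "\<dots> = e" using N unfolding \<epsilon>_def by (simp add: field_simps)
      finally show ?thesis .
    qed
    ultimately show "(norm (u t))\<^sup>2 - (norm (u s))\<^sup>2 \<le> 2 * \<kappa> * (t - s) + e"
      using main[of \<epsilon>] unfolding K_def by linarith
  qed
qed

section \<open>The nonlinear term\<close>

lemma fourth_power_diff_le: "(x - y) ^ 4 \<le> 8 * (x ^ 4 + y ^ 4)" for x y :: real
proof -
  have sq: "(a - b)\<^sup>2 \<le> 2 * (a\<^sup>2 + b\<^sup>2)" "(a + b)\<^sup>2 \<le> 2 * (a\<^sup>2 + b\<^sup>2)" for a b :: real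
    using sum_squares_bound[of a b] sum_squares_bound[of a "- b"] by (simp_all add: power2_sum power2_diff)
  have "(x - y) ^ 4 = ((x - y)\<^sup>2)\<^sup>2" by simp
  also have "\<dots> \<le> (2 * (x\<^sup>2 + y\<^sup>2))\<^sup>2" by (intro power_mono sq) simp
  also have "\<dots> = 4 * (x\<^sup>2 + y\<^sup>2)\<^sup>2" by (simp only: power_mult_distrib) simp
  also have "\<dots> \<le> 4 * (2 * ((x\<^sup>2)\<^sup>2 + (y\<^sup>2)\<^sup>2))" using sq(2)[of "x\<^sup>2" "y\<^sup>2"] by simp
  finally show ?thesis by simp
qed

text \<open>
  A weighted Young inequality: either \<open>|y| \<le> \<delta> |x|\<close> and the first term dominates, or the second does.
\<close>

lemma cube_times_le: "\<bar>x\<bar> ^ 3 * \<bar>y\<bar> \<le> \<delta> * x ^ 4 + y ^ 4 / \<delta> ^ 3" if "\<delta> > 0" for x y \<delta> :: real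
proof (cases "\<bar>y\<bar> \<le> \<delta> * \<bar>x\<bar>")
  case True
  then have "\<bar>x\<bar> ^ 3 * \<bar>y\<bar> \<le> \<bar>x\<bar> ^ 3 * (\<delta> * \<bar>x\<bar>)" by (intro mult_left_mono) auto
  also have "\<dots> = \<delta> * x ^ 4"
    using power_even_abs[of 4 x] by (simp add: power3_eq_cube power4_eq_xxxx)
  finally show ?thesis using that by (simp add: add_increasing2)
next
  case False
  then have "\<bar>x\<bar> \<le> \<bar>y\<bar> / \<delta>" using that by (simp add: field_simps)
  then have "\<bar>x\<bar> ^ 3 * \<bar>y\<bar> \<le> (\<bar>y\<bar> / \<delta>) ^ 3 * \<bar>y\<bar>" by (intro mult_right_mono power_mono) auto
  also have "\<dots> = y ^ 4 / \<delta> ^ 3"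
    using power_even_abs[of 4 y] by (simp add: power3_eq_cube power4_eq_xxxx)
  finally show ?thesis using that by (simp add: add_increasing)
qed

text \<open>
  On \<open>[-k,k]\<close> the function \<open>f\<close> is approximated by a polynomial, which is Lipschitz there; composing it
  with the projection of the line onto \<open>[-k,k]\<close> makes it globally Lipschitz and preserves the growth
  bound up to the additive constant \<open>1\<close>.
\<close>

lemma lipschitz_approximation:
  fixes f :: "real \<Rightarrow> real"
  assumes f: "continuous_on UNIV f" and C: "C \<ge> 0" "\<And>x. \<bar>f x\<bar> \<le> C * (1 + \<bar>x\<bar> ^ p)"
  obtains F L where "\<And>k x y. \<bar>F k x - F k y\<bar> \<le> L k * \<bar>x - y\<bar>" "\<And>k::nat. L k \<ge> 0"
    "\<And>k x. \<bar>F k x\<bar> \<le> 1 + C * (1 + \<bar>x\<bar> ^ p)" "\<And>x. (\<lambda>k. F k x) \<longlonglongrightarrow> f x"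
proof -
  define cl :: "nat \<Rightarrow> real \<Rightarrow> real" where "cl k x = max (- real k) (min (real k) x)" for k x
  have cl: "cl k x \<in> {- real k..real k}" "\<bar>cl k x - cl k y\<bar> \<le> \<bar>x - y\<bar>" "\<bar>cl k x\<bar> \<le> \<bar>x\<bar>" for k x y
    by (auto simp: cl_def)
  have "\<exists>g B. real_polynomial_function g \<and> (\<forall>x\<in>{- real k..real k}. \<bar>f x - g x\<bar> < inverse (real (Suc k)))
      \<and> B \<ge> 0 \<and> (\<forall>x\<in>{- real k..real k}. \<forall>y\<in>{- real k..real k}. \<bar>g x - g y\<bar> \<le> B * \<bar>x - y\<bar>)" for k :: nat
  proof -
    let ?S = "{- real k..real k}"
    obtain g where g: "real_polynomial_function g" "\<And>x. x \<in> ?S \<Longrightarrow> \<bar>f x - g x\<bar> < inverse (real (Suc k))"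
      using Stone_Weierstrass_real_polynomial_function[of ?S f "inverse (real (Suc k))"]
        continuous_on_subset[OF f subset_UNIV] by auto
    obtain g' where g': "real_polynomial_function g'" "\<And>x. (g has_real_derivative g' x) (at x)"
      using has_real_derivative_polynomial_function[OF g(1)] by blast
    have "continuous_on ?S g'"
      using g'(1) continuous_on_polymonial_function real_polynomial_function_eq by blast
    then have "bounded (g' ` ?S)"
      by (intro compact_imp_bounded compact_continuous_image) simp_all
    then obtain B where B: "\<And>x. x \<in> ?S \<Longrightarrow> norm (g' x) \<le> B"
      unfolding bounded_iff by blast
    have "norm (g x - g y) \<le> B * norm (x - y)" if "x \<in> ?S" "y \<in> ?S" for x y
      by (rule field_differentiable_bound[of ?S g g']) (use g'(2) B that in \<open>auto intro: DERIV_subset\<close>)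
    moreover have "B \<ge> 0" using B[of 0] by (auto intro: order_trans[OF norm_ge_zero])
    ultimately show ?thesis using g by (intro exI[of _ g] exI[of _ B]) auto
  qed
  then obtain g B where g: "\<And>k x. x \<in> {- real k..real k} \<Longrightarrow> \<bar>f x - g k x\<bar> < inverse (real (Suc k))"
      "\<And>k::nat. B k \<ge> 0"
      "\<And>k x y. x \<in> {- real k..real k} \<Longrightarrow> y \<in> {- real k..real k} \<Longrightarrow> \<bar>g k x - g k y\<bar> \<le> B k * \<bar>x - y\<bar>"
    by metis
  show ?thesis
  proof (rule that[of "\<lambda>k x. g k (cl k x)" B])
    show "\<bar>g k (cl k x) - g k (cl k y)\<bar> \<le> B k * \<bar>x - y\<bar>" for k x y
      using g(3)[OF cl(1) cl(1), of k x y] mult_left_mono[OF cl(2)[of k x y] g(2)[of k]] by linarith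
    show "B k \<ge> 0" for k by (rule g)
    show "\<bar>g k (cl k x)\<bar> \<le> 1 + C * (1 + \<bar>x\<bar> ^ p)" for k x
    proof -
      have "\<bar>f (cl k x)\<bar> \<le> C * (1 + \<bar>cl k x\<bar> ^ p)" by (rule C)
      also have "\<dots> \<le> C * (1 + \<bar>x\<bar> ^ p)" using C(1) cl(3) by (intro mult_left_mono add_left_mono power_mono) auto
      finally have "\<bar>f (cl k x)\<bar> \<le> C * (1 + \<bar>x\<bar> ^ p)" .
      moreover have "inverse (real (Suc k)) \<le> 1" by (simp add: field_simps)
      ultimately show ?thesis using g(1)[OF cl(1), of k x] by linarith
    qed
    show "(\<lambda>k. g k (cl k x)) \<longlonglongrightarrow> f x" for x
    proof (rule LIMSEQ_I)
      fix r :: real assume r: "r > 0"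
      obtain n1 where n1: "inverse (real (Suc n1)) < r" using reals_Archimedean[OF r] by blast
      obtain n2 :: nat where n2: "\<bar>x\<bar> \<le> real n2" using real_arch_simple by blast
      have "norm (g k (cl k x) - f x) < r" if k: "k \<ge> max n1 n2" for k
      proof -
        have "cl k x = x" using n2 k by (auto simp: cl_def)
        then have "\<bar>f x - g k (cl k x)\<bar> < inverse (real (Suc k))" using g(1)[OF cl(1), of k x] by simp
        also have "\<dots> \<le> inverse (real (Suc n1))" using k by (intro le_imp_inverse_le) auto
        finally show ?thesis using n1 by (simp add: abs_minus_commute)
      qed
      then show "\<exists>no. \<forall>n\<ge>no. norm (g n (cl n x) - f x) < r" by blast
    qed
  qed
qed

context bounded_open
begin

lemma integral_rep_product_le: "(LINT x|M\<Omega>. \<bar>rep_l2 u x\<bar> * \<bar>rep_l2 v x\<bar>) \<le> norm u * norm v"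
proof -
  have sq: "square_integrable (\<lambda>x. \<bar>rep_l2 y x\<bar>)" for y :: "'a l2"
    using square_integrable_rep[of y] by (auto simp: square_integrable_def)
  have n: "norm (abs_l2 (\<lambda>x. \<bar>rep_l2 y x\<bar>)) = norm y" for y :: "'a l2"
    unfolding norm_eq_sqrt_inner inner_abs_abs_l2[OF sq sq] inner_l2_eq[of y y] by simp
  have "(LINT x|M\<Omega>. \<bar>rep_l2 u x\<bar> * \<bar>rep_l2 v x\<bar>) \<le> (LINT x|lebesgue. \<bar>rep_l2 u x\<bar> * \<bar>rep_l2 v x\<bar>)"
    unfolding integral_restrict_space[OF domain_sets(2)]
  proof (rule integral_mono)
    show "integrable lebesgue (\<lambda>x. indicator \<Omega> x *\<^sub>R (\<bar>rep_l2 u x\<bar> * \<bar>rep_l2 v x\<bar>))"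
      by (intro integrable_mult_indicator domain_sets square_integrable_mult sq)
    show "integrable lebesgue (\<lambda>x. \<bar>rep_l2 u x\<bar> * \<bar>rep_l2 v x\<bar>)"
      by (intro square_integrable_mult sq)
  qed (auto simp: indicator_def)
  also have "\<dots> = abs_l2 (\<lambda>x. \<bar>rep_l2 u x\<bar>) \<bullet> abs_l2 (\<lambda>x. \<bar>rep_l2 v x\<bar>)"
    by (rule inner_abs_abs_l2[OF sq sq, symmetric])
  also have "\<dots> \<le> norm u * norm v"
    using norm_cauchy_schwarz[of "abs_l2 (\<lambda>x. \<bar>rep_l2 u x\<bar>)" "abs_l2 (\<lambda>x. \<bar>rep_l2 v x\<bar>)"] by (simp add: n)
  finally show ?thesis .
qed

lemma continuous_composition_measurable:
  fixes g :: "real \<Rightarrow> real"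
  assumes "continuous_on UNIV g"
  shows "(\<lambda>x. g (rep_l2 u x)) \<in> borel_measurable M\<Omega>"
  by (rule measurable_compose[OF rep_measurable_domain borel_measurable_continuous_onI[OF assms]])

lemma lipschitz_composition_continuous:
  fixes F :: "real \<Rightarrow> real"
  assumes F: "\<And>x y. \<bar>F x - F y\<bar> \<le> L * \<bar>x - y\<bar>" and L: "L \<ge> 0"
    and u: "continuous_on I (u :: real \<Rightarrow> 'a l2)"
  shows "continuous_on I (\<lambda>t. LINT x|M\<Omega>. F (rep_l2 (u t) x) * rep_l2 v x)"
proof -
  have Fc: "continuous_on UNIV F"
    by (rule lipschitz_on_continuous_on[where L=L])
      (use F L in \<open>auto simp: lipschitz_on_def dist_real_def\<close>)
  have int: "integrable M\<Omega> (\<lambda>x. F (rep_l2 y x) * rep_l2 v x)" for y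
  proof (rule Bochner_Integration.integrable_bound)
    show "integrable M\<Omega> (\<lambda>x. \<bar>F 0\<bar> * \<bar>rep_l2 v x\<bar> + L * (\<bar>rep_l2 y x\<bar> * \<bar>rep_l2 v x\<bar>))"
      by (intro Bochner_Integration.integrable_add integrable_mult_right integrable_abs rep_integrable_domain rep_product_integrable_domain)
    show "(\<lambda>x. F (rep_l2 y x) * rep_l2 v x) \<in> borel_measurable M\<Omega>"
      by (intro borel_measurable_times continuous_composition_measurable Fc rep_measurable_domain)
    have "\<bar>F a * b\<bar> \<le> \<bar>\<bar>F 0\<bar> * \<bar>b\<bar> + L * (\<bar>a\<bar> * \<bar>b\<bar>)\<bar>" for a b
    proof -
      have "\<bar>F a\<bar> \<le> \<bar>F 0\<bar> + L * \<bar>a\<bar>" using F[of a 0] by simp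
      then have "\<bar>F a\<bar> * \<bar>b\<bar> \<le> (\<bar>F 0\<bar> + L * \<bar>a\<bar>) * \<bar>b\<bar>" by (rule mult_right_mono) simp
      then show ?thesis using L by (simp add: abs_mult algebra_simps)
    qed
    then show "AE x in M\<Omega>. norm (F (rep_l2 y x) * rep_l2 v x) \<le> norm (\<bar>F 0\<bar> * \<bar>rep_l2 v x\<bar> + L * (\<bar>rep_l2 y x\<bar> * \<bar>rep_l2 v x\<bar>))"
      by simp
  qed
  have lip: "\<bar>(LINT x|M\<Omega>. F (rep_l2 y x) * rep_l2 v x) - (LINT x|M\<Omega>. F (rep_l2 z x) * rep_l2 v x)\<bar> \<le> L * norm v * norm (y - z)" for y z
  proof -
    have "\<bar>(LINT x|M\<Omega>. F (rep_l2 y x) * rep_l2 v x) - (LINT x|M\<Omega>. F (rep_l2 z x) * rep_l2 v x)\<bar>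
      = \<bar>LINT x|M\<Omega>. F (rep_l2 y x) * rep_l2 v x - F (rep_l2 z x) * rep_l2 v x\<bar>"
      using int by simp
    also have "\<dots> \<le> (LINT x|M\<Omega>. L * (\<bar>rep_l2 (y - z) x\<bar> * \<bar>rep_l2 v x\<bar>))"
    proof (rule order_trans[OF integral_abs_bound integral_mono_AE])
      show "integrable M\<Omega> (\<lambda>x. \<bar>F (rep_l2 y x) * rep_l2 v x - F (rep_l2 z x) * rep_l2 v x\<bar>)"
        using int by simp
      show "integrable M\<Omega> (\<lambda>x. L * (\<bar>rep_l2 (y - z) x\<bar> * \<bar>rep_l2 v x\<bar>))"
        using rep_product_integrable_domain by simp
      show "AE x in M\<Omega>. \<bar>F (rep_l2 y x) * rep_l2 v x - F (rep_l2 z x) * rep_l2 v x\<bar> \<le> L * (\<bar>rep_l2 (y - z) x\<bar> * \<bar>rep_l2 v x\<bar>)"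
        using AE_domain[OF rep_diff_AE[of y z]]
      proof eventually_elim
        case (elim x)
        have "\<bar>F (rep_l2 y x) - F (rep_l2 z x)\<bar> * \<bar>rep_l2 v x\<bar> \<le> L * \<bar>rep_l2 y x - rep_l2 z x\<bar> * \<bar>rep_l2 v x\<bar>"
          by (intro mult_right_mono F) simp
        then show ?case by (simp add: elim left_diff_distrib[symmetric] abs_mult mult.assoc)
      qed
    qed
    also have "\<dots> \<le> L * (norm (y - z) * norm v)"
      using integral_rep_product_le L by (simp add: mult_left_mono)
    finally show ?thesis by (simp add: mult.commute mult.left_commute)
  qed
  show ?thesis
    unfolding continuous_on_iff
  proof (intro ballI allI impI)
    fix t and e :: real assume t: "t \<in> I" and e: "e > 0"
    have K: "L * norm v + 1 > 0" using L by (simp add: add_nonneg_pos)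
    obtain d where d: "d > 0" "\<And>t'. t' \<in> I \<Longrightarrow> dist t' t < d \<Longrightarrow> dist (u t') (u t) < e / (L * norm v + 1)"
      using u[unfolded continuous_on_iff, rule_format, OF t, of "e / (L * norm v + 1)"] e K by auto
    have "dist (LINT x|M\<Omega>. F (rep_l2 (u t') x) * rep_l2 v x) (LINT x|M\<Omega>. F (rep_l2 (u t) x) * rep_l2 v x) < e"
      if "t' \<in> I" "dist t' t < d" for t'
    proof -
      have "norm (u t' - u t) < e / (L * norm v + 1)" using d(2)[OF that] by (simp add: dist_norm)
      then have "(L * norm v + 1) * norm (u t' - u t) < e" using K by (simp add: field_simps)
      moreover have "L * norm v * norm (u t' - u t) \<le> (L * norm v + 1) * norm (u t' - u t)"
        by (intro mult_right_mono) auto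
      ultimately show ?thesis using lip[of "u t'" "u t"] by (simp add: dist_real_def)
    qed
    then show "\<exists>d>0. \<forall>t'\<in>I. dist t' t < d \<longrightarrow>
        dist (LINT x|M\<Omega>. F (rep_l2 (u t') x) * rep_l2 v x) (LINT x|M\<Omega>. F (rep_l2 (u t) x) * rep_l2 v x) < e"
      using d(1) by blast
  qed
qed

text \<open>
  For Lipschitz \<open>f\<close> this function of time is continuous, because \<open>u\<close> is continuous with values in \<open>L\<^sup>2\<close>.
  The general case is a pointwise limit, by dominated convergence in space.
\<close>

lemma nonlinear_functional_measurable:
  fixes f :: "real \<Rightarrow> real"
  assumes f: "continuous_on UNIV f" and C: "C \<ge> 0" "\<And>x. \<bar>f x\<bar> \<le> C * (1 + \<bar>x\<bar> ^ p)"
    and u: "continuous_on I (u :: real \<Rightarrow> 'a l2)" and I: "I \<in> sets lebesgue"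
    and int: "AE t in lebesgue_on I. integrable M\<Omega> (\<lambda>x. \<bar>rep_l2 (u t) x\<bar> ^ p * \<bar>rep_l2 v x\<bar>)"
  shows "(\<lambda>t. LINT x|M\<Omega>. f (rep_l2 (u t) x) * rep_l2 v x) \<in> borel_measurable (lebesgue_on I)"
proof -
  obtain F L where F: "\<And>k x y. \<bar>F k x - F k y\<bar> \<le> L k * \<bar>x - y\<bar>" "\<And>k::nat. L k \<ge> 0"
    "\<And>k x. \<bar>F k x\<bar> \<le> 1 + C * (1 + \<bar>x\<bar> ^ p)" "\<And>x. (\<lambda>k. F k x) \<longlonglongrightarrow> f x"
    using lipschitz_approximation[OF f C] by blast
  have Fc: "continuous_on UNIV (F k)" for k
    by (rule lipschitz_on_continuous_on[where L="L k"])
      (use F in \<open>auto simp: lipschitz_on_def dist_real_def\<close>)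
  show ?thesis
  proof (rule borel_measurable_lebesgue_on_AE_limit[OF I])
    show "(\<lambda>t. LINT x|M\<Omega>. F k (rep_l2 (u t) x) * rep_l2 v x) \<in> borel_measurable (lebesgue_on I)" for k
      by (rule continuous_imp_measurable_on_sets_lebesgue[OF lipschitz_composition_continuous[OF F(1,2) u] I])
    show "AE t in lebesgue_on I. (\<lambda>k. LINT x|M\<Omega>. F k (rep_l2 (u t) x) * rep_l2 v x)
        \<longlonglongrightarrow> (LINT x|M\<Omega>. f (rep_l2 (u t) x) * rep_l2 v x)"
      using int
    proof eventually_elim
      case (elim t)
      show ?case
      proof (rule integral_dominated_convergence)
        show "(\<lambda>x. f (rep_l2 (u t) x) * rep_l2 v x) \<in> borel_measurable M\<Omega>"
          "(\<lambda>x. F k (rep_l2 (u t) x) * rep_l2 v x) \<in> borel_measurable M\<Omega>" for k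
          by (intro borel_measurable_times continuous_composition_measurable f Fc rep_measurable_domain)+
        show "integrable M\<Omega> (\<lambda>x. (1 + C) * \<bar>rep_l2 v x\<bar> + C * (\<bar>rep_l2 (u t) x\<bar> ^ p * \<bar>rep_l2 v x\<bar>))"
          by (intro Bochner_Integration.integrable_add integrable_mult_right integrable_abs rep_integrable_domain elim)
        show "AE x in M\<Omega>. (\<lambda>k. F k (rep_l2 (u t) x) * rep_l2 v x) \<longlonglongrightarrow> f (rep_l2 (u t) x) * rep_l2 v x"
          by (intro AE_I2 tendsto_mult tendsto_const F)
        have "\<bar>F k a * b\<bar> \<le> (1 + C) * \<bar>b\<bar> + C * (\<bar>a\<bar> ^ p * \<bar>b\<bar>)" for k a b
          using mult_right_mono[OF F(3)[of k a], of "\<bar>b\<bar>"] by (simp add: abs_mult algebra_simps)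
        then show "AE x in M\<Omega>. norm (F k (rep_l2 (u t) x) * rep_l2 v x) \<le> (1 + C) * \<bar>rep_l2 v x\<bar> + C * (\<bar>rep_l2 (u t) x\<bar> ^ p * \<bar>rep_l2 v x\<bar>)" for k
          by simp
      qed
    qed
  qed
qed

lemma L4_power: "L4_norm \<Omega> u ^ 4 = (LINT x|M\<Omega>. (rep_l2 u x) ^ 4)"
  unfolding L4_norm_def by (rule real_root_pow_pos2) (auto intro!: Bochner_Integration.integral_nonneg)

lemma L4_norm_nonneg: "0 \<le> L4_norm \<Omega> u"
  unfolding L4_norm_def by (intro real_root_ge_zero Bochner_Integration.integral_nonneg) simp

lemma L4_integrable: "u \<in> L4 \<Omega> \<Longrightarrow> integrable M\<Omega> (\<lambda>x. (rep_l2 u x) ^ 4)"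
  by (simp add: L4_def)

lemma L4_diff:
  assumes "u \<in> L4 \<Omega>" "v \<in> L4 \<Omega>"
  shows "u - v \<in> L4 \<Omega>" "L4_norm \<Omega> (u - v) ^ 4 \<le> 8 * (L4_norm \<Omega> u ^ 4 + L4_norm \<Omega> v ^ 4)"
proof -
  have i: "integrable M\<Omega> (\<lambda>x. 8 * ((rep_l2 u x) ^ 4 + (rep_l2 v x) ^ 4))"
    using L4_integrable assms by auto
  have le: "AE x in M\<Omega>. (rep_l2 (u - v) x) ^ 4 \<le> 8 * ((rep_l2 u x) ^ 4 + (rep_l2 v x) ^ 4)"
    using AE_domain[OF rep_diff_AE[of u v]] by eventually_elim (simp only: fourth_power_diff_le)
  have d: "integrable M\<Omega> (\<lambda>x. (rep_l2 (u - v) x) ^ 4)"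
  proof (rule Bochner_Integration.integrable_bound[OF i])
    show "AE x in M\<Omega>. norm (rep_l2 (u - v) x ^ 4) \<le> norm (8 * ((rep_l2 u x) ^ 4 + (rep_l2 v x) ^ 4))"
      using le by eventually_elim simp
  qed (intro borel_measurable_power rep_measurable_domain)
  then show "u - v \<in> L4 \<Omega>" using assms by (auto simp: L4_def intro: L2_diff)
  have "L4_norm \<Omega> (u - v) ^ 4 \<le> (LINT x|M\<Omega>. 8 * ((rep_l2 u x) ^ 4 + (rep_l2 v x) ^ 4))"
    unfolding L4_power by (rule integral_mono_AE[OF d i le])
  then show "L4_norm \<Omega> (u - v) ^ 4 \<le> 8 * (L4_norm \<Omega> u ^ 4 + L4_norm \<Omega> v ^ 4)"
    using L4_integrable assms by (simp add: L4_power)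
qed

lemma L4_norm_quasi_triangle:
  assumes "x \<in> L4 \<Omega>" "y \<in> L4 \<Omega>" "z \<in> L4 \<Omega>"
  shows "L4_norm \<Omega> (x - z) \<le> 8 * (L4_norm \<Omega> (y - x) + L4_norm \<Omega> (y - z))"
proof -
  let ?A = "L4_norm \<Omega> (y - x)" and ?B = "L4_norm \<Omega> (y - z)"
  have "x - z = (y - z) - (y - x)" by simp
  then have "L4_norm \<Omega> (x - z) ^ 4 \<le> 8 * (?B ^ 4 + ?A ^ 4)"
    using L4_diff(2)[OF L4_diff(1)[OF assms(2,3)] L4_diff(1)[OF assms(2,1)]] by simp
  also have "\<dots> \<le> 8 ^ 4 * (?A + ?B) ^ 4"
  proof -
    have "?A ^ 4 \<le> (?A + ?B) ^ 4" "?B ^ 4 \<le> (?A + ?B) ^ 4"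
      using L4_norm_nonneg by (auto intro!: power_mono)
    then have "8 * (?B ^ 4 + ?A ^ 4) \<le> 16 * (?A + ?B) ^ 4" by simp
    also have "\<dots> \<le> 8 ^ 4 * (?A + ?B) ^ 4" by (intro mult_right_mono) auto
    finally show ?thesis .
  qed
  also have "\<dots> = (8 * (?A + ?B)) ^ 4" by (rule power_mult_distrib[symmetric])
  finally have "L4_norm \<Omega> (x - z) ^ Suc 3 \<le> (8 * (?A + ?B)) ^ Suc 3" by simp
  then show ?thesis
    by (rule power_le_imp_le_base) (simp add: L4_norm_nonneg)
qed

end

section \<open>Energy estimate\<close>

lemma bochner_Lp_integrable:
  assumes u: "u \<in> bochner_Lp p I X N" and m: "(\<lambda>t. N (u t)) \<in> borel_measurable (lebesgue_on I)"
    and nn: "\<And>x. 0 \<le> N x"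
  shows "integrable (lebesgue_on I) (\<lambda>t. N (u t) ^ p)"
proof (rule integrableI_nonneg)
  show "(\<lambda>t. N (u t) ^ p) \<in> borel_measurable (lebesgue_on I)" using m by (rule borel_measurable_power)
  show "AE t in lebesgue_on I. 0 \<le> N (u t) ^ p" using nn by simp
  show "(\<integral>\<^sup>+ t. ennreal (N (u t) ^ p) \<partial>lebesgue_on I) < \<infinity>" using u by (simp add: bochner_Lp_def)
qed

text \<open>
  Let \<open>S1\<close> and \<open>S2\<close> be the countable sets of values of the approximating simple functions for the two
  norms. For each \<open>p \<in> S1\<close>, \<open>q \<in> S2\<close> and each accuracy, one time is selected at which \<open>u\<close> is close to \<open>p\<close> in the first
  and to \<open>q\<close> in the second norm, if there is any. The values of \<open>u\<close> at the selected times form \<open>D\<close>.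
\<close>

lemma AE_simultaneous_approximation_by_own_values:
  fixes u :: "real \<Rightarrow> 'b::real_vector"
  assumes u1: "strongly_measurable I X1 N1 u" and u2: "strongly_measurable I X2 N2 u" and I: "I \<in> sets lebesgue"
    and K1: "K1 > 0" "\<And>x y z. x \<in> X1 \<Longrightarrow> y \<in> X1 \<Longrightarrow> z \<in> X1 \<Longrightarrow> N1 (x - z) \<le> K1 * (N1 (y - x) + N1 (y - z))"
    and K2: "K2 > 0" "\<And>x y z. x \<in> X2 \<Longrightarrow> y \<in> X2 \<Longrightarrow> z \<in> X2 \<Longrightarrow> N2 (x - z) \<le> K2 * (N2 (y - x) + N2 (y - z))"
  obtains D where "countable D" "D \<subseteq> X1 \<inter> X2"
    "AE t in lebesgue_on I. u t \<in> X1 \<and> u t \<in> X2 \<and> (\<forall>\<delta>>0. \<exists>v\<in>D. N1 (v - u t) < \<delta> \<and> N2 (v - u t) < \<delta>)"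
proof -
  obtain s1 where s1: "\<And>n::nat. simple_function (lebesgue_on I) (s1 n) \<and> s1 n ` I \<subseteq> X1"
    "AE t in lebesgue_on I. (\<lambda>n. N1 (s1 n t - u t)) \<longlonglongrightarrow> 0"
    using u1 unfolding strongly_measurable_def by blast
  obtain s2 where s2: "\<And>n::nat. simple_function (lebesgue_on I) (s2 n) \<and> s2 n ` I \<subseteq> X2"
    "AE t in lebesgue_on I. (\<lambda>n. N2 (s2 n t - u t)) \<longlonglongrightarrow> 0"
    using u2 unfolding strongly_measurable_def by blast
  have uX: "AE t in lebesgue_on I. u t \<in> X1" "AE t in lebesgue_on I. u t \<in> X2"
    using u1 u2 by (auto simp: strongly_measurable_def)
  define S1 where "S1 = (\<Union>n. s1 n ` I)"
  define S2 where "S2 = (\<Union>n. s2 n ` I)"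
  have S: "countable S1" "countable S2"
    unfolding S1_def S2_def
    by (rule countable_UN, simp, rule countable_finite, use s1(1) s2(1) in \<open>simp add: simple_function_def\<close>)+
  have SX: "S1 \<subseteq> X1" "S2 \<subseteq> X2"
    unfolding S1_def S2_def using s1(1) s2(1) by blast+
  define good where "good t \<longleftrightarrow> t \<in> I \<and> u t \<in> X1 \<and> u t \<in> X2 \<and>
    (\<lambda>n. N1 (s1 n t - u t)) \<longlonglongrightarrow> 0 \<and> (\<lambda>n. N2 (s2 n t - u t)) \<longlonglongrightarrow> 0" for t
  have AE_good: "AE t in lebesgue_on I. good t"
  proof -
    have "AE t in lebesgue_on I. t \<in> I" using I by (simp add: AE_restrict_space_iff)
    with uX s1(2) s2(2) show ?thesis unfolding good_def by eventually_elim simp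
  qed
  define Q where "Q p q m t \<longleftrightarrow> good t \<and> N1 (p - u t) < inverse (real (Suc m)) \<and> N2 (q - u t) < inverse (real (Suc m))" for p q m t
  define D where "D = (\<lambda>(p, q, m). u (SOME t. Q p q m t)) ` {(p, q, m). p \<in> S1 \<and> q \<in> S2 \<and> (\<exists>t. Q p q m t)}"
  have "countable {(p, q, m). p \<in> S1 \<and> q \<in> S2 \<and> (\<exists>t. Q p q m t)}"
    by (rule countable_subset[of _ "S1 \<times> S2 \<times> UNIV"]) (use S in auto)
  then have cD: "countable D" unfolding D_def by (rule countable_image)
  have someI: "Q p q m (SOME t. Q p q m t)" if "Q p q m t" for p q m t
    using that by (rule someI)
  have DX: "D \<subseteq> X1 \<inter> X2"
    using someI by (auto simp: D_def Q_def good_def)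
  have "\<exists>v\<in>D. N1 (v - u t) < \<delta> \<and> N2 (v - u t) < \<delta>" if t: "good t" and \<delta>: "\<delta> > 0" for t \<delta>
  proof -
    have "min (\<delta> / (2 * K1)) (\<delta> / (2 * K2)) > 0" using K1(1) K2(1) \<delta> by simp
    then obtain m where "inverse (real (Suc m)) < min (\<delta> / (2 * K1)) (\<delta> / (2 * K2))"
      using reals_Archimedean by blast
    then have m: "K1 * (2 * inverse (real (Suc m))) < \<delta>" "K2 * (2 * inverse (real (Suc m))) < \<delta>"
      using K1(1) K2(1) by (auto simp: field_simps)
    let ?r = "inverse (real (Suc m))"
    have "eventually (\<lambda>n. N1 (s1 n t - u t) < ?r) sequentially" "eventually (\<lambda>n. N2 (s2 n t - u t) < ?r) sequentially"
      using t by (auto simp: good_def intro!: order_tendstoD(2)[of _ 0])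
    then obtain n1 n2 where n: "N1 (s1 n1 t - u t) < ?r" "N2 (s2 n2 t - u t) < ?r"
      by (meson eventually_happens trivial_limit_sequentially)
    let ?p = "s1 n1 t" and ?q = "s2 n2 t"
    have pq: "?p \<in> S1" "?q \<in> S2" using t by (auto simp: S1_def S2_def good_def)
    have Qt: "Q ?p ?q m t" using n t by (simp add: Q_def)
    define t' where "t' = (SOME t. Q ?p ?q m t)"
    have Qt': "Q ?p ?q m t'" unfolding t'_def by (rule someI[OF Qt])
    have "u t' \<in> D" unfolding D_def t'_def using pq Qt by (intro image_eqI[of _ _ "(?p, ?q, m)"]) auto
    moreover have "N1 (u t' - u t) \<le> K1 * (N1 (?p - u t') + N1 (?p - u t))"
      using Qt Qt' pq SX by (intro K1) (auto simp: Q_def good_def)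
    then have "N1 (u t' - u t) \<le> K1 * (2 * ?r)"
      using Qt Qt' K1(1) by (elim order_trans) (auto simp: Q_def intro!: mult_left_mono)
    moreover have "N2 (u t' - u t) \<le> K2 * (N2 (?q - u t') + N2 (?q - u t))"
      using Qt Qt' pq SX by (intro K2) (auto simp: Q_def good_def)
    then have "N2 (u t' - u t) \<le> K2 * (2 * ?r)"
      using Qt Qt' K2(1) by (elim order_trans) (auto simp: Q_def intro!: mult_left_mono)
    ultimately show ?thesis using m by (intro bexI[of _ "u t'"]) auto
  qed
  then have *: "good t \<Longrightarrow> \<forall>\<delta>>0. \<exists>v\<in>D. N1 (v - u t) < \<delta> \<and> N2 (v - u t) < \<delta>" for t by blast
  have "AE t in lebesgue_on I. u t \<in> X1 \<and> u t \<in> X2 \<and> (\<forall>\<delta>>0. \<exists>v\<in>D. N1 (v - u t) < \<delta> \<and> N2 (v - u t) < \<delta>)"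
    using AE_good by (rule eventually_mono) (use * in \<open>simp add: good_def\<close>)
  then show ?thesis using that cD DX by blast
qed

locale reaction_diffusion = bounded_open \<Omega> for \<Omega> :: "'a::euclidean_space set" +
  fixes f :: "real \<Rightarrow> real" and h :: "'a l2" and C1 C2 :: real
  assumes f_continuous: "continuous_on UNIV f"
    and f_growth: "\<And>x. \<bar>f x\<bar> \<le> C1 * (1 + \<bar>x\<bar> ^ 3)"
    and f_dissipative: "\<And>x. f x * x \<ge> - C2"
begin

definition react :: "'a l2 \<Rightarrow> 'a l2 \<Rightarrow> real" where
  "react u v = (LINT x|M\<Omega>. f (rep_l2 u x) * rep_l2 v x)"

lemma C1_nonneg: "C1 \<ge> 0"
  using f_growth[of 0] by simp

lemma abs_f_times_le: "\<bar>f a * b\<bar> \<le> C1 * (1 + a ^ 4 + 2 * b ^ 4)"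
proof -
  have "\<bar>b\<bar> \<le> 1 + b ^ 4"
  proof (cases "\<bar>b\<bar> \<le> 1")
    case False
    then have "\<bar>b\<bar> ^ 1 \<le> \<bar>b\<bar> ^ 4" by (intro power_increasing) auto
    then show ?thesis by (simp add: power_even_abs)
  qed (simp add: add_increasing2)
  moreover have "\<bar>a\<bar> ^ 3 * \<bar>b\<bar> \<le> a ^ 4 + b ^ 4" using cube_times_le[of 1 a b] by simp
  ultimately have "(1 + \<bar>a\<bar> ^ 3) * \<bar>b\<bar> \<le> 1 + a ^ 4 + 2 * b ^ 4" by (simp add: algebra_simps)
  then have "C1 * ((1 + \<bar>a\<bar> ^ 3) * \<bar>b\<bar>) \<le> C1 * (1 + a ^ 4 + 2 * b ^ 4)"
    by (rule mult_left_mono[OF _ C1_nonneg])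
  moreover have "\<bar>f a * b\<bar> \<le> C1 * (1 + \<bar>a\<bar> ^ 3) * \<bar>b\<bar>"
    unfolding abs_mult by (intro mult_right_mono f_growth) simp
  ultimately show ?thesis by (simp add: mult.assoc)
qed

lemma react_integrable:
  assumes "u \<in> L4 \<Omega>" "v \<in> L4 \<Omega>"
  shows "integrable M\<Omega> (\<lambda>x. f (rep_l2 u x) * rep_l2 v x)"
    and "\<bar>react u v\<bar> \<le> C1 * (measure lebesgue \<Omega> + L4_norm \<Omega> u ^ 4 + 2 * L4_norm \<Omega> v ^ 4)"
proof -
  let ?B = "\<lambda>x. C1 * (1 + (rep_l2 u x) ^ 4 + 2 * (rep_l2 v x) ^ 4)"
  have B: "integrable M\<Omega> ?B"
    by (intro integrable_mult_right Bochner_Integration.integrable_add integrable_domain_const L4_integrable assms)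
  show i: "integrable M\<Omega> (\<lambda>x. f (rep_l2 u x) * rep_l2 v x)"
  proof (rule Bochner_Integration.integrable_bound[OF B])
    show "(\<lambda>x. f (rep_l2 u x) * rep_l2 v x) \<in> borel_measurable M\<Omega>"
      by (intro borel_measurable_times continuous_composition_measurable f_continuous rep_measurable_domain)
    show "AE x in M\<Omega>. norm (f (rep_l2 u x) * rep_l2 v x) \<le> norm (?B x)"
      unfolding real_norm_def by (intro AE_I2 order_trans[OF abs_f_times_le abs_ge_self])
  qed
  have "\<bar>react u v\<bar> \<le> (LINT x|M\<Omega>. \<bar>f (rep_l2 u x) * rep_l2 v x\<bar>)"
    unfolding react_def by (rule integral_abs_bound)
  also have "\<dots> \<le> (LINT x|M\<Omega>. ?B x)"
    using i B abs_f_times_le by (intro integral_mono) auto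
  also have "\<dots> = C1 * (measure lebesgue \<Omega> + L4_norm \<Omega> u ^ 4 + 2 * L4_norm \<Omega> v ^ 4)"
    using L4_integrable[OF assms(1)] L4_integrable[OF assms(2)] integrable_domain_const[of 1] domain_sets
    by (simp add: L4_power measure_restrict_space)
  finally show "\<bar>react u v\<bar> \<le> C1 * (measure lebesgue \<Omega> + L4_norm \<Omega> u ^ 4 + 2 * L4_norm \<Omega> v ^ 4)" .
qed

lemma react_self_ge:
  assumes "u \<in> L4 \<Omega>"
  shows "react u u \<ge> - (C2 * measure lebesgue \<Omega>)"
proof -
  have "(LINT x|M\<Omega>. - C2) \<le> react u u"
    unfolding react_def using f_dissipative by (intro integral_mono integrable_domain_const react_integrable assms) auto
  then show ?thesis using domain_sets by (simp add: measure_restrict_space mult.commute)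
qed

text \<open>
  By \<open>cube_times_le\<close> the difference is at most \<open>C1 (\<delta> B + |v n - u|\<^sup>4 / \<delta>\<^sup>3)\<close>, with the \<open>L\<^sup>4\<close> norm and \<open>B\<close>
  independent of \<open>n\<close>: first choose \<open>\<delta>\<close>, then \<open>n\<close>.
\<close>

lemma react_tendsto:
  assumes u: "u \<in> L4 \<Omega>" and v: "\<And>n. v n \<in> L4 \<Omega>" "(\<lambda>n. L4_norm \<Omega> (v n - u)) \<longlonglongrightarrow> 0"
  shows "(\<lambda>n. react u (v n)) \<longlonglongrightarrow> react u u"
proof (rule LIMSEQ_I)
  fix e :: real assume e: "e > 0"
  define B where "B = (LINT x|M\<Omega>. (1 + \<bar>rep_l2 u x\<bar>) ^ 4)"
  have A_le: "(1 + \<bar>a\<bar>) ^ 4 \<le> 8 * (1 + a ^ 4)" for a :: real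
    using fourth_power_diff_le[of 1 "- \<bar>a\<bar>"] by (simp add: power_even_abs)
  have iA: "integrable M\<Omega> (\<lambda>x. (1 + \<bar>rep_l2 u x\<bar>) ^ 4)"
  proof (rule Bochner_Integration.integrable_bound)
    show "integrable M\<Omega> (\<lambda>x. 8 * (1 + (rep_l2 u x) ^ 4))"
      by (intro integrable_mult_right Bochner_Integration.integrable_add integrable_domain_const L4_integrable u)
    show "(\<lambda>x. (1 + \<bar>rep_l2 u x\<bar>) ^ 4) \<in> borel_measurable M\<Omega>"
      by (intro borel_measurable_power borel_measurable_add borel_measurable_abs rep_measurable_domain) simp
    show "AE x in M\<Omega>. norm ((1 + \<bar>rep_l2 u x\<bar>) ^ 4) \<le> norm (8 * (1 + (rep_l2 u x) ^ 4))"
      using A_le by (intro AE_I2) (simp add: abs_of_nonneg)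
  qed
  have B: "B \<ge> 0" unfolding B_def by (intro Bochner_Integration.integral_nonneg) simp
  have bound: "\<bar>react u (v n) - react u u\<bar> \<le> C1 * (\<delta> * B + L4_norm \<Omega> (v n - u) ^ 4 / \<delta> ^ 3)" if \<delta>: "\<delta> > 0" for n \<delta>
  proof -
    let ?d = "rep_l2 (v n - u)"
    have d: "v n - u \<in> L4 \<Omega>" by (rule L4_diff[OF v(1) u])
    have "react u (v n) - react u u = (LINT x|M\<Omega>. f (rep_l2 u x) * rep_l2 (v n) x - f (rep_l2 u x) * rep_l2 u x)"
      using react_integrable(1)[OF u] u v(1) by (simp add: react_def)
    also have "\<bar>\<dots>\<bar> \<le> (LINT x|M\<Omega>. C1 * (\<delta> * (1 + \<bar>rep_l2 u x\<bar>) ^ 4 + (?d x) ^ 4 / \<delta> ^ 3))"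
    proof (rule order_trans[OF integral_abs_bound integral_mono_AE])
      show "integrable M\<Omega> (\<lambda>x. \<bar>f (rep_l2 u x) * rep_l2 (v n) x - f (rep_l2 u x) * rep_l2 u x\<bar>)"
        by (intro integrable_abs Bochner_Integration.integrable_diff react_integrable(1) u v)
      show "integrable M\<Omega> (\<lambda>x. C1 * (\<delta> * (1 + \<bar>rep_l2 u x\<bar>) ^ 4 + (?d x) ^ 4 / \<delta> ^ 3))"
        by (intro integrable_mult_right Bochner_Integration.integrable_add iA integrable_divide L4_integrable[OF d])
      show "AE x in M\<Omega>. \<bar>f (rep_l2 u x) * rep_l2 (v n) x - f (rep_l2 u x) * rep_l2 u x\<bar>
          \<le> C1 * (\<delta> * (1 + \<bar>rep_l2 u x\<bar>) ^ 4 + (?d x) ^ 4 / \<delta> ^ 3)"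
        using AE_domain[OF rep_diff_AE[of "v n" u]]
      proof eventually_elim
        case (elim x)
        let ?a = "rep_l2 u x"
        have "\<bar>f ?a\<bar> \<le> C1 * (1 + \<bar>?a\<bar> ^ 3)" by (rule f_growth)
        also have "\<dots> \<le> C1 * (1 + \<bar>?a\<bar>) ^ 3"
          by (intro mult_left_mono C1_nonneg) (simp add: power3_eq_cube algebra_simps)
        finally have fa: "\<bar>f ?a\<bar> \<le> C1 * (1 + \<bar>?a\<bar>) ^ 3" .
        have "f ?a * rep_l2 (v n) x - f ?a * ?a = f ?a * ?d x" using elim by (simp add: right_diff_distrib)
        then have "\<bar>f ?a * rep_l2 (v n) x - f ?a * ?a\<bar> = \<bar>f ?a\<bar> * \<bar>?d x\<bar>" by (simp add: abs_mult)
        also have "\<dots> \<le> C1 * (1 + \<bar>?a\<bar>) ^ 3 * \<bar>?d x\<bar>" by (intro mult_right_mono fa) simp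
        also have "\<dots> = C1 * (\<bar>1 + \<bar>?a\<bar>\<bar> ^ 3 * \<bar>?d x\<bar>)" by (simp add: mult.assoc)
        also have "\<dots> \<le> C1 * (\<delta> * (1 + \<bar>?a\<bar>) ^ 4 + (?d x) ^ 4 / \<delta> ^ 3)"
          by (intro mult_left_mono C1_nonneg cube_times_le \<delta>)
        finally show ?case .
      qed
    qed
    also have "\<dots> = C1 * (\<delta> * B + L4_norm \<Omega> (v n - u) ^ 4 / \<delta> ^ 3)"
      using iA L4_integrable[OF d] by (simp add: B_def L4_power)
    finally show ?thesis .
  qed
  define \<delta> where "\<delta> = e / (2 * (C1 * B + 1))"
  have pos: "C1 * B + 1 > 0" using C1_nonneg B by (simp add: add_nonneg_pos)
  have \<delta>: "\<delta> > 0" "C1 * (\<delta> * B) \<le> e / 2"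
  proof -
    show "\<delta> > 0" using e pos by (simp add: \<delta>_def)
    have "C1 * (\<delta> * B) \<le> \<delta> * (C1 * B + 1)" using \<open>\<delta> > 0\<close> by (simp add: algebra_simps)
    also have "\<dots> = e / 2" using pos unfolding \<delta>_def by (simp add: field_simps)
    finally show "C1 * (\<delta> * B) \<le> e / 2" .
  qed
  have "(\<lambda>n. C1 * (L4_norm \<Omega> (v n - u) ^ 4 / \<delta> ^ 3)) \<longlonglongrightarrow> C1 * (0 ^ 4 / \<delta> ^ 3)"
    using \<delta>(1) by (intro tendsto_intros v(2)) auto
  then have "eventually (\<lambda>n. C1 * (L4_norm \<Omega> (v n - u) ^ 4 / \<delta> ^ 3) < e / 2) sequentially"
    using e by (intro order_tendstoD(2)) auto
  then obtain n0 where n0: "\<And>n. n \<ge> n0 \<Longrightarrow> C1 * (L4_norm \<Omega> (v n - u) ^ 4 / \<delta> ^ 3) < e / 2"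
    by (auto simp: eventually_sequentially)
  have "norm (react u (v n) - react u u) < e" if "n \<ge> n0" for n
    using bound[OF \<delta>(1), of n] n0[OF that] \<delta>(2) unfolding real_norm_def distrib_left by linarith
  then show "\<exists>no. \<forall>n\<ge>no. norm (react u (v n) - react u u) < e" by blast
qed

lemma H10_norm_measurable:
  assumes "strongly_measurable I (H10 \<Omega>) (H10_norm \<Omega>) u" "I \<in> sets lebesgue"
  shows "(\<lambda>t. H10_norm \<Omega> (u t)) \<in> borel_measurable (lebesgue_on I)"
proof (rule strongly_measurable_imp_borel_measurable[OF assms])
  fix y :: "nat \<Rightarrow> 'a l2" and x
  assume y: "\<And>n. y n \<in> H10 \<Omega>" and x: "x \<in> H10 \<Omega>" and lim: "(\<lambda>n. H10_norm \<Omega> (y n - x)) \<longlonglongrightarrow> 0"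
  have 0: "0 \<in> H10 \<Omega>" using H10_diff[OF x x] by simp
  have "\<bar>H10_norm \<Omega> (y n) - H10_norm \<Omega> x\<bar> \<le> H10_norm \<Omega> (y n - x)" for n
    using H10_norm_triangle[OF y x 0, of n] H10_norm_triangle[OF x y 0, of n] H10_norm_commute[of x "y n"] by simp
  then have "(\<lambda>n. H10_norm \<Omega> (y n) - H10_norm \<Omega> x) \<longlonglongrightarrow> 0"
    by (intro Lim_null_comparison[OF _ lim]) simp
  then show "(\<lambda>n. H10_norm \<Omega> (y n)) \<longlonglongrightarrow> H10_norm \<Omega> x" by (rule LIM_zero_cancel)
qed

lemma H10_inner_tendsto:
  assumes y: "\<And>n. y n \<in> H10 \<Omega>" and x: "x \<in> H10 \<Omega>" and lim: "(\<lambda>n. H10_norm \<Omega> (y n - x)) \<longlonglongrightarrow> 0"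
  shows "(\<lambda>n. H10_inner \<Omega> (y n) v) \<longlonglongrightarrow> H10_inner \<Omega> x v"
proof (rule LIM_zero_cancel, rule Lim_null_comparison)
  show "eventually (\<lambda>n. norm (H10_inner \<Omega> (y n) v - H10_inner \<Omega> x v) \<le> H10_norm \<Omega> (y n - x) * H10_norm \<Omega> v) sequentially"
    using H10_inner_Cauchy_Schwarz by (intro always_eventually) (simp add: H10_inner_diff_left[OF y x, symmetric])
  show "(\<lambda>n. H10_norm \<Omega> (y n - x) * H10_norm \<Omega> v) \<longlonglongrightarrow> 0"
    using tendsto_mult[OF lim tendsto_const, of "H10_norm \<Omega> v"] by simp
qed

text \<open>
  The fourth power of the norm is the functional of \<open>nonlinear_functional_measurable\<close> for
  \<open>f x = x ^ 4\<close> and for \<open>v\<close> the indicator of \<open>\<Omega>\<close>.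
\<close>

lemma L4_norm_measurable:
  assumes u: "continuous_on I (u :: real \<Rightarrow> 'a l2)" and I: "I \<in> sets lebesgue" and L4: "AE t in lebesgue_on I. u t \<in> L4 \<Omega>"
  shows "(\<lambda>t. L4_norm \<Omega> (u t)) \<in> borel_measurable (lebesgue_on I)"
proof -
  define one where "one = abs_l2 (indicator \<Omega> :: 'a \<Rightarrow> real)"
  have "emeasure lebesgue \<Omega> < \<infinity>"
    using lmeasurable_open[OF bounded_domain open_domain] by (simp only: fmeasurable_def mem_Collect_eq)
  then have "integrable lebesgue (indicator \<Omega> :: 'a \<Rightarrow> real)"
    by (rule integrable_real_indicator[OF domain_sets(1)])
  then have sq: "square_integrable (indicator \<Omega> :: 'a \<Rightarrow> real)"
    using domain_sets by (simp add: square_integrable_def power2_eq_square flip: indicator_inter_arith)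
  have "AE x in M\<Omega>. rep_l2 one x = indicator \<Omega> x"
    unfolding one_def by (rule AE_domain[OF rep_abs_l2_AE[OF sq]])
  moreover have "AE x in M\<Omega>. x \<in> \<Omega>" by (simp add: AE_restrict_space_iff domain_sets)
  ultimately have one: "AE x in M\<Omega>. rep_l2 one x = 1" by eventually_elim simp
  have eq: "(LINT x|M\<Omega>. (rep_l2 y x) ^ 4 * rep_l2 one x) = L4_norm \<Omega> y ^ 4" for y
    unfolding L4_power
    by (intro integral_cong_AE borel_measurable_times borel_measurable_power rep_measurable_domain)
      (use one in eventually_elim, simp)
  have int: "AE t in lebesgue_on I. integrable M\<Omega> (\<lambda>x. \<bar>rep_l2 (u t) x\<bar> ^ 4 * \<bar>rep_l2 one x\<bar>)"
    using L4
  proof eventually_elim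
    case (elim t)
    have "integrable M\<Omega> (\<lambda>x. (rep_l2 (u t) x) ^ 4)" by (rule L4_integrable[OF elim])
    then show ?case
    proof (rule integrable_cong_AE_imp)
      show "(\<lambda>x. \<bar>rep_l2 (u t) x\<bar> ^ 4 * \<bar>rep_l2 one x\<bar>) \<in> borel_measurable M\<Omega>"
        by (intro borel_measurable_times borel_measurable_power borel_measurable_abs rep_measurable_domain)
      show "AE x in M\<Omega>. (rep_l2 (u t) x) ^ 4 = \<bar>rep_l2 (u t) x\<bar> ^ 4 * \<bar>rep_l2 one x\<bar>"
        using one by eventually_elim simp
    qed
  qed
  have c: "continuous_on UNIV (\<lambda>x::real. x ^ 4)" by (intro continuous_intros)
  have "(\<lambda>t. L4_norm \<Omega> (u t) ^ 4) \<in> borel_measurable (lebesgue_on I)"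
    using nonlinear_functional_measurable[OF c zero_le_one _ u I int] by (simp add: eq)
  then have "(\<lambda>t. root 4 (L4_norm \<Omega> (u t) ^ 4)) \<in> borel_measurable (lebesgue_on I)"
    by (rule measurable_compose[OF _ borel_measurable_continuous_onI]) (intro continuous_intros)
  then show ?thesis using L4_norm_nonneg by (simp add: real_root_power_cancel)
qed

lemma react_measurable:
  assumes u: "continuous_on I (u :: real \<Rightarrow> 'a l2)" and I: "I \<in> sets lebesgue" and L4: "AE t in lebesgue_on I. u t \<in> L4 \<Omega>" and v: "v \<in> L4 \<Omega>"
  shows "(\<lambda>t. react (u t) v) \<in> borel_measurable (lebesgue_on I)"
  unfolding react_def
proof (rule nonlinear_functional_measurable[OF f_continuous C1_nonneg f_growth u I])
  show "AE t in lebesgue_on I. integrable M\<Omega> (\<lambda>x. \<bar>rep_l2 (u t) x\<bar> ^ 3 * \<bar>rep_l2 v x\<bar>)"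
    using L4
  proof eventually_elim
    case (elim t)
    show ?case
    proof (rule Bochner_Integration.integrable_bound)
      show "integrable M\<Omega> (\<lambda>x. (rep_l2 (u t) x) ^ 4 + (rep_l2 v x) ^ 4)"
        by (intro Bochner_Integration.integrable_add L4_integrable elim v)
      show "(\<lambda>x. \<bar>rep_l2 (u t) x\<bar> ^ 3 * \<bar>rep_l2 v x\<bar>) \<in> borel_measurable M\<Omega>"
        by (intro borel_measurable_times borel_measurable_power borel_measurable_abs rep_measurable_domain)
      show "AE x in M\<Omega>. norm (\<bar>rep_l2 (u t) x\<bar> ^ 3 * \<bar>rep_l2 v x\<bar>) \<le> norm ((rep_l2 (u t) x) ^ 4 + (rep_l2 v x) ^ 4)"
        using cube_times_le[of 1] by (intro AE_I2) simp
    qed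
  qed
qed

lemma integrable_times_test:
  fixes g :: "real \<Rightarrow> real"
  assumes g: "integrable (lebesgue_on I) g" and \<eta>: "\<eta> \<in> test_functions J"
  shows "integrable (lebesgue_on I) (\<lambda>t. g t * \<eta> t)"
proof -
  obtain B where B: "\<And>t. \<bar>\<eta> t\<bar> \<le> B" using test_function_bounded[OF \<eta>] by blast
  show ?thesis
  proof (rule Bochner_Integration.integrable_bound)
    show "integrable (lebesgue_on I) (\<lambda>t. B * \<bar>g t\<bar>)" using g by simp
    have "\<eta> \<in> borel_measurable (lebesgue_on I)"
      by (intro measurable_restrict_space1 borel_measurable_integrable[OF test_function_integrable(2)[OF \<eta>]])
    then show "(\<lambda>t. g t * \<eta> t) \<in> borel_measurable (lebesgue_on I)"
      by (rule borel_measurable_times[OF borel_measurable_integrable[OF g]])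
    have "\<bar>g t * \<eta> t\<bar> \<le> \<bar>B * \<bar>g t\<bar>\<bar>" for t
      using mult_right_mono[OF order_trans[OF B abs_ge_self], of "\<bar>g t\<bar>" t] by (simp add: abs_mult mult.commute)
    then show "AE t in lebesgue_on I. norm (g t * \<eta> t) \<le> norm (B * \<bar>g t\<bar>)" by simp
  qed
qed

text \<open>
  The weak formulation and the weak time derivative together say that the left-hand side is orthogonal
  to all test functions of time. The exceptional null set depends on \<open>v\<close>.
\<close>

lemma equation_AE:
  assumes weak: "weak_solution \<Omega> f h u" and cont: "continuous_on {0..} u" and ab: "0 \<le> a" "a < b"
    and w: "w \<in> bochner_Lp 2 {a<..<b} (L2 \<Omega>) norm" and wt: "weak_time_deriv {a<..<b} \<Omega> u w"
    and v: "v \<in> H10 \<Omega>" "v \<in> L4 \<Omega>"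
  shows "AE t in lebesgue_on {a<..<b}. w t \<bullet> v + (H10_inner \<Omega> (u t) v + react (u t) v - h \<bullet> v) = 0"
proof -
  let ?I = "{a<..<b}" and ?T = "{0<..<b}"
  have sub: "?I \<subseteq> ?T" using ab by auto
  have u2: "u \<in> bochner_Lp 2 ?T (H10 \<Omega>) (H10_norm \<Omega>)" and u4: "u \<in> bochner_Lp 4 ?T (L4 \<Omega>) (L4_norm \<Omega>)"
    using weak ab by (auto simp: weak_solution_def)
  have cI: "continuous_on ?T u" using cont by (rule continuous_on_subset) auto
  have s2: "strongly_measurable ?T (H10 \<Omega>) (H10_norm \<Omega>) u" and s4: "strongly_measurable ?T (L4 \<Omega>) (L4_norm \<Omega>) u"
    using u2 u4 by (auto simp: bochner_Lp_def)
  have L4: "AE t in lebesgue_on ?T. u t \<in> L4 \<Omega>" using s4 by (simp add: strongly_measurable_def)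
  have i2: "integrable (lebesgue_on ?T) (\<lambda>t. H10_norm \<Omega> (u t) ^ 2)"
    by (rule bochner_Lp_integrable[OF u2 H10_norm_measurable[OF s2]]) (auto simp: H10_norm_nonneg)
  have i4: "integrable (lebesgue_on ?T) (\<lambda>t. L4_norm \<Omega> (u t) ^ 4)"
    by (rule bochner_Lp_integrable[OF u4 L4_norm_measurable[OF cI _ L4]]) (auto simp: L4_norm_nonneg)
  have const: "integrable (lebesgue_on ?T) (\<lambda>_. c :: real)" for c
    by (intro finite_measure.integrable_const finite_measure_lebesgue_on bounded_set_imp_lmeasurable) auto
  have iH: "integrable (lebesgue_on ?T) (\<lambda>t. H10_inner \<Omega> (u t) v)"
  proof (rule Bochner_Integration.integrable_bound)
    show "integrable (lebesgue_on ?T) (\<lambda>t. (1 + H10_norm \<Omega> (u t) ^ 2) * H10_norm \<Omega> v)"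
      using i2 const[of 1] by simp
    show "(\<lambda>t. H10_inner \<Omega> (u t) v) \<in> borel_measurable (lebesgue_on ?T)"
      by (rule strongly_measurable_imp_borel_measurable[OF s2 _ H10_inner_tendsto]) auto
    have "\<bar>H10_inner \<Omega> (u t) v\<bar> \<le> (1 + H10_norm \<Omega> (u t) ^ 2) * H10_norm \<Omega> v" for t
      by (rule order_trans[OF H10_inner_Cauchy_Schwarz mult_right_mono[OF order_trans[OF abs_ge_self abs_le_one_plus_square] H10_norm_nonneg]])
    then show "AE t in lebesgue_on ?T. norm (H10_inner \<Omega> (u t) v) \<le> norm ((1 + H10_norm \<Omega> (u t) ^ 2) * H10_norm \<Omega> v)"
      unfolding real_norm_def by (intro AE_I2 order_trans[OF _ abs_ge_self])
  qed
  have iR: "integrable (lebesgue_on ?T) (\<lambda>t. react (u t) v)"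
  proof (rule Bochner_Integration.integrable_bound)
    let ?B = "\<lambda>t. C1 * (measure lebesgue \<Omega> + L4_norm \<Omega> (u t) ^ 4 + 2 * L4_norm \<Omega> v ^ 4)"
    show "integrable (lebesgue_on ?T) ?B"
      by (intro integrable_mult_right Bochner_Integration.integrable_add const i4)
    show "(\<lambda>t. react (u t) v) \<in> borel_measurable (lebesgue_on ?T)"
      by (rule react_measurable[OF cI _ L4 v(2)]) simp
    show "AE t in lebesgue_on ?T. norm (react (u t) v) \<le> norm (?B t)"
      using L4
    proof eventually_elim
      case (elim t)
      show ?case unfolding real_norm_def by (rule order_trans[OF react_integrable(2)[OF elim v(2)] abs_ge_self])
    qed
  qed
  define k where "k t = H10_inner \<Omega> (u t) v + react (u t) v - h \<bullet> v" for t
  have ik: "integrable (lebesgue_on ?T) k"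
    unfolding k_def by (intro Bochner_Integration.integrable_diff Bochner_Integration.integrable_add iH iR const)
  then have ikI: "integrable (lebesgue_on ?I) k"
    by (rule integrable_lebesgue_on_subset[OF _ sub]) auto
  note iw = integrable_norm_if_square(2)[OF w, of v]
  have vL2: "v \<in> L2 \<Omega>" using v(1) by (rule H10_imp_L2)
  have "AE t in lebesgue_on ?I. w t \<bullet> v + k t = 0"
  proof (rule fundamental_lemma_of_variations)
    show "integrable (lebesgue_on ?I) (\<lambda>t. w t \<bullet> v + k t)" using iw ikI by simp
    fix \<eta> assume \<eta>: "\<eta> \<in> test_functions ?I"
    have \<eta>T: "\<eta> \<in> test_functions ?T" using \<eta> test_functions_mono[OF sub] by blast
    have "- (LINT t|lebesgue_on ?T. (u t \<bullet> v) * deriv \<eta> t) + (LINT t|lebesgue_on ?T. k t * \<eta> t) = 0"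
      using weak ab v(1) \<eta>T unfolding weak_solution_def k_def react_def by (meson le_less_trans)
    then have "- (LINT t|lebesgue_on ?I. (u t \<bullet> v) * deriv \<eta> t) + (LINT t|lebesgue_on ?I. k t * \<eta> t) = 0"
      using integral_times_test_eq[OF \<eta> sub] integral_times_test_eq[OF test_function_deriv[OF \<eta>] sub]
        integral_times_test_eq[OF \<eta> order_refl] integral_times_test_eq[OF test_function_deriv[OF \<eta>] order_refl]
      by simp
    moreover have "(LINT t|lebesgue_on ?I. (u t \<bullet> v) * deriv \<eta> t) = - (LINT t|lebesgue_on ?I. (w t \<bullet> v) * \<eta> t)"
      using wt vL2 \<eta> unfolding weak_time_deriv_def by blast
    ultimately show "(LINT t|lebesgue_on ?I. (w t \<bullet> v + k t) * \<eta> t) = 0"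
      using integrable_times_test[OF iw \<eta>] integrable_times_test[OF ikI \<eta>] by (simp add: distrib_right)
  qed simp
  then show ?thesis by (simp add: k_def)
qed

text \<open>
  For almost every \<open>t\<close> the equation holds for all \<open>v\<close> in a countable set of values of \<open>u\<close> at once, and
  \<open>u(t)\<close> is a limit of such \<open>v\<close> in \<open>H\<^sub>0\<^sup>1\<close>, in \<open>L\<^sup>4\<close> and, by the Poincare inequality, in \<open>L\<^sup>2\<close>.
\<close>

lemma energy_equation_AE:
  assumes weak: "weak_solution \<Omega> f h u" and cont: "continuous_on {0..} u" and ab: "0 \<le> a" "a < b"
    and w: "w \<in> bochner_Lp 2 {a<..<b} (L2 \<Omega>) norm" and wt: "weak_time_deriv {a<..<b} \<Omega> u w"
  shows "AE t in lebesgue_on {a<..<b}. u t \<in> H10 \<Omega> \<and> u t \<in> L4 \<Omega> \<and>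
    w t \<bullet> u t + ((H10_norm \<Omega> (u t))\<^sup>2 + react (u t) (u t) - h \<bullet> u t) = 0"
proof -
  let ?I = "{a<..<b}" and ?T = "{0<..<b}"
  have sub: "?I \<subseteq> ?T" using ab by auto
  have "u \<in> bochner_Lp 2 ?T (H10 \<Omega>) (H10_norm \<Omega>)" "u \<in> bochner_Lp 4 ?T (L4 \<Omega>) (L4_norm \<Omega>)"
    using weak ab by (auto simp: weak_solution_def)
  then have s: "strongly_measurable ?I (H10 \<Omega>) (H10_norm \<Omega>) u" "strongly_measurable ?I (L4 \<Omega>) (L4_norm \<Omega>) u"
    using strongly_measurable_subset[OF _ sub] by (auto simp: bochner_Lp_def)
  obtain P where P: "P > 0" "\<And>u. u \<in> H10 \<Omega> \<Longrightarrow> norm u \<le> P * H10_norm \<Omega> u" using poincare_inequality by blast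
  obtain D where D: "countable D" "D \<subseteq> H10 \<Omega> \<inter> L4 \<Omega>"
    "AE t in lebesgue_on ?I. u t \<in> H10 \<Omega> \<and> u t \<in> L4 \<Omega> \<and>
       (\<forall>\<delta>>0. \<exists>v\<in>D. H10_norm \<Omega> (v - u t) < \<delta> \<and> L4_norm \<Omega> (v - u t) < \<delta>)"
  proof (rule AE_simultaneous_approximation_by_own_values[OF s, of 1 8])
    show "H10_norm \<Omega> (x - z) \<le> 1 * (H10_norm \<Omega> (y - x) + H10_norm \<Omega> (y - z))"
      if "x \<in> H10 \<Omega>" "y \<in> H10 \<Omega>" "z \<in> H10 \<Omega>" for x y z
      using H10_norm_triangle[OF that] H10_norm_commute[of x y] by simp
  qed (use L4_norm_quasi_triangle in auto)
  have "AE t in lebesgue_on ?I. \<forall>v\<in>D. w t \<bullet> v + (H10_inner \<Omega> (u t) v + react (u t) v - h \<bullet> v) = 0"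
    unfolding AE_ball_countable[OF D(1)]
    using equation_AE[OF weak cont ab w wt] D(2) by blast
  with D(3) show ?thesis
  proof eventually_elim
    case (elim t)
    have uH: "u t \<in> H10 \<Omega>" and uL: "u t \<in> L4 \<Omega>" using elim by auto
    have "\<exists>v\<in>D. H10_norm \<Omega> (v - u t) < inverse (real (Suc n)) \<and> L4_norm \<Omega> (v - u t) < inverse (real (Suc n))" for n
      using elim by simp
    then obtain v where v: "\<And>n. v n \<in> D" "\<And>n. H10_norm \<Omega> (v n - u t) < inverse (real (Suc n))"
      "\<And>n. L4_norm \<Omega> (v n - u t) < inverse (real (Suc n))" by metis
    have vHL: "v n \<in> H10 \<Omega>" "v n \<in> L4 \<Omega>" for n using v(1) D(2) by auto
    have lim: "(\<lambda>n. H10_norm \<Omega> (v n - u t)) \<longlonglongrightarrow> 0" "(\<lambda>n. L4_norm \<Omega> (v n - u t)) \<longlonglongrightarrow> 0"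
      by (rule Lim_null_comparison[OF _ LIMSEQ_inverse_real_of_nat],
          use v H10_norm_nonneg L4_norm_nonneg in \<open>auto intro!: always_eventually less_imp_le simp del: of_nat_Suc\<close>)+
    have "(\<lambda>n. norm (v n - u t)) \<longlonglongrightarrow> 0"
    proof (rule Lim_null_comparison)
      show "eventually (\<lambda>n. norm (norm (v n - u t)) \<le> P * H10_norm \<Omega> (v n - u t)) sequentially"
        using P(2)[OF H10_diff[OF vHL(1) uH]] by simp
      show "(\<lambda>n. P * H10_norm \<Omega> (v n - u t)) \<longlonglongrightarrow> 0" using tendsto_mult[OF tendsto_const lim(1), of P] by simp
    qed
    then have vlim: "v \<longlonglongrightarrow> u t" by (simp add: tendsto_norm_zero_iff LIM_zero_iff)
    have "(\<lambda>n. w t \<bullet> v n + (H10_inner \<Omega> (v n) (u t) + react (u t) (v n) - h \<bullet> v n))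
       \<longlonglongrightarrow> w t \<bullet> u t + (H10_inner \<Omega> (u t) (u t) + react (u t) (u t) - h \<bullet> u t)"
      by (intro tendsto_intros vlim H10_inner_tendsto react_tendsto vHL uH uL lim)
    moreover have "w t \<bullet> v n + (H10_inner \<Omega> (v n) (u t) + react (u t) (v n) - h \<bullet> v n) = 0" for n
      using elim v(1) H10_inner_commute by metis
    ultimately have "w t \<bullet> u t + (H10_inner \<Omega> (u t) (u t) + react (u t) (u t) - h \<bullet> u t) = 0"
      by (simp add: LIMSEQ_const_iff)
    then show ?case using uH uL by (simp add: H10_norm_square)
  qed
qed

text \<open>
  If \<open>|u(s)|\<^sub>H\<^sup>2 > M\<close> for almost all \<open>s\<close>, the energy equation gives \<open>w \<bullet> u \<le> K - M / 2\<close> with \<open>K\<close> depending on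
  \<open>C2\<close>, \<open>h\<close> and the Poincare constant. Over a time interval of length at least \<open>1/2\<close> the quantity \<open>|u|\<^sup>2\<close>
  would then drop by more than its initial value.
\<close>

lemma regular_solutions_enter_bounded_set:
  obtains M where "\<And>u. u \<in> K_r \<Omega> f h \<Longrightarrow> norm (u 0) \<le> R \<Longrightarrow>
    \<exists>s. 0 < s \<and> s < 1 \<and> u s \<in> H10 \<Omega> \<and> H10_norm \<Omega> (u s) \<le> M"
proof -
  obtain P where P: "P > 0" "\<And>u. u \<in> H10 \<Omega> \<Longrightarrow> norm u \<le> P * H10_norm \<Omega> u" using poincare_inequality by blast
  define K where "K = C2 * measure lebesgue \<Omega> + (P * norm h)\<^sup>2 / 2"
  \<comment> \<open>This choice makes \<open>K - M / 2 < - (R + 1)\<^sup>2\<close>, a larger decrease than \<open>|u|\<^sup>2 \<le> (R + 1)\<^sup>2\<close> admits.\<close>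
  define M where "M = 2 * K + 2 * (R + 1)\<^sup>2 + 1"
  have "\<exists>s. 0 < s \<and> s < 1 \<and> u s \<in> H10 \<Omega> \<and> H10_norm \<Omega> (u s) \<le> sqrt M"
    if u: "u \<in> K_r \<Omega> f h" and R: "norm (u 0) \<le> R" for u
  proof (rule ccontr)
    assume no: "\<not> ?thesis"
    have reg: "regular_solution \<Omega> f h u" and c: "continuous_on {0..} u" and L: "u ` {0..} \<subseteq> L2 \<Omega>"
      using u by (auto simp: K_r_def)
    have weak: "weak_solution \<Omega> f h u" using reg by (simp add: regular_solution_def)
    obtain d where d: "d > 0" "\<And>t. t \<ge> 0 \<Longrightarrow> dist t 0 < d \<Longrightarrow> dist (u t) (u 0) < 1"
      using c[unfolded continuous_on_iff, rule_format, of 0 1] by auto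
    \<comment> \<open>The estimate starts at a small \<open>\<epsilon> > 0\<close> instead of zero, where \<open>u\<close> is not known to be regular;
      continuity keeps \<open>|u(\<epsilon>)| \<le> R + 1\<close>.\<close>
    define \<epsilon> where "\<epsilon> = min (d / 2) (1/4)"
    have \<epsilon>: "0 < \<epsilon>" "\<epsilon> \<le> 1/4" "\<epsilon> < d" using d(1) by (auto simp: \<epsilon>_def)
    have "dist (u \<epsilon>) (u 0) < 1" using d(2)[of \<epsilon>] \<epsilon> by simp
    then have u\<epsilon>: "norm (u \<epsilon>) \<le> R + 1" using R norm_triangle_sub[of "u \<epsilon>" "u 0"] by (simp add: dist_norm)
    let ?I = "{\<epsilon>/2<..<1}"
    obtain w where w: "w \<in> bochner_Lp 2 ?I (L2 \<Omega>) norm" "weak_time_deriv ?I \<Omega> u w"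
      using conjunct2[OF reg[unfolded regular_solution_def], rule_format, of "\<epsilon>/2" 1] \<epsilon> by auto
    have cI: "continuous_on ?I u" by (rule continuous_on_subset[OF c]) (use \<epsilon> in auto)
    have energy: "AE t in lebesgue_on ?I. u t \<in> H10 \<Omega> \<and> u t \<in> L4 \<Omega> \<and>
      w t \<bullet> u t + ((H10_norm \<Omega> (u t))\<^sup>2 + react (u t) (u t) - h \<bullet> u t) = 0"
      by (rule energy_equation_AE[OF weak c _ _ w]) (use \<epsilon> in auto)
    have tI: "AE t in lebesgue_on ?I. t \<in> ?I" by (simp add: AE_restrict_space_iff)
    have "(norm (u (3/4)))\<^sup>2 - (norm (u \<epsilon>))\<^sup>2 \<le> 2 * (K - M / 2) * (3/4 - \<epsilon>)"
    proof (rule norm_square_increment_le[OF cI w(1)])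
      fix r s t assume r: "r \<in> ?I" and st: "\<epsilon>/2 < s" "s \<le> t" "t < 1"
      have rL: "u r \<in> L2 \<Omega>" using L r \<epsilon> by auto
      show "u t \<bullet> u r - u s \<bullet> u r = (LINT x|lebesgue_on {s<..t}. w x \<bullet> u r)"
      proof (rule weak_derivative_imp_increment[OF _ _ _ st])
        show "continuous_on ?I (\<lambda>t. u t \<bullet> u r)" by (intro continuous_intros cI)
        show "integrable (lebesgue_on ?I) (\<lambda>t. w t \<bullet> u r)" by (rule integrable_norm_if_square[OF w(1)])
      qed (use w(2) rL in \<open>auto simp: weak_time_deriv_def\<close>)
    next
      show "AE t in lebesgue_on ?I. w t \<bullet> u t \<le> K - M / 2"
        using energy tI
      proof eventually_elim
        case (elim t)
        let ?H = "H10_norm \<Omega> (u t)"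
        have "0 < t" "t < 1" using elim \<epsilon> by auto
        then have "?H > sqrt M" using no elim by (meson not_le)
        then have "M < ?H\<^sup>2" using real_le_lsqrt[of M ?H] H10_norm_nonneg[of "u t"] not_le real_le_rsqrt real_sqrt_le_iff real_sqrt_unique by (metis real_sqrt_less_iff) 
        moreover have "react (u t) (u t) \<ge> - (C2 * measure lebesgue \<Omega>)" using elim by (intro react_self_ge) auto
        moreover have "h \<bullet> u t \<le> (P * norm h)\<^sup>2 / 2 + ?H\<^sup>2 / 2"
        proof -
          have "h \<bullet> u t \<le> norm h * norm (u t)" by (rule norm_cauchy_schwarz)
          also have "\<dots> \<le> norm h * (P * ?H)" using elim P(2) by (intro mult_left_mono) auto
          also have "\<dots> \<le> (P * norm h)\<^sup>2 / 2 + ?H\<^sup>2 / 2"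
            using sum_squares_bound[of "P * norm h" ?H] by (simp add: algebra_simps)
          finally show ?thesis .
        qed
        ultimately show ?case using elim by (simp add: K_def field_simps)
      qed
    qed (use \<epsilon> in auto)
    also have "\<dots> \<le> (K - M / 2)"
    proof -
      have "K - M / 2 = - (R + 1)\<^sup>2 - 1 / 2" by (simp add: M_def add_divide_distrib)
      then have "K - M / 2 \<le> 0" using zero_le_power2[of "R + 1"] by linarith
      moreover have "2 * (3/4 - \<epsilon>) \<ge> 1" using \<epsilon> by simp
      ultimately have "(K - M / 2) * (2 * (3/4 - \<epsilon>)) \<le> (K - M / 2) * 1" by (rule mult_left_mono_neg[rotated])
      moreover have "2 * (K - M / 2) * (3/4 - \<epsilon>) = (K - M / 2) * (2 * (3/4 - \<epsilon>))" by (simp only: mult_ac)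
      ultimately show ?thesis by simp
    qed
    also have "\<dots> = - (R + 1)\<^sup>2 - 1 / 2" by (simp add: M_def add_divide_distrib)
    finally have "(norm (u (3/4)))\<^sup>2 \<le> (norm (u \<epsilon>))\<^sup>2 - (R + 1)\<^sup>2 - 1 / 2" by simp
    moreover have "(norm (u \<epsilon>))\<^sup>2 \<le> (R + 1)\<^sup>2" by (rule power_mono[OF u\<epsilon>]) simp
    moreover have "0 \<le> (norm (u (3/4)))\<^sup>2" by simp
    ultimately show False by linarith
  qed
  then show ?thesis using that by blast
qed

end

section \<open>Attractors\<close>

text \<open>
  A set that is compact for a norm \<open>N\<close> dominating the ambient norm is closed for the ambient norm: a
  sequence in \<open>\<Theta>\<close> approaching \<open>x\<close> has a subsequence with an \<open>N\<close>-limit in \<open>\<Theta>\<close>, which must be \<open>x\<close>.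
\<close>

lemma compactin_norm_topology_imp_norm_closed:
  fixes \<Theta> :: "'b::real_normed_vector set"
  assumes M: "Metric_space X (\<lambda>x y. N (x - y))" and \<Theta>: "compactin (norm_topology X N) \<Theta>"
    and dom: "\<And>x y. x \<in> X \<Longrightarrow> y \<in> X \<Longrightarrow> norm (x - y) \<le> C * N (x - y)"
    and x: "\<And>e. e > 0 \<Longrightarrow> \<exists>y\<in>\<Theta>. norm (x - y) < e"
  shows "x \<in> \<Theta>"
proof -
  interpret Metric_space X "\<lambda>x y. N (x - y)" by (rule M)
  have \<Theta>X: "\<Theta> \<subseteq> X" using \<Theta> compactin_subset_topspace unfolding norm_topology_def topspace_mtopology by (metis topspace_mtopology)
  have "\<exists>y\<in>\<Theta>. norm (x - y) < inverse (real (Suc n))" for n using x by simp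
  then obtain y where y: "\<And>n. y n \<in> \<Theta>" "\<And>n. norm (x - y n) < inverse (real (Suc n))" by metis
  obtain l r where l: "l \<in> \<Theta>" "strict_mono r" "limitin mtopology (y \<circ> r) l sequentially"
    using \<Theta> y(1) unfolding norm_topology_def compactin_sequentially by (metis image_subsetI)
  have "(\<lambda>n. norm (x - y n)) \<longlonglongrightarrow> 0"
    by (rule Lim_null_comparison[OF _ LIMSEQ_inverse_real_of_nat]) (use y(2) in \<open>auto intro!: always_eventually less_imp_le simp del: of_nat_Suc\<close>)
  then have "(\<lambda>n. norm (y n - x)) \<longlonglongrightarrow> 0" by (simp only: norm_minus_commute)
  then have "y \<longlonglongrightarrow> x" by (simp add: tendsto_norm_zero_iff LIM_zero_iff)
  then have 1: "(y \<circ> r) \<longlonglongrightarrow> x" using l(2) by (rule LIMSEQ_subseq_LIMSEQ)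
  have lim: "(\<lambda>n. N ((y \<circ> r) n - l)) \<longlonglongrightarrow> 0"
    using l(3) unfolding limitin_metric_dist_null by simp
  have "(\<lambda>n. norm ((y \<circ> r) n - l)) \<longlonglongrightarrow> 0"
  proof (rule Lim_null_comparison)
    show "eventually (\<lambda>n. norm (norm ((y \<circ> r) n - l)) \<le> C * N ((y \<circ> r) n - l)) sequentially"
      using dom y(1) l(1) \<Theta>X by (intro always_eventually) auto
    show "(\<lambda>n. C * N ((y \<circ> r) n - l)) \<longlonglongrightarrow> 0" using tendsto_mult[OF tendsto_const lim, of C] by simp
  qed
  then have "(y \<circ> r) \<longlonglongrightarrow> l" by (simp add: tendsto_norm_zero_iff LIM_zero_iff comp_def)
  with 1 have "x = l" by (rule LIMSEQ_unique)
  then show ?thesis using l(1) by simp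
qed

lemma compactin_norm_topology_imp_bounded:
  fixes \<Theta> :: "'b::real_normed_vector set"
  assumes M: "Metric_space X (\<lambda>x y. N (x - y))" and \<Theta>: "compactin (norm_topology X N) \<Theta>"
    and dom: "\<And>x y. x \<in> X \<Longrightarrow> y \<in> X \<Longrightarrow> norm (x - y) \<le> C * N (x - y)" and C: "C \<ge> 0"
  obtains R where "\<And>x. x \<in> \<Theta> \<Longrightarrow> norm x \<le> R"
proof -
  interpret Metric_space X "\<lambda>x y. N (x - y)" by (rule M)
  have "mbounded \<Theta>" using \<Theta> compactin_imp_mbounded unfolding norm_topology_def by blast
  then obtain c B where cB: "\<Theta> \<subseteq> mcball c B" by (auto simp: mbounded_def)
  have "norm x \<le> norm c + C * B" if "x \<in> \<Theta>" for x
  proof -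
    have "x \<in> X" "c \<in> X" "N (c - x) \<le> B" using cB that by auto
    then have "norm (c - x) \<le> C * B" using dom[of c x] C by (meson mult_left_mono order_trans)
    then show ?thesis using norm_triangle_sub[of x c] by (simp add: norm_minus_commute)
  qed
  then show ?thesis using that by blast
qed

lemma attracts_bounded_eventually_near:
  assumes A: "attracts_bounded X N G \<Theta>" and B: "B \<subseteq> X" "\<And>x. x \<in> B \<Longrightarrow> N x \<le> M" and e: "e > 0"
  obtains T where "\<And>t x z. t \<ge> T \<Longrightarrow> x \<in> B \<Longrightarrow> z \<in> G t x \<Longrightarrow> \<exists>y\<in>\<Theta>. N (z - y) < e"
proof -
  have "((\<lambda>t. semidist N (\<Union>x\<in>B. G t x) \<Theta>) \<longlongrightarrow> 0) at_top"
    using A B unfolding attracts_bounded_def by blast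
  then have "eventually (\<lambda>t. semidist N (\<Union>x\<in>B. G t x) \<Theta> < ennreal e) at_top"
    by (rule order_tendstoD(2)) (use e in simp)
  then obtain T where T: "\<And>t. t \<ge> T \<Longrightarrow> semidist N (\<Union>x\<in>B. G t x) \<Theta> < ennreal e"
    by (auto simp: eventually_at_top_linorder)
  have "\<exists>y\<in>\<Theta>. N (z - y) < e" if "t \<ge> T" "x \<in> B" "z \<in> G t x" for t x z
  proof -
    have "(INF y\<in>\<Theta>. ennreal (N (z - y))) \<le> semidist N (\<Union>x\<in>B. G t x) \<Theta>"
      unfolding semidist_def by (rule SUP_upper2[of z]) (use that in auto)
    also have "\<dots> < ennreal e" by (rule T[OF that(1)])
    finally obtain y where "y \<in> \<Theta>" "ennreal (N (z - y)) < ennreal e" unfolding INF_less_iff by blast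
    then show ?thesis using e by (intro bexI[of _ y]) (auto simp: ennreal_less_iff intro: ccontr dest: ennreal_leI)
  qed
  then show ?thesis using that by blast
qed

lemma Metric_space_norm: "Metric_space X (\<lambda>x y :: 'b::real_normed_vector. norm (x - y))"
  by unfold_locales (auto simp: norm_minus_commute intro: norm_diff_triangle_le)

context bounded_open
begin

lemma Metric_space_H10: "Metric_space (H10 \<Omega>) (\<lambda>x y. H10_norm \<Omega> (x - y))"
proof
  fix x y z
  show "0 \<le> H10_norm \<Omega> (x - y)" by (rule H10_norm_nonneg)
  show "H10_norm \<Omega> (x - y) = H10_norm \<Omega> (y - x)" by (rule H10_norm_commute)
  assume x: "x \<in> H10 \<Omega>" and y: "y \<in> H10 \<Omega>"
  obtain P where P: "P > 0" "\<And>u. u \<in> H10 \<Omega> \<Longrightarrow> norm u \<le> P * H10_norm \<Omega> u" using poincare_inequality by blast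
  have "H10_norm \<Omega> (x - x) = 0"
    unfolding H10_norm_L2_set L2_set_def using H1_diff(2)[OF H10_imp_H1[OF x] H10_imp_H1[OF x]] by simp
  then show "H10_norm \<Omega> (x - y) = 0 \<longleftrightarrow> x = y"
    using P(2)[OF H10_diff[OF x y]] by auto
  assume z: "z \<in> H10 \<Omega>"
  show "H10_norm \<Omega> (x - z) \<le> H10_norm \<Omega> (x - y) + H10_norm \<Omega> (y - z)"
    by (rule H10_norm_triangle[OF x y z])
qed

end

context reaction_diffusion
begin

lemma AE_regular_solution_in_H10:
  assumes "u \<in> K_r \<Omega> f h" "T > 0"
  shows "AE t in lebesgue_on {0<..<T}. u t \<in> H10 \<Omega>"
  using assms by (auto simp: K_r_def regular_solution_def weak_solution_def bochner_Lp_def strongly_measurable_def)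

lemma attractor_strong_subset_regular:
  assumes r: "global_attractor (L2 \<Omega>) norm (G_r \<Omega> f h) \<Theta>_r" "compactin (norm_topology (L2 \<Omega>) norm) \<Theta>_r"
    and s: "global_attractor (H10 \<Omega>) (H10_norm \<Omega>) (G_s \<Omega> f h) \<Theta>_s" "compactin (norm_topology (H10 \<Omega>) (H10_norm \<Omega>)) \<Theta>_s"
  shows "\<Theta>_s \<subseteq> \<Theta>_r"
proof
  fix x assume x: "x \<in> \<Theta>_s"
  obtain P where P: "P > 0" "\<And>u. u \<in> H10 \<Omega> \<Longrightarrow> norm u \<le> P * H10_norm \<Omega> u" using poincare_inequality by blast
  obtain R where R: "\<And>x. x \<in> \<Theta>_s \<Longrightarrow> norm x \<le> R"
    using compactin_norm_topology_imp_bounded[OF Metric_space_H10 s(2), of P] P H10_diff by (metis less_imp_le)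
  have sub: "\<Theta>_s \<subseteq> L2 \<Omega>" using s(1) H10_imp_L2 by (auto simp: global_attractor_def)
  show "x \<in> \<Theta>_r"
  proof (rule compactin_norm_topology_imp_norm_closed[OF Metric_space_norm r(2), of 1])
    fix e :: real assume e: "e > 0"
    have "attracts_bounded (L2 \<Omega>) norm (G_r \<Omega> f h) \<Theta>_r" using r(1) by (simp add: global_attractor_def)
    from attracts_bounded_eventually_near[OF this sub R e] obtain T where
      T: "\<And>t x z. t \<ge> T \<Longrightarrow> x \<in> \<Theta>_s \<Longrightarrow> z \<in> G_r \<Omega> f h t x \<Longrightarrow> \<exists>y\<in>\<Theta>_r. norm (z - y) < e" by blast
    have "\<forall>t\<ge>0. \<Theta>_s \<subseteq> (\<Union>y\<in>\<Theta>_s. G_s \<Omega> f h t y)" using s(1) by (simp add: global_attractor_def)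
    then have "x \<in> (\<Union>y\<in>\<Theta>_s. G_s \<Omega> f h (max T 0) y)" using x max.cobounded2 by blast
    then obtain y where "y \<in> \<Theta>_s" "x \<in> G_r \<Omega> f h (max T 0) y"
      using K_s_subset_K_r[of \<Omega> f h] by (auto simp: G_r_def G_s_def)
    then show "\<exists>y\<in>\<Theta>_r. norm (x - y) < e" using T[of "max T 0" y x] by simp
  qed auto
qed

text \<open>
  For \<open>x \<in> \<Theta>\<^sub>r\<close> and large \<open>t\<close> write \<open>x = u(t)\<close> with \<open>u(0) \<in> \<Theta>\<^sub>r\<close>, and let \<open>\<sigma>\<close> be a time in \<open>(0,1)\<close> at which
  \<open>u\<close> meets the fixed ball \<open>B\<close> of \<open>H\<^sub>0\<^sup>1\<close>. The solution restarted at \<open>\<sigma>\<close> is strong, hence \<open>u(t')\<close> is close to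
  \<open>\<Theta>\<^sub>s\<close> for every \<open>t' \<ge> t\<close> with \<open>u(t') \<in> H\<^sub>0\<^sup>1\<close>; such \<open>t'\<close> exist arbitrarily close to \<open>t\<close>.
\<close>

lemma attractor_regular_subset_strong:
  assumes r: "global_attractor (L2 \<Omega>) norm (G_r \<Omega> f h) \<Theta>_r" "compactin (norm_topology (L2 \<Omega>) norm) \<Theta>_r"
    and s: "global_attractor (H10 \<Omega>) (H10_norm \<Omega>) (G_s \<Omega> f h) \<Theta>_s" "compactin (norm_topology (H10 \<Omega>) (H10_norm \<Omega>)) \<Theta>_s"
  shows "\<Theta>_r \<subseteq> \<Theta>_s"
proof
  fix x assume x: "x \<in> \<Theta>_r"
  obtain P where P: "P > 0" "\<And>u. u \<in> H10 \<Omega> \<Longrightarrow> norm u \<le> P * H10_norm \<Omega> u" using poincare_inequality by blast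
  obtain R where R: "\<And>x. x \<in> \<Theta>_r \<Longrightarrow> norm x \<le> R"
    using compactin_norm_topology_imp_bounded[OF Metric_space_norm r(2), of 1] by auto
  obtain M where M: "\<And>u. u \<in> K_r \<Omega> f h \<Longrightarrow> norm (u 0) \<le> R \<Longrightarrow>
    \<exists>s. 0 < s \<and> s < 1 \<and> u s \<in> H10 \<Omega> \<and> H10_norm \<Omega> (u s) \<le> M"
    using regular_solutions_enter_bounded_set[of R] by blast
  define B where "B = {y \<in> H10 \<Omega>. H10_norm \<Omega> y \<le> M}"
  have \<Theta>sH: "\<Theta>_s \<subseteq> H10 \<Omega>" using s(1) by (simp add: global_attractor_def)
  show "x \<in> \<Theta>_s"
  proof (rule compactin_norm_topology_imp_norm_closed[OF Metric_space_H10 s(2), of P])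
    show "norm (y - z) \<le> P * H10_norm \<Omega> (y - z)" if "y \<in> H10 \<Omega>" "z \<in> H10 \<Omega>" for y z
      by (rule P(2)[OF H10_diff[OF that]])
    fix e :: real assume e: "e > 0"
    have A: "attracts_bounded (H10 \<Omega>) (H10_norm \<Omega>) (G_s \<Omega> f h) \<Theta>_s" using s(1) by (simp add: global_attractor_def)
    have B: "B \<subseteq> H10 \<Omega>" "\<And>y. y \<in> B \<Longrightarrow> H10_norm \<Omega> y \<le> M" "e / (2 * P) > 0"
      using e P(1) by (simp_all add: B_def subset_iff)
    from attracts_bounded_eventually_near[OF A B] obtain T where
      T: "\<And>t y z. t \<ge> T \<Longrightarrow> y \<in> B \<Longrightarrow> z \<in> G_s \<Omega> f h t y \<Longrightarrow> \<exists>y\<in>\<Theta>_s. H10_norm \<Omega> (z - y) < e / (2 * P)"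
      by blast
    \<comment> \<open>The extra unit of time pays for \<open>\<sigma> < 1\<close>.\<close>
    define t where "t = max T 0 + 1"
    have t: "t \<ge> 1" "t \<ge> T + 1" by (auto simp: t_def)
    have "\<forall>t\<ge>0. \<Theta>_r \<subseteq> (\<Union>y\<in>\<Theta>_r. G_r \<Omega> f h t y)" using r(1) by (simp add: global_attractor_def)
    then have "x \<in> (\<Union>y\<in>\<Theta>_r. G_r \<Omega> f h t y)" using x t(1) by (meson order_trans subsetD zero_le_one)
    then obtain u where u: "u \<in> K_r \<Omega> f h" "u 0 \<in> \<Theta>_r" "x = u t" by (auto simp: G_r_def)
    obtain \<sigma> where \<sigma>: "0 < \<sigma>" "\<sigma> < 1" "u \<sigma> \<in> B" using M[OF u(1) R[OF u(2)]] by (auto simp: B_def)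
    have "continuous_on {0..} u" using u(1) by (simp add: K_r_def)
    then obtain d where d: "d > 0" "\<And>t'. t' \<ge> 0 \<Longrightarrow> dist t' t < d \<Longrightarrow> dist (u t') (u t) < e / 2"
      using t e unfolding continuous_on_iff
      by (metis atLeast_iff half_gt_zero order_trans zero_le_one)
    have "\<exists>t'\<in>{t<..<t + d}. u t' \<in> H10 \<Omega>"
    proof (rule ccontr)
      assume no: "\<not> ?thesis"
      have "AE t' in lebesgue_on {0<..<t + d}. u t' \<in> H10 \<Omega>"
        by (rule AE_regular_solution_in_H10[OF u(1)]) (use t d in simp)
      then have "AE t' in lebesgue_on {t<..<t + d}. u t' \<in> H10 \<Omega>"
        by (rule AE_lebesgue_on_subset[rotated 3]) (use t in auto)
      moreover have "AE t' in lebesgue_on {t<..<t + d}. t' \<in> {t<..<t + d}" by (simp add: AE_restrict_space_iff)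
      ultimately have "AE t' in lebesgue_on {t<..<t + d}. False"
        by eventually_elim (use no in blast)
      then have "emeasure (lebesgue_on {t<..<t + d}) (space (lebesgue_on {t<..<t + d})) = 0"
        using AE_iff_measurable[of "{t<..<t + d}" "lebesgue_on {t<..<t + d}" "\<lambda>_. False"] by (simp add: set_eq_iff)
      then show False using d(1) by (simp add: emeasure_restrict_space)
    qed
    then obtain t' where t': "t < t'" "t' < t + d" "u t' \<in> H10 \<Omega>" by auto
    have "u t' \<in> G_s \<Omega> f h (t' - \<sigma>) (u \<sigma>)"
      unfolding G_s_def using K_r_shift_in_K_s[OF u(1) \<sigma>(1)]
      by (intro CollectI exI[of _ "\<lambda>r. u (r + \<sigma>)"]) simp
    then obtain y where y: "y \<in> \<Theta>_s" "H10_norm \<Omega> (u t' - y) < e / (2 * P)"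
      using T[of "t' - \<sigma>" "u \<sigma>"] \<sigma> t t' by auto
    have "norm (u t' - y) \<le> P * H10_norm \<Omega> (u t' - y)"
      by (rule P(2)[OF H10_diff[OF t'(3)]]) (use y \<Theta>sH in auto)
    also have "\<dots> < e / 2" using y(2) P(1) by (simp add: field_simps)
    finally have "norm (u t' - y) < e / 2" .
    moreover have "norm (u t - u t') < e / 2"
      using d(2)[of t'] t t' by (simp add: dist_norm norm_minus_commute)
    ultimately have "norm (x - y) < e"
      using norm_triangle_ineq[of "u t - u t'" "u t' - y"] u(3) by simp
    then show "\<exists>y\<in>\<Theta>_s. norm (x - y) < e" using y(1) by blast
  qed
qed

end

theorem lemma43:
  fixes \<Omega> :: "(real ^ 3) set"
    and f :: "real \<Rightarrow> real"
    and h :: "(real ^ 3) l2"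
    and C1 C2 \<alpha> :: real
    and \<Theta>_r \<Theta>_s :: "(real ^ 3) l2 set"
  assumes "open \<Omega>" "connected \<Omega>" "\<Omega> \<noteq> {}" "bounded \<Omega>" "C_k_boundary 2 \<Omega>"
    and "h \<in> L2 \<Omega>"
    and "continuous_on UNIV f"
    and "C1 > 0" "C2 > 0" "\<alpha> > 0"
    and "\<And>u. \<bar>f u\<bar> \<le> C1 * (1 + \<bar>u\<bar> ^ 3)"
    and "\<And>u. f u * u \<ge> \<alpha> * \<bar>u\<bar> ^ 4 - C2"
    and "global_attractor (L2 \<Omega>) norm (G_r \<Omega> f h) \<Theta>_r"
    and "compactin (norm_topology (L2 \<Omega>) norm) \<Theta>_r"
    and "global_attractor (H10 \<Omega>) (H10_norm \<Omega>) (G_s \<Omega> f h) \<Theta>_s"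
    and "compactin (norm_topology (H10 \<Omega>) (H10_norm \<Omega>)) \<Theta>_s"
  shows "\<Theta>_s = \<Theta>_r"
proof -
  have diss: "- C2 \<le> f u * u" for u
  proof -
    have "0 \<le> \<alpha> * \<bar>u\<bar> ^ 4" using assms(10) by simp
    then show ?thesis using assms(12)[of u] by linarith
  qed
  interpret reaction_diffusion \<Omega> f h C1 C2
    by unfold_locales (fact assms diss)+
  show ?thesis
    using attractor_strong_subset_regular[OF assms(13-16)] attractor_regular_subset_strong[OF assms(13-16)] by blast
qed

end
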